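(* Let $m\ge 2$ and $0\le s\le m$, $k\in\mathbb{N}_0$. Put $$\mathcal{I}_k^s=\mathrm{Ker}_k^s\underline{\partial}^+\oplus\big(\mathrm{Ker}_k^{s-1}\underline{\partial}^-\big)e_m .$$ (i) The Cauchy–Kovalevskaya extension operator $CK$ restricts to a linear isomorphism of $\mathcal{I}_k^s$ onto $\mathcal{H}_k^s(\mathbb{R}^m)$, and this isomorphism intertwines the H-action of $Pin(m-1)$. (ii) Moreover, if $u_0\in\mathrm{Ker}_k^s\underline{\partial}^+$ and $v_0\in\mathrm{Ker}_k^{s-1}\underline{\partial}^-$, then $$CK(u_0+v_0e_m)(\underline{\mathbf{x}},x_m)=\sum_{j=0}^k\frac{x_m^j}{j!}u_j(\underline{\mathbf{x}})+\sum_{j=0}^k\frac{x_m^j}{j!}v_j(\underline{\mathbf{x}})e_m,$$ where for $t\ge 0$ $$u_{2t}=(\underline{\partial}^+\underline{\partial}^-)^tu_0,\quad u_{2t+1}=(-1)^{s-1}(\underline{\partial}^+\underline{\partial}^-)^t\underline{\partial}^+v_0,$$ $$v_{2t}=(\underline{\partial}^-\underline{\partial}^+)^tv_0,\quad v_{2t+1}=(-1)^{s-1}(\underline{\partial}^-\underline{\partial}^+)^t\underline{\partial}^-u_0.$$ In addition, for every $p\in\mathcal{H}_k^s(\mathbb{R}^m)$, its restriction $p_0(\underline{\mathbf x})=p(\underline{\mathbf x},0)$ lies in $\mathcal I_k^s$ and $p=CK(p_0)$.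
   Context: $\mathcal{C}\ell_m$ denotes either the real Clifford algebra $\mathbb{R}_{0,m}$ or the complex Clifford algebra $\mathbb{C}_m$ generated by the standard basis $e_1,\dots,e_m$ of $\mathbb{R}^m$ with relations $e_ie_j+e_je_i=-2\delta_{ij}$; $\mathcal{C}\ell_m=\bigoplus_{s=0}^m\mathcal{C}\ell_m^s$, where $\mathcal{C}\ell_m^s$ is the space of $s$-vectors (spanned by the products $e_{i_1}\cdots e_{i_s}$, $i_1<\dots<i_s$). A point $\mathbf{x}=(x_1,\dots,x_m)$ is identified with the 1-vector $\sum_j x_je_j$. For a 1-vector $u$ and an $s$-vector $v$, $u\bullet v=\frac12(uv-(-1)^svu)$ and $u\wedge v=\frac12(uv+(-1)^svu)$, extended linearly in $v$. $\mathcal P_k^s(\mathbb R^m)$ is the space of $k$-homogeneous $\mathcal C\ell_m^s$-valued polynomials on $\mathbb R^m$ (zero if $k<0$ or $s\notin\{0,\dots,m\}$); $\mathcal{H}_k^s(\mathbb R^m)=\{P\in\mathcal{P}_k^s(\mathbb R^m):\partial P=0\}$ where $\partial=\sum_{j=1}^m e_j\partial_{x_j}$ acts from the left. The H-action of $Pin(m)$ on polynomials is $[H(r)P](\mathbf x)=rP(r^{-1}\mathbf x r)r^{-1}$; $Pin(m-1)\subset Pin(m)$ is generated by unit vectors in $\mathrm{span}(e_1,\dots,e_{m-1})$. Write $\underline{\mathbf{x}}=\sum_{j=1}^{m-1}x_je_j$, $\underline{\partial}=\sum_{j=1}^{m-1}e_j\partial_{x_j}$, $\underline{\partial}^+P=\sum_{j=1}^{m-1}e_j\wedge\partial_{x_j}P$,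 $\underline{\partial}^-P=\sum_{j=1}^{m-1}e_j\bullet\partial_{x_j}P$. $\mathcal{P}_k^s(\mathbb{R}^{m-1})$ denotes the $k$-homogeneous polynomials in $x_1,\dots,x_{m-1}$ with values in the $s$-vectors of the subalgebra $\mathcal{C}\ell_{m-1}$ generated by $e_1,\dots,e_{m-1}$, and $\mathrm{Ker}_k^s\underline{\partial}^{\pm}=\{u\in\mathcal{P}_k^s(\mathbb{R}^{m-1}):\underline{\partial}^{\pm}u=0\}$ (zero if $s<0$ or $s>m-1$). For a $\mathcal{C}\ell_m$-valued polynomial $p_0$ in $\underline{\mathbf x}$, the Cauchy–Kovalevskaya extension is $CK(p_0)(\underline{\mathbf{x}},x_m)=\sum_{j\ge 0}\frac{x_m^j}{j!}(e_m\underline{\partial})^jp_0(\underline{\mathbf{x}})$ (formally $e^{e_mx_m\underline\partial}p_0$). *)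

theory Defs
  imports Complex_Main "HOL-Library.Function_Algebras"
begin

text \<open>An element of the Clifford algebra generated by e_1,...,e_m is represented by its
  coefficient function on blades: x B is the coefficient of e_B = e_{i_1}...e_{i_s}
  (i_1 < ... < i_s, B = {i_1,...,i_s} \<subseteq> {1..m}).\<close>

type_synonym 'a clf = "nat set \<Rightarrow> 'a"

text \<open>Polynomials with Clifford coefficients: P alpha B is the coefficient of
  x^alpha e_B, where x^alpha = prod_i x_i^(alpha i).\<close>

type_synonym 'a cpoly = "(nat \<Rightarrow> nat) \<Rightarrow> nat set \<Rightarrow> 'a"

text \<open>Sign in e_A e_B = bsign A B e_{A symdiff B}, from e_i e_j = - e_j e_i (i \<noteq> j), e_i^2 = -1.\<close>
definition bsign :: "nat set \<Rightarrow> nat set \<Rightarrow> 'a::comm_ring_1" where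
  "bsign A B = (-1) ^ (card {(a,b). a \<in> A \<and> b \<in> B \<and> b < a} + card (A \<inter> B))"

definition cmul :: "nat \<Rightarrow> 'a::comm_ring_1 clf \<Rightarrow> 'a clf \<Rightarrow> 'a clf" where
  "cmul m x y = (\<lambda>C. \<Sum>A\<in>Pow {1..m}. \<Sum>B\<in>Pow {1..m}.
      if (A - B) \<union> (B - A) = C then bsign A B * x A * y B else 0)"

definition cone :: "'a::zero_neq_one clf" where
  "cone = (\<lambda>B. if B = {} then 1 else 0)"

definition ebasis :: "nat \<Rightarrow> 'a::zero_neq_one clf" where
  "ebasis j = (\<lambda>B. if B = {j} then 1 else 0)"

definition ginv :: "'a::comm_ring_1 clf \<Rightarrow> 'a clf" where
  "ginv x = (\<lambda>B. (-1) ^ card B * x B)"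

text \<open>u \<bullet> v = 1/2 (u v - (-1)^s v u), u \<wedge> v = 1/2 (u v + (-1)^s v u) for s-vectors v,
  extended linearly in v.\<close>
definition cdot :: "nat \<Rightarrow> 'a::field clf \<Rightarrow> 'a clf \<Rightarrow> 'a clf" where
  "cdot m u v = (\<lambda>B. (cmul m u v B - cmul m (ginv v) u B) / 2)"

definition cwedge :: "nat \<Rightarrow> 'a::field clf \<Rightarrow> 'a clf \<Rightarrow> 'a clf" where
  "cwedge m u v = (\<lambda>B. (cmul m u v B + cmul m (ginv v) u B) / 2)"

definition is_cpoly :: "nat \<Rightarrow> 'a::zero cpoly \<Rightarrow> bool" where
  "is_cpoly n P \<longleftrightarrow> finite {\<alpha>. \<exists>B. P \<alpha> B \<noteq> 0} \<and>
     (\<forall>\<alpha> B. P \<alpha> B \<noteq> 0 \<longrightarrow> (\<forall>i. \<alpha> i \<noteq> 0 \<longrightarrow> i \<in> {1..n}) \<and> B \<subseteq> {1..n})"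

text \<open>P_k^s(R^n): k-homogeneous, s-vector valued (zero space if s < 0 or s > n).\<close>
definition hpoly :: "nat \<Rightarrow> nat \<Rightarrow> int \<Rightarrow> 'a::zero cpoly set" where
  "hpoly n k s = {P. is_cpoly n P \<and>
     (\<forall>\<alpha> B. P \<alpha> B \<noteq> 0 \<longrightarrow> (\<Sum>i\<in>{1..n}. \<alpha> i) = k \<and> int (card B) = s)}"

definition pd :: "nat \<Rightarrow> 'a::semiring_1 cpoly \<Rightarrow> 'a cpoly" where
  "pd j P = (\<lambda>\<alpha> B. of_nat (\<alpha> j + 1) * P (\<alpha>(j := \<alpha> j + 1)) B)"

definition plmul :: "nat \<Rightarrow> 'a::comm_ring_1 clf \<Rightarrow> 'a cpoly \<Rightarrow> 'a cpoly" where
  "plmul m c P = (\<lambda>\<alpha>. cmul m c (P \<alpha>))"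

definition prmul :: "nat \<Rightarrow> 'a::comm_ring_1 cpoly \<Rightarrow> 'a clf \<Rightarrow> 'a cpoly" where
  "prmul m P c = (\<lambda>\<alpha>. cmul m (P \<alpha>) c)"

definition psmul :: "'a::times \<Rightarrow> 'a cpoly \<Rightarrow> 'a cpoly" where
  "psmul c P = (\<lambda>\<alpha> B. c * P \<alpha> B)"

definition mulx :: "nat \<Rightarrow> nat \<Rightarrow> 'a::zero cpoly \<Rightarrow> 'a cpoly" where
  "mulx i j P = (\<lambda>\<alpha> B. if j \<le> \<alpha> i then P (\<alpha>(i := \<alpha> i - j)) B else 0)"

definition dirac :: "nat \<Rightarrow> 'a::comm_ring_1 cpoly \<Rightarrow> 'a cpoly" where
  "dirac m P = (\<Sum>j\<in>{1..m}. plmul m (ebasis j) (pd j P))"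

definition dirac_u :: "nat \<Rightarrow> 'a::comm_ring_1 cpoly \<Rightarrow> 'a cpoly" where
  "dirac_u m P = (\<Sum>j\<in>{1..m-1}. plmul m (ebasis j) (pd j P))"

definition dplus :: "nat \<Rightarrow> 'a::field cpoly \<Rightarrow> 'a cpoly" where
  "dplus m P = (\<Sum>j\<in>{1..m-1}. (\<lambda>\<alpha>. cwedge m (ebasis j) (pd j P \<alpha>)))"

definition dminus :: "nat \<Rightarrow> 'a::field cpoly \<Rightarrow> 'a cpoly" where
  "dminus m P = (\<Sum>j\<in>{1..m-1}. (\<lambda>\<alpha>. cdot m (ebasis j) (pd j P \<alpha>)))"

definition Ker_plus :: "nat \<Rightarrow> nat \<Rightarrow> int \<Rightarrow> 'a::field cpoly set" where
  "Ker_plus m k s = {u \<in> hpoly (m-1) k s. dplus m u = 0}"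

definition Ker_minus :: "nat \<Rightarrow> nat \<Rightarrow> int \<Rightarrow> 'a::field cpoly set" where
  "Ker_minus m k s = {u \<in> hpoly (m-1) k s. dminus m u = 0}"

definition Ispace :: "nat \<Rightarrow> nat \<Rightarrow> int \<Rightarrow> 'a::field cpoly set" where
  "Ispace m k s = {u + prmul m v (ebasis m) | u v. u \<in> Ker_plus m k s \<and> v \<in> Ker_minus m k (s - 1)}"

definition Hspace :: "nat \<Rightarrow> nat \<Rightarrow> int \<Rightarrow> 'a::comm_ring_1 cpoly set" where
  "Hspace m k s = {P \<in> hpoly m k s. dirac m P = 0}"

text \<open>Cauchy-Kovalevskaya extension as formal series sum_j x_m^j/j! (e_m dirac_u)^j p0;
  the coefficient of x^alpha e_B only receives contributions from j \<le> alpha m.\<close>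
definition CK :: "nat \<Rightarrow> 'a::field_char_0 cpoly \<Rightarrow> 'a cpoly" where
  "CK m p0 = (\<lambda>\<alpha> B. \<Sum>j\<le>\<alpha> m.
      mulx m j (((\<lambda>P. plmul m (ebasis m) (dirac_u m P)) ^^ j) p0) \<alpha> B / fact j)"

definition restr :: "nat \<Rightarrow> 'a::zero cpoly \<Rightarrow> 'a cpoly" where
  "restr m P = (\<lambda>\<alpha> B. if \<alpha> m = 0 then P \<alpha> B else 0)"

definition peval :: "nat \<Rightarrow> 'a::real_algebra_1 cpoly \<Rightarrow> (nat \<Rightarrow> real) \<Rightarrow> 'a clf" where
  "peval m P x = (\<lambda>B. \<Sum>\<alpha>\<in>{\<alpha>. \<exists>B. P \<alpha> B \<noteq> 0}. P \<alpha> B * of_real (\<Prod>i\<in>{1..m}. x i ^ \<alpha> i))"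

definition unit_vec_u :: "nat \<Rightarrow> real clf \<Rightarrow> bool" where
  "unit_vec_u m u \<longleftrightarrow> (\<exists>a::nat \<Rightarrow> real.
      u = (\<lambda>B. \<Sum>i\<in>{1..m-1}. if B = {i} then a i else 0) \<and> (\<Sum>i\<in>{1..m-1}. (a i)^2) = 1)"

text \<open>Pin(m-1) inside Cl_m: products of unit vectors of span(e_1..e_{m-1})
  (closed under inverses since u^{-1} = -u).\<close>
definition Pin_u :: "nat \<Rightarrow> real clf set" where
  "Pin_u m = {foldr (cmul m) us cone | us. \<forall>u\<in>set us. unit_vec_u m u}"

definition cinv :: "nat \<Rightarrow> 'a::comm_ring_1 clf \<Rightarrow> 'a clf" where
  "cinv m r = (SOME y. cmul m r y = cone \<and> cmul m y r = cone)"

definition cof_real :: "real clf \<Rightarrow> 'a::real_algebra_1 clf" where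
  "cof_real r = (\<lambda>B. of_real (r B))"

definition vec_of_pt :: "nat \<Rightarrow> (nat \<Rightarrow> real) \<Rightarrow> real clf" where
  "vec_of_pt m x = (\<lambda>B. \<Sum>i\<in>{1..m}. if B = {i} then x i else 0)"

definition Hfun :: "nat \<Rightarrow> real clf \<Rightarrow> ((nat \<Rightarrow> real) \<Rightarrow> 'a::{real_algebra_1,comm_ring_1} clf)
                    \<Rightarrow> (nat \<Rightarrow> real) \<Rightarrow> 'a clf" where
  "Hfun m r f = (\<lambda>x. cmul m (cmul m (cof_real r)
        (f (\<lambda>i. cmul m (cinv m r) (cmul m (vec_of_pt m x) r) {i}))) (cof_real (cinv m r)))"

definition Hpoly :: "nat \<Rightarrow> real clf \<Rightarrow> 'a::{real_algebra_1,comm_ring_1} cpoly \<Rightarrow> 'a cpoly" where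
  "Hpoly m r P = (THE Q. is_cpoly m Q \<and> peval m Q = Hfun m r (peval m P))"

end

theory Submission
  imports Defs "HOL-Computational_Algebra.Polynomial"
begin

text \<open>Write \<open>D = e\<^sub>m \<partial>_\<close> for the Dirac operator of the first \<open>m - 1\<close> variables multiplied by \<open>e\<^sub>m\<close>.
  As \<open>e\<^sub>m\<^sup>2 = - 1\<close>, a polynomial is monogenic iff its derivative in \<open>x\<^sub>m\<close> is \<open>D P\<close>, so it is the CK
  extension of its restriction to \<open>x\<^sub>m = 0\<close>. For \<open>u, v\<close> with values in the subalgebra of
  \<open>e\<^sub>1, \<dots>, e\<^sub>m\<^sub>-\<^sub>1\<close>, commuting \<open>e\<^sub>m\<close> past them shows that \<open>D (u + v e\<^sub>m)\<close> is again homogeneous of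
  grade \<open>s\<close> iff \<open>\<partial>\<^sup>+ u = 0\<close> and \<open>\<partial>\<^sup>- v = 0\<close>; these conditions persist under \<open>D\<close> because
  \<open>\<partial>\<^sup>+\<close> and \<open>\<partial>\<^sup>-\<close> square to zero. Equivariance follows since the H-action preserves
  monogenic polynomials and, as \<open>r\<inverse> e\<^sub>m r = \<plusminus> e\<^sub>m\<close> on \<open>Pin(m - 1)\<close>, commutes with the restriction.\<close>

subsection \<open>Clifford multiplication\<close>

text \<open>The equivariance is the part that shapes the second half. \<open>Hpoly\<close> is
  specified through the values of polynomial functions, whereas the differential operators act on
  families of coefficients, where a linear change of variables has no simple formula. A bridge is
  needed in both directions: a polynomial is determined by its values, and a linear substitution
  again yields a polynomial. Chain rule, degree and grade of the transformed polynomial are then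
  recovered from values. Derivatives along lines are formal derivatives of univariate polynomials,
  so the argument stays algebraic and treats real and complex coefficients alike. The sign of a
  product of blades is rewritten as a product over pairs of indices. In this form it is
  multiplicative in each argument with respect to symmetric difference, and associativity reduces to
  that. Supports need care throughout: Clifford elements are functions on all sets of naturals, and
  cancelling a unit is valid only for functions supported inside \<open>{1..m}\<close>.\<close>

lemma sum_fun_apply: "(\<Sum>i\<in>A. f i) x = (\<Sum>i\<in>A. f i x)"
  by (induction A rule: infinite_finite_induct) auto

text \<open>The factors over the intersection occur twice on the right and cancel, since each
  squares to 1.\<close>

lemma prod_sym_diff:
  fixes f :: "'b \<Rightarrow> 'a::comm_ring_1"
  assumes "finite A" "finite B" "\<And>x. f x * f x = 1"
  shows "prod f (sym_diff A B) = prod f A * prod f B"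
proof -
  have A: "prod f A = prod f (A - B) * prod f (A \<inter> B)"
    using assms(1) by (subst prod.union_disjoint[symmetric]) (auto intro: prod.cong)
  have B: "prod f B = prod f (B - A) * prod f (A \<inter> B)"
    using assms(2) by (subst prod.union_disjoint[symmetric]) (auto intro: prod.cong)
  have "prod f (A \<inter> B) * prod f (A \<inter> B) = 1"
    by (simp add: prod.distrib[symmetric] assms(3))
  then have "prod f A * prod f B = prod f (A - B) * prod f (B - A)"
    unfolding A B by (metis (no_types, lifting) mult.assoc mult.commute mult.left_neutral)
  then show ?thesis
    using assms by (subst prod.union_disjoint) auto
qed

lemma prod_if_minus_one:
  assumes "finite A"
  shows "(\<Prod>x\<in>A. if P x then - 1 else (1::'a::comm_ring_1)) = (- 1) ^ card {x\<in>A. P x}"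
proof -
  have "A \<inter> {x. P x} = {x\<in>A. P x}" by auto
  then show ?thesis using assms by (simp add: prod.If_cases)
qed

text \<open>The exponent of \<open>bsign\<close> counts inversions \<open>b < a\<close> and
  coincidences \<open>b = a\<close>; together these are the pairs with \<open>b \<le> a\<close>. The
  product form makes the sign multiplicative in each argument.\<close>

lemma bsign_prod:
  assumes "finite A" "finite B"
  shows "bsign A B = (\<Prod>a\<in>A. \<Prod>b\<in>B. if b \<le> a then - 1 else (1::'a::comm_ring_1))"
proof -
  let ?L = "{(a,b). a \<in> A \<and> b \<in> B \<and> b < a}" and ?E = "(\<lambda>a. (a,a)) ` (A \<inter> B)"
  have fin: "finite ?L"
    by (rule finite_subset[of _ "A \<times> B"]) (use assms in auto)
  have "{p\<in>A \<times> B. snd p \<le> fst p} = ?L \<union> ?E" by auto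
  moreover have "card (?L \<union> ?E) = card ?L + card ?E"
    using assms fin by (intro card_Un_disjoint) auto
  moreover have "card ?E = card (A \<inter> B)"
    by (intro card_image) (auto simp: inj_on_def)
  ultimately have "card {p\<in>A \<times> B. snd p \<le> fst p} = card ?L + card (A \<inter> B)" by simp
  then have "bsign A B = (\<Prod>p\<in>A \<times> B. if snd p \<le> fst p then - 1 else (1::'a))"
    unfolding bsign_def using assms by (subst prod_if_minus_one) auto
  then show ?thesis by (simp add: prod.cartesian_product case_prod_beta)
qed

lemma bsign_sym_diff_left:
  assumes "finite A" "finite B" "finite C"
  shows "bsign (sym_diff A B) C = bsign A C * (bsign B C :: 'a::comm_ring_1)"
proof -
  have "(\<Prod>c\<in>C. if c \<le> a then - 1 else 1) * (\<Prod>c\<in>C. if c \<le> a then - 1 else 1) = (1::'a)" for a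
    unfolding prod.distrib[symmetric] by (rule prod.neutral) auto
  then show ?thesis using assms by (simp add: bsign_prod prod_sym_diff)
qed

lemma bsign_sym_diff_right:
  assumes "finite A" "finite B" "finite C"
  shows "bsign A (sym_diff B C) = bsign A B * (bsign A C :: 'a::comm_ring_1)"
  using assms by (simp add: bsign_prod prod_sym_diff prod.distrib[symmetric])

text \<open>Compares \<open>e_D e_j\<close> with \<open>e_j e_D\<close>: the factor
  \<open>(- 1) ^ card D\<close> turns the condition \<open>j \<le> d\<close> into
  \<open>d < j\<close>, which differs from the condition \<open>d \<le> j\<close> of
  \<open>bsign {j} D\<close> only at \<open>d = j\<close>. This one exception later separates the
  outer from the inner product.\<close>

lemma bsign_singleton_swap:
  assumes "finite D"
  shows "bsign D {j} * (- 1) ^ card D = (if j \<in> D then - bsign {j} D else (bsign {j} D :: 'a::comm_ring_1))"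
proof -
  have *: "(-1) ^ card D = (\<Prod>d\<in>D. - (1::'a))" by simp
  have "bsign D {j} * (- 1) ^ card D = (\<Prod>d\<in>D. if d < j then - 1 else (1::'a))"
    using assms unfolding * by (simp add: bsign_prod prod.distrib[symmetric] del: prod_constant)
       (intro prod.cong, auto)
  also have "\<dots> = (\<Prod>d\<in>D. (if d \<le> j then - 1 else 1) * (if d = j then - 1 else 1))"
    by (intro prod.cong) auto
  also have "\<dots> = (if j \<in> D then - bsign {j} D else bsign {j} D)"
    using assms by (simp add: prod.distrib bsign_prod)
  finally show ?thesis .
qed

lemma minus_one_power_card_sym_diff:
  assumes "finite A" "finite B"
  shows "(- 1) ^ card (sym_diff A B) = (- 1) ^ card A * ((- 1) ^ card B :: 'a::comm_ring_1)"
  using prod_sym_diff[of A B "\<lambda>_. - (1::'a)"] assms by simp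

section \<open>The product: associativity, units and basis relations\<close>

text \<open>\<open>cmul m\<close> discards every coefficient outside \<open>{1..m}\<close>, so
  \<open>cone\<close> acts as a unit exactly on the functions with this support.\<close>

definition clf_on :: "nat \<Rightarrow> 'a::zero clf \<Rightarrow> bool" where
  "clf_on m x \<longleftrightarrow> (\<forall>B. x B \<noteq> 0 \<longrightarrow> B \<subseteq> {1..m})"

definition scl :: "'a::times \<Rightarrow> 'a clf \<Rightarrow> 'a clf" where
  "scl c x = (\<lambda>B. c * x B)"

text \<open>For given \<open>A\<close> the only \<open>B\<close> that contributes to
  \<open>C\<close> is the symmetric difference of \<open>A\<close> and \<open>C\<close>, so one of
  the two sums collapses.\<close>

lemma cmul_eq:
  "cmul m x y C = (if C \<subseteq> {1..m} then
     \<Sum>A\<in>Pow {1..m}. bsign A (sym_diff A C) * x A * y (sym_diff A C) else 0)"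
proof -
  have eq: "sym_diff A B = C \<longleftrightarrow> B = sym_diff A C" for A B :: "nat set"
    by blast
  have "cmul m x y C = (\<Sum>A\<in>Pow {1..m}. if sym_diff A C \<in> Pow {1..m}
      then bsign A (sym_diff A C) * x A * y (sym_diff A C) else 0)"
    unfolding cmul_def eq by (simp only: sum.delta finite_Pow_iff finite_atLeastAtMost)
  also have "\<dots> = (if C \<subseteq> {1..m} then
     \<Sum>A\<in>Pow {1..m}. bsign A (sym_diff A C) * x A * y (sym_diff A C) else 0)"
  proof (cases "C \<subseteq> {1..m}")
    case True
    then have "sym_diff A C \<in> Pow {1..m}" if "A \<in> Pow {1..m}" for A
      using that by blast
    then show ?thesis using True by (simp only: if_True cong: sum.cong)
  next
    case False
    then have "sym_diff A C \<notin> Pow {1..m}" if "A \<in> Pow {1..m}" for A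
      using that by blast
    then show ?thesis using False by (simp only: if_False sum.neutral_const cong: sum.cong)
  qed
  finally show ?thesis .
qed

lemma clf_on_cmul [simp]: "clf_on m (cmul m x y)"
  unfolding clf_on_def cmul_eq by presburger

text \<open>After reindexing, both sides are sums over the same pairs of blades, and the signs agree
  because either product of two signs expands to
  \<open>bsign A B * bsign A E * bsign B E\<close>.\<close>

lemma cmul_assoc: "cmul m (cmul m x y) z = cmul m x (cmul m y z)"
proof
  fix C
  show "cmul m (cmul m x y) z C = cmul m x (cmul m y z) C"
  proof (cases "C \<subseteq> {1..m}")
    case True
    let ?P = "Pow {1..m}"
    have "cmul m (cmul m x y) z C = (\<Sum>D\<in>?P. \<Sum>A\<in>?P. bsign D (sym_diff D C) *
        (bsign A (sym_diff A D) * x A * y (sym_diff A D)) * z (sym_diff D C))"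
      using True by (simp add: cmul_eq sum_distrib_left sum_distrib_right)
    also have "\<dots> = (\<Sum>A\<in>?P. \<Sum>D\<in>?P. bsign D (sym_diff D C) *
        (bsign A (sym_diff A D) * x A * y (sym_diff A D)) * z (sym_diff D C))"
      by (rule sum.swap)
    also have "\<dots> = (\<Sum>A\<in>?P. \<Sum>B\<in>?P. bsign A (sym_diff A C) * x A *
        (bsign B (sym_diff B (sym_diff A C)) * y B * z (sym_diff B (sym_diff A C))))"
    proof (rule sum.cong[OF refl])
      fix A assume A: "A \<in> ?P"
      let ?h = "\<lambda>B. bsign A (sym_diff A C) * x A *
        (bsign B (sym_diff B (sym_diff A C)) * y B * z (sym_diff B (sym_diff A C)))"
      \<comment> \<open>On the left \<open>D\<close> is the blade of the inner product
        \<open>x y\<close>; for fixed \<open>A\<close>, passing from \<open>D\<close> to the blade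
        taken from \<open>y\<close> is an involution of \<open>Pow {1..m}\<close>.\<close>
      have "bij_betw (\<lambda>D. sym_diff A D) ?P ?P"
        by (rule bij_betw_byWitness[where f' = "\<lambda>D. sym_diff A D"]) (use A in auto)
      from sum.reindex_bij_betw[OF this, of ?h, symmetric]
      have "sum ?h ?P = (\<Sum>D\<in>?P. ?h (sym_diff A D))" .
      also have "\<dots> = (\<Sum>D\<in>?P. bsign D (sym_diff D C) *
        (bsign A (sym_diff A D) * x A * y (sym_diff A D)) * z (sym_diff D C))"
      proof (rule sum.cong[OF refl])
        fix D assume D: "D \<in> ?P"
        define B where "B = sym_diff A D"
        define E where "E = sym_diff D C"
        have fin: "finite A" "finite B" "finite E"
          using A D True unfolding B_def E_def by (auto intro: finite_subset)
        have eqs: "D = sym_diff A B" "sym_diff B (sym_diff A C) = E" "sym_diff A C = sym_diff B E"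
          unfolding B_def E_def by blast+
        have "bsign D E * bsign A B = bsign A (sym_diff A C) * (bsign B E :: 'a)"
          unfolding eqs(1,3) using fin
          by (simp add: bsign_sym_diff_left bsign_sym_diff_right)
        then show "?h (sym_diff A D) = bsign D (sym_diff D C) *
            (bsign A (sym_diff A D) * x A * y (sym_diff A D)) * z (sym_diff D C)"
          unfolding B_def[symmetric] E_def[symmetric] eqs(2)
          by (metis (no_types, lifting) mult.assoc mult.commute)
      qed
      finally show "(\<Sum>D\<in>?P. bsign D (sym_diff D C) *
        (bsign A (sym_diff A D) * x A * y (sym_diff A D)) * z (sym_diff D C)) = sum ?h ?P" ..
    qed
    also have "\<dots> = cmul m x (cmul m y z) C"
      using True by (auto simp: cmul_eq sum_distrib_left intro!: sum.cong)
    finally show ?thesis .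
  qed (simp add: cmul_eq)
qed

lemma cmul_add_left: "cmul m (x + y) z = cmul m x z + cmul m y z"
  and cmul_add_right: "cmul m z (x + y) = cmul m z x + cmul m z y"
  and cmul_diff_left: "cmul m (x - y) z = cmul m x z - cmul m y z"
  and cmul_diff_right: "cmul m z (x - y) = cmul m z x - cmul m z y"
  and cmul_minus_left: "cmul m (- x) z = - cmul m x z"
  and cmul_minus_right: "cmul m z (- x) = - cmul m z x"
  and cmul_scl_left: "cmul m (scl c x) z = scl c (cmul m x z)"
  and cmul_scl_right: "cmul m z (scl c x) = scl c (cmul m z x)"
  and cmul_zero_left [simp]: "cmul m 0 z = 0"
  and cmul_zero_right [simp]: "cmul m z 0 = 0"
  by (auto simp: fun_eq_iff cmul_eq scl_def algebra_simps sum.distrib sum_subtractf sum_negf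
      sum_distrib_left)

lemma cmul_sum_left: "cmul m (\<Sum>i\<in>A. f i) z = (\<Sum>i\<in>A. cmul m (f i) z)"
  by (induction A rule: infinite_finite_induct)
    (simp_all only: sum.infinite sum.empty sum.insert cmul_add_left cmul_zero_left not_False_eq_True)

lemma cmul_sum_right: "cmul m z (\<Sum>i\<in>A. f i) = (\<Sum>i\<in>A. cmul m z (f i))"
  by (induction A rule: infinite_finite_induct)
    (simp_all only: sum.infinite sum.empty sum.insert cmul_add_right cmul_zero_right not_False_eq_True)

lemma cmul_cong:
  assumes "\<And>A. A \<subseteq> {1..m} \<Longrightarrow> x A = x' A" "\<And>A. A \<subseteq> {1..m} \<Longrightarrow> y A = y' A"
  shows "cmul m x y = cmul m x' y'"
  unfolding cmul_def using assms by (auto intro!: ext sum.cong)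

lemma ebasis_apply: "ebasis j B = (if B = {j} then 1 else 0)"
  by (simp add: ebasis_def)

lemma cmul_ebasis_left:
  assumes "j \<in> {1..m}"
  shows "cmul m (ebasis j) y C =
    (if C \<subseteq> {1..m} then bsign {j} (sym_diff {j} C) * y (sym_diff {j} C) else 0)"
proof -
  have "(\<Sum>A\<in>Pow {1..m}. bsign A (sym_diff A C) * ebasis j A * y (sym_diff A C)) =
      (\<Sum>A\<in>Pow {1..m}. if A = {j} then bsign {j} (sym_diff {j} C) * y (sym_diff {j} C) else 0)"
    by (intro sum.cong) (auto simp: ebasis_def)
  also have "\<dots> = bsign {j} (sym_diff {j} C) * y (sym_diff {j} C)"
    using assms by simp
  finally show ?thesis by (simp only: cmul_eq)
qed

lemma cmul_ebasis_right:
  assumes "j \<in> {1..m}"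
  shows "cmul m y (ebasis j) C =
    (if C \<subseteq> {1..m} then bsign (sym_diff {j} C) {j} * y (sym_diff {j} C) else 0)"
proof (cases "C \<subseteq> {1..m}")
  case True
  have eq: "sym_diff A C = {j} \<longleftrightarrow> A = sym_diff {j} C" for A by blast
  have "(\<Sum>A\<in>Pow {1..m}. bsign A (sym_diff A C) * y A * ebasis j (sym_diff A C)) =
      (\<Sum>A\<in>Pow {1..m}. if A = sym_diff {j} C
         then bsign (sym_diff {j} C) {j} * y (sym_diff {j} C) else 0)"
  proof (intro sum.cong refl)
    fix A
    show "bsign A (sym_diff A C) * y A * ebasis j (sym_diff A C) =
      (if A = sym_diff {j} C then bsign (sym_diff {j} C) {j} * y (sym_diff {j} C) else 0)"
    proof (cases "A = sym_diff {j} C")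
      case True
      then have "sym_diff A C = {j}" using eq by blast
      then show ?thesis using True by (simp only: ebasis_def) simp
    next
      case False
      then have "sym_diff A C \<noteq> {j}" using eq by blast
      then show ?thesis using False by (simp only: ebasis_def) simp
    qed
  qed
  also have "\<dots> = bsign (sym_diff {j} C) {j} * y (sym_diff {j} C)"
    using assms True by auto
  finally show ?thesis using True by (simp only: cmul_eq if_True)
qed (simp add: cmul_eq)

lemma cmul_cone_left:
  assumes "clf_on m y" shows "cmul m cone y = y"
proof
  fix C
  have "(\<Sum>A\<in>Pow {1..m}. bsign A (sym_diff A C) * cone A * y (sym_diff A C)) =
      (\<Sum>A\<in>Pow {1..m}. if A = {} then y C else 0)"
    by (intro sum.cong) (auto simp: cone_def bsign_def)
  also have "\<dots> = y C" by simp
  finally show "cmul m cone y C = y C"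
    using assms by (auto simp: cmul_eq clf_on_def)
qed

lemma cmul_cone_right:
  assumes "clf_on m y" shows "cmul m y cone = y"
proof
  fix C
  show "cmul m y cone C = y C"
  proof (cases "C \<subseteq> {1..m}")
    case True
    have eq: "sym_diff A C = {} \<longleftrightarrow> A = C" for A by blast
    have "(\<Sum>A\<in>Pow {1..m}. bsign A (sym_diff A C) * y A * cone (sym_diff A C)) =
        (\<Sum>A\<in>Pow {1..m}. if A = C then y C else 0)"
      by (intro sum.cong refl) (auto simp: cone_def eq bsign_def)
    also have "\<dots> = y C" using True by simp
    finally show ?thesis using True by (simp add: cmul_eq)
  qed (use assms in \<open>auto simp: cmul_eq clf_on_def\<close>)
qed

lemma clf_on_simps [simp]:
  "clf_on m (0 :: 'a::comm_ring_1 clf)"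
  "clf_on m (cone :: 'a::comm_ring_1 clf)"
  "j \<in> {1..m} \<Longrightarrow> clf_on m (ebasis j :: 'a::comm_ring_1 clf)"
  by (auto simp: clf_on_def cone_def ebasis_def)

lemma clf_on_add: "clf_on m x \<Longrightarrow> clf_on m y \<Longrightarrow> clf_on m (x + y :: 'a::comm_ring_1 clf)"
  and clf_on_scl: "clf_on m x \<Longrightarrow> clf_on m (scl c x :: 'a::comm_ring_1 clf)"
  and clf_on_minus: "clf_on m x \<Longrightarrow> clf_on m (- x :: 'a::comm_ring_1 clf)"
  and clf_on_ginv: "clf_on m x \<Longrightarrow> clf_on m (ginv x :: 'a::comm_ring_1 clf)"
  unfolding clf_on_def scl_def ginv_def fun_Compl_def plus_fun_apply
  by (metis add.right_neutral, metis mult_zero_right, simp, metis mult_zero_right)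

lemma clf_on_sum:
  "(\<And>i. i \<in> A \<Longrightarrow> clf_on m (f i)) \<Longrightarrow> clf_on m (\<Sum>i\<in>A. f i :: 'a::comm_ring_1 clf)"
  unfolding clf_on_def sum_fun_apply by (metis (mono_tags, lifting) sum.neutral)

lemma ebasis_square:
  assumes "i \<in> {1..m}"
  shows "cmul m (ebasis i) (ebasis i) = - (cone :: 'a::comm_ring_1 clf)"
proof
  fix C
  have "sym_diff {i} C = {i} \<longleftrightarrow> C = {}" by blast
  then show "cmul m (ebasis i) (ebasis i) C = (- (cone :: 'a clf)) C"
    unfolding cmul_ebasis_left[OF assms] unfolding ebasis_def cone_def
    by (simp add: bsign_prod)
qed

lemma cmul_ebasis_ebasis:
  assumes "i \<in> {1..m}" "j \<in> {1..m}" "i \<noteq> j"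
  shows "cmul m (ebasis i) (ebasis j) C = (if C = {i,j} then bsign {i} {j} else (0::'a::comm_ring_1))"
proof (cases "C = {i,j}")
  case True
  then have "sym_diff {i} C = {j}" using assms(3) by auto
  then have "cmul m (ebasis i) (ebasis j) C = (if C \<subseteq> {1..m} then bsign {i} {j} else (0::'a))"
    by (simp only: cmul_ebasis_left[OF assms(1)] ebasis_apply refl if_True mult_1_right)
  then show ?thesis using True assms by simp
next
  case False
  have "C = sym_diff {i} (sym_diff {i} C)" by blast
  moreover have "sym_diff {i} {j} = {i,j}" using assms(3) by auto
  ultimately have "sym_diff {i} C \<noteq> {j}" using False by metis
  then show ?thesis using False
    by (simp only: cmul_ebasis_left[OF assms(1)] ebasis_apply if_False mult_zero_right if_cancel)
qed

lemma ebasis_anticommute: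
  assumes "i \<in> {1..m}" "j \<in> {1..m}" "i \<noteq> j"
  shows "cmul m (ebasis i) (ebasis j) = - cmul m (ebasis j) (ebasis i :: 'a::comm_ring_1 clf)"
proof
  fix C
  have "bsign {i} {j} = - (bsign {j} {i} :: 'a)"
    using assms(3) by (auto simp: bsign_prod)
  then show "cmul m (ebasis i) (ebasis j) C = (- cmul m (ebasis j) (ebasis i :: 'a clf)) C"
    using cmul_ebasis_ebasis[of i m j C, where 'a='a] cmul_ebasis_ebasis[of j m i C, where 'a='a]
      assms insert_commute[of j i "{}"] by simp
qed

section \<open>Grade involution, outer and inner products\<close>

lemma ginv_ginv [simp]: "ginv (ginv x) = x"
proof
  fix B :: "nat set"
  have "(- 1) ^ card B * (- 1) ^ card B = (1::'a)"
    by (simp flip: power_mult_distrib)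
  then show "ginv (ginv x) B = x B"
    by (simp add: ginv_def flip: mult.assoc)
qed

lemma ginv_add: "ginv (x + y) = ginv x + ginv y"
  and ginv_diff: "ginv (x - y) = ginv x - ginv y"
  and ginv_scl: "ginv (scl c x) = scl c (ginv x)"
  and ginv_zero [simp]: "ginv 0 = 0"
  and ginv_ebasis: "ginv (ebasis j) = - ebasis j"
  by (auto simp: ginv_def scl_def fun_eq_iff ebasis_def algebra_simps)

text \<open>The parity of the cardinality is additive under symmetric difference.\<close>

lemma ginv_cmul: "ginv (cmul m x y) = cmul m (ginv x) (ginv y)"
proof
  fix C
  have "(- 1) ^ card C = (- 1) ^ card A * ((- 1) ^ card (sym_diff A C) :: 'a)"
    if "A \<subseteq> {1..m}" "C \<subseteq> {1..m}" for A
  proof -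
    have fin: "finite A" "finite C" using that by (auto intro: finite_subset)
    have "C = sym_diff A (sym_diff A C)" by blast
    moreover have "finite (sym_diff A C)" using fin by blast
    ultimately show ?thesis
      using minus_one_power_card_sym_diff[of A "sym_diff A C", where 'a='a] fin by metis
  qed
  note sgn = this
  show "ginv (cmul m x y) C = cmul m (ginv x) (ginv y) C"
  proof (cases "C \<subseteq> {1..m}")
    case True
    have "(- 1) ^ card C * (bsign A (sym_diff A C) * x A * y (sym_diff A C)) =
      bsign A (sym_diff A C) * ((- 1) ^ card A * x A) *
        ((- 1) ^ card (sym_diff A C) * y (sym_diff A C))" if "A \<in> Pow {1..m}" for A
      unfolding sgn[OF PowD[OF that] True] by (simp only: mult_ac)
    then show ?thesis using True
      by (simp only: ginv_def cmul_eq if_True sum_distrib_left cong: sum.cong)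
  qed (simp add: ginv_def cmul_eq)
qed

lemma cwedge_alt: "cwedge m u v = scl (1/2) (cmul m u v + cmul m (ginv v) u)"
  and cdot_alt: "cdot m u v = scl (1/2) (cmul m u v - cmul m (ginv v) u)"
  by (auto simp: cwedge_def cdot_def scl_def)

lemma cmul_ginv_ebasis:
  assumes "j \<in> {1..m}" "C \<subseteq> {1..m}"
  shows "cmul m (ginv y) (ebasis j) C = (if j \<in> C then 1 else - 1) * cmul m (ebasis j) y C"
proof -
  have "finite (sym_diff {j} C)" using assms by (auto intro: finite_subset)
  from bsign_singleton_swap[OF this, of j, where 'a='a]
  have "bsign (sym_diff {j} C) {j} * (- 1) ^ card (sym_diff {j} C) =
      (if j \<in> C then 1 else - 1) * (bsign {j} (sym_diff {j} C) :: 'a)"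
    by (auto split: if_splits)
  from arg_cong[OF this, of "\<lambda>z. z * y (sym_diff {j} C)"] show ?thesis using assms
    by (simp add: cmul_ebasis_left cmul_ebasis_right ginv_def mult.assoc)
qed

text \<open>By \<open>cmul_ginv_ebasis\<close> the two terms of the half sum agree on blades
  containing \<open>j\<close> and cancel on the others; for \<open>cdot\<close> it is the reverse.
  This describes both products blade by blade, also for arguments of mixed grade.\<close>

lemma cwedge_ebasis:
  assumes "j \<in> {1..m}"
  shows "cwedge m (ebasis j) y C = (if j \<in> C then cmul m (ebasis j) (y::'a::field_char_0 clf) C else 0)"
  using cmul_ginv_ebasis[OF assms, of C y] clf_on_cmul[of m]
  by (cases "C \<subseteq> {1..m}") (auto simp: cwedge_def cmul_eq)

lemma cdot_ebasis:
  assumes "j \<in> {1..m}"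
  shows "cdot m (ebasis j) y C = (if j \<in> C then 0 else cmul m (ebasis j) (y::'a::field_char_0 clf) C)"
  using cmul_ginv_ebasis[OF assms, of C y] clf_on_cmul[of m]
  by (cases "C \<subseteq> {1..m}") (auto simp: cdot_def cmul_eq)

subsection \<open>The operators dplus and dminus\<close>

lemma scl_add: "scl c (x + y) = scl c x + scl (c::'a::comm_ring_1) y"
  and scl_diff: "scl c (x - y) = scl c x - scl (c::'a::comm_ring_1) y"
  and scl_minus: "scl c (- x) = - scl (c::'a::comm_ring_1) x"
  and scl_scl: "scl c (scl d x) = scl (c * d :: 'a::comm_ring_1) x"
  and scl_zero [simp]: "scl (c::'a::comm_ring_1) 0 = 0"
  and scl_one [simp]: "scl (1::'a::comm_ring_1) x = x"
  by (auto simp: scl_def fun_eq_iff algebra_simps)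

lemma scl_sum: "scl (c::'a::comm_ring_1) (\<Sum>i\<in>A. f i) = (\<Sum>i\<in>A. scl c (f i))"
  by (rule ext) (simp only: scl_def sum_fun_apply sum_distrib_left)

text \<open>Both sides truncate \<open>w\<close> to the blades inside \<open>{1..m}\<close>; hence
  scalars commute with every function, whatever its support.\<close>

lemma cmul_cone_commute: "cmul m cone w = cmul m w cone"
proof -
  define w' where "w' = (\<lambda>B. if B \<subseteq> {1..m} then w B else 0)"
  have "clf_on m w'" by (auto simp: clf_on_def w'_def)
  moreover have "cmul m cone w = cmul m cone w'" "cmul m w cone = cmul m w' cone"
    by (auto intro!: cmul_cong simp: w'_def)
  ultimately show ?thesis by (simp only: cmul_cone_left cmul_cone_right)
qed

text \<open>In the expansion the terms with \<open>ginv w\<close> in the middle cancel after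
  symmetrising in \<open>u\<close> and \<open>v\<close>. What remains, for both products, is a
  quarter of the commutator of \<open>u v + v u\<close> with \<open>w\<close>, and this is zero
  because \<open>u v + v u\<close> is a scalar.\<close>

lemma
  fixes u v w :: "'a::field_char_0 clf"
  assumes "ginv u = - u" "ginv v = - v" "cmul m u v + cmul m v u = scl c cone"
  shows cwedge_cwedge_anticommute: "cwedge m u (cwedge m v w) = - cwedge m v (cwedge m u w)"
    and cdot_cdot_anticommute: "cdot m u (cdot m v w) = - cdot m v (cdot m u w)"
proof -
  have eq: "cmul m u (cmul m v w) + cmul m v (cmul m u w) =
      cmul m w (cmul m u v) + cmul m w (cmul m v u)"
    using assms(3) cmul_cone_commute[of m w]
    by (simp only: cmul_assoc[symmetric] cmul_add_left[symmetric] cmul_add_right[symmetric]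
        cmul_scl_left cmul_scl_right)
       (simp only: cmul_assoc cmul_add_left[symmetric] cmul_add_right[symmetric]
        cmul_scl_left cmul_scl_right)
  have "cwedge m u (cwedge m v w) + cwedge m v (cwedge m u w) = scl (1/4)
    (cmul m u (cmul m v w) + cmul m v (cmul m u w) - (cmul m w (cmul m u v) + cmul m w (cmul m v u)))"
    unfolding cwedge_alt ginv_scl ginv_add ginv_cmul ginv_ginv assms(1,2) cmul_scl_left
      cmul_scl_right cmul_add_left cmul_add_right cmul_minus_left cmul_minus_right cmul_assoc scl_add
      scl_minus scl_diff scl_scl
    by simp
  then have "cwedge m u (cwedge m v w) + cwedge m v (cwedge m u w) = 0"
    by (simp only: eq diff_self scl_zero)
  then show "cwedge m u (cwedge m v w) = - cwedge m v (cwedge m u w)"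
    by (rule eq_neg_iff_add_eq_0[THEN iffD2])
  have "cdot m u (cdot m v w) + cdot m v (cdot m u w) = scl (1/4)
    (cmul m u (cmul m v w) + cmul m v (cmul m u w) - (cmul m w (cmul m u v) + cmul m w (cmul m v u)))"
    unfolding cdot_alt ginv_scl ginv_diff ginv_cmul ginv_ginv assms(1,2) cmul_scl_left
      cmul_scl_right cmul_diff_left cmul_diff_right cmul_minus_left cmul_minus_right cmul_assoc
      scl_minus scl_diff scl_scl scl_add
    by simp
  then have "cdot m u (cdot m v w) + cdot m v (cdot m u w) = 0"
    by (simp only: eq diff_self scl_zero)
  then show "cdot m u (cdot m v w) = - cdot m v (cdot m u w)"
    by (rule eq_neg_iff_add_eq_0[THEN iffD2])
qed

lemma ebasis_relation:
  assumes "i \<in> {1..m}" "j \<in> {1..m}"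
  shows "cmul m (ebasis i) (ebasis j) + cmul m (ebasis j) (ebasis i) =
    scl (if i = j then - 2 else 0) (cone :: 'a::comm_ring_1 clf)"
  using assms by (auto simp: ebasis_square ebasis_anticommute[of i m j] scl_def fun_eq_iff)

lemma cwedge_scl: "cwedge m u (scl c v) = scl c (cwedge m u (v :: 'a::field_char_0 clf))"
  and cdot_scl: "cdot m u (scl c v) = scl c (cdot m u (v :: 'a::field_char_0 clf))"
  unfolding cwedge_alt cdot_alt
  by (simp_all add: ginv_scl cmul_scl_left cmul_scl_right scl_add scl_diff scl_scl mult.commute)

lemma cwedge_zero [simp]: "cwedge m u 0 = 0"
  and cdot_zero [simp]: "cdot m u 0 = 0"
  unfolding cwedge_alt cdot_alt by (simp_all add: fun_eq_iff scl_def)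

lemma cwedge_add: "cwedge m u (v + w) = cwedge m u v + cwedge m u (w :: 'a::field_char_0 clf)"
  and cdot_add: "cdot m u (v + w) = cdot m u v + cdot m u (w :: 'a::field_char_0 clf)"
  unfolding cwedge_alt cdot_alt ginv_add cmul_add_left cmul_add_right scl_add scl_diff
  by (simp_all add: algebra_simps)

lemma cwedge_sum: "cwedge m u (\<Sum>i\<in>A. f i) = (\<Sum>i\<in>A. cwedge m u (f i :: 'a::field_char_0 clf))"
  by (induction A rule: infinite_finite_induct)
    (simp_all only: sum.infinite sum.empty sum.insert cwedge_add cwedge_zero not_False_eq_True)

lemma cdot_sum: "cdot m u (\<Sum>i\<in>A. f i) = (\<Sum>i\<in>A. cdot m u (f i :: 'a::field_char_0 clf))"
  by (induction A rule: infinite_finite_induct)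
    (simp_all only: sum.infinite sum.empty sum.insert cdot_add cdot_zero not_False_eq_True)

lemma cwedge_plus_cdot: "cwedge m u v + cdot m u v = cmul m u (v :: 'a::field_char_0 clf)"
  by (simp add: cwedge_def cdot_def fun_eq_iff field_simps)

section \<open>Partial derivatives and the two halves of the Dirac operator\<close>

lemma pd_apply: "pd j P \<alpha> = scl (of_nat (Suc (\<alpha> j))) (P (\<alpha>(j := Suc (\<alpha> j))))"
  by (simp add: pd_def scl_def)

lemma plmul_apply: "plmul m c P \<alpha> = cmul m c (P \<alpha>)"
  and prmul_apply: "prmul m P c \<alpha> = cmul m (P \<alpha>) c"
  and psmul_apply: "psmul d P \<alpha> = scl d (P \<alpha>)"
  by (simp_all add: plmul_def prmul_def psmul_def scl_def)

lemma dirac_apply: "dirac m P \<alpha> = (\<Sum>j\<in>{1..m}. cmul m (ebasis j) (pd j P \<alpha>))"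
  and dirac_u_apply: "dirac_u m P \<alpha> = (\<Sum>j\<in>{1..m-1}. cmul m (ebasis j) (pd j P \<alpha>))"
  and dplus_apply: "dplus m P' \<alpha> = (\<Sum>j\<in>{1..m-1}. cwedge m (ebasis j) (pd j P' \<alpha>))"
  and dminus_apply: "dminus m P' \<alpha> = (\<Sum>j\<in>{1..m-1}. cdot m (ebasis j) (pd j P' \<alpha>))"
  by (simp_all add: dirac_def dirac_u_def dplus_def dminus_def sum_fun_apply plmul_apply)

lemma pd_psmul: "pd j (psmul c P) = psmul c (pd j P)"
  for P :: "'a::comm_ring_1 cpoly"
  by (simp add: fun_eq_iff pd_def psmul_def mult.left_commute)

lemma pd_add: "pd j (P + Q) = pd j P + pd j Q"
  for P :: "'a::comm_ring_1 cpoly"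
  by (simp add: fun_eq_iff pd_def algebra_simps)

lemma pd_zero [simp]: "pd j 0 = (0 :: 'a::comm_ring_1 cpoly)"
  by (simp add: fun_eq_iff pd_def)

lemma pd_commute: "pd i (pd j P) = pd j (pd i P)"
  for P :: "'a::comm_ring_1 cpoly"
  by (cases "i = j") (simp_all add: fun_eq_iff pd_def fun_upd_twist mult.left_commute)

lemma dplus_psmul: "dplus m (psmul c P) = psmul c (dplus m (P :: 'a::field_char_0 cpoly))"
  and dminus_psmul: "dminus m (psmul c P) = psmul c (dminus m P)"
  and dirac_u_psmul: "dirac_u m (psmul c P) = psmul c (dirac_u m P)"
  by (rule ext, simp only: dplus_apply dminus_apply dirac_u_apply pd_psmul psmul_apply cwedge_scl
      cdot_scl cmul_scl_right scl_sum)+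

lemma dirac_u_add: "dirac_u m (P + Q) = dirac_u m P + dirac_u m Q"
  by (rule ext, simp only: dirac_u_apply pd_add plus_fun_apply cmul_add_right sum.distrib)

lemma dplus_zero [simp]: "dplus m 0 = (0 :: 'a::field_char_0 cpoly)"
  and dminus_zero [simp]: "dminus m 0 = (0 :: 'a::field_char_0 cpoly)"
  by (rule ext, simp only: dplus_apply dminus_apply pd_zero zero_fun_apply cwedge_zero cdot_zero
      sum.neutral_const)+

lemma dirac_u_eq: "dirac_u m P = dplus m P + dminus m (P :: 'a::field_char_0 cpoly)"
  by (rule ext) (simp only: dirac_u_apply dplus_apply dminus_apply plus_fun_apply
      sum.distrib[symmetric] cwedge_plus_cdot)

lemma antisymmetric_sum_eq_0:
  fixes f :: "'b \<Rightarrow> 'b \<Rightarrow> 'c \<Rightarrow> 'a::field_char_0"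
  assumes "\<And>i j. i \<in> A \<Longrightarrow> j \<in> A \<Longrightarrow> f i j = - f j i"
  shows "(\<Sum>i\<in>A. \<Sum>j\<in>A. f i j) = 0"
proof
  fix x
  have "(\<Sum>i\<in>A. \<Sum>j\<in>A. f i j x) = (\<Sum>i\<in>A. \<Sum>j\<in>A. f j i x)"
    by (rule sum.swap)
  also have "\<dots> = (\<Sum>i\<in>A. \<Sum>j\<in>A. - f i j x)"
    by (intro sum.cong refl) (metis assms fun_Compl_def)
  also have "\<dots> = - (\<Sum>i\<in>A. \<Sum>j\<in>A. f i j x)"
    by (simp add: sum_negf)
  finally have "2 * (\<Sum>i\<in>A. \<Sum>j\<in>A. f i j x) = 0" by (simp add: eq_neg_iff_add_eq_0)
  then show "(\<Sum>i\<in>A. \<Sum>j\<in>A. f i j) x = 0 x" by (simp add: sum_fun_apply)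
qed

lemma pd_dplus: "pd j (dplus m P) \<alpha> = (\<Sum>i\<in>{1..m-1}. cwedge m (ebasis i) (pd j (pd i P) \<alpha>))"
  and pd_dminus: "pd j (dminus m P) \<alpha> = (\<Sum>i\<in>{1..m-1}. cdot m (ebasis i) (pd j (pd i P) \<alpha>))"
  for P :: "'a::field_char_0 cpoly"
  by (simp_all only: pd_apply[of j "dplus m P"] pd_apply[of j "dminus m P"] dplus_apply dminus_apply
      scl_sum cwedge_scl[symmetric] cdot_scl[symmetric] pd_apply[of j "pd _ P"])

text \<open>Partial derivatives commute while outer products by basis vectors anticommute, so the
  double sum is antisymmetric in its indices. The same argument with inner products serves
  \<open>dminus\<close>.\<close>

lemma dplus_dplus: "dplus m (dplus m P) = (0 :: 'a::field_char_0 cpoly)"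
proof
  fix \<alpha>
  have "dplus m (dplus m P) \<alpha> = (\<Sum>j\<in>{1..m-1}. \<Sum>i\<in>{1..m-1}.
      cwedge m (ebasis j) (cwedge m (ebasis i) (pd j (pd i P) \<alpha>)))"
    by (simp only: dplus_apply pd_dplus cwedge_sum)
  also have "\<dots> = 0"
  proof (rule antisymmetric_sum_eq_0)
    fix i j assume "i \<in> {1..m-1}" "j \<in> {1..m-1}"
    then have "i \<in> {1..m}" "j \<in> {1..m}" by auto
    from cwedge_cwedge_anticommute[OF ginv_ebasis ginv_ebasis ebasis_relation[OF this]]
    show "cwedge m (ebasis i) (cwedge m (ebasis j) (pd i (pd j P) \<alpha>)) =
      - cwedge m (ebasis j) (cwedge m (ebasis i) (pd j (pd i P) \<alpha>))"
      by (simp only: pd_commute[of i j])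
  qed
  finally show "dplus m (dplus m P) \<alpha> = 0 \<alpha>" by (simp only: zero_fun_apply)
qed

lemma dminus_dminus: "dminus m (dminus m P) = (0 :: 'a::field_char_0 cpoly)"
proof
  fix \<alpha>
  have "dminus m (dminus m P) \<alpha> = (\<Sum>j\<in>{1..m-1}. \<Sum>i\<in>{1..m-1}.
      cdot m (ebasis j) (cdot m (ebasis i) (pd j (pd i P) \<alpha>)))"
    by (simp only: dminus_apply pd_dminus cdot_sum)
  also have "\<dots> = 0"
  proof (rule antisymmetric_sum_eq_0)
    fix i j assume "i \<in> {1..m-1}" "j \<in> {1..m-1}"
    then have "i \<in> {1..m}" "j \<in> {1..m}" by auto
    from cdot_cdot_anticommute[OF ginv_ebasis ginv_ebasis ebasis_relation[OF this]]
    show "cdot m (ebasis i) (cdot m (ebasis j) (pd i (pd j P) \<alpha>)) =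
      - cdot m (ebasis j) (cdot m (ebasis i) (pd j (pd i P) \<alpha>))"
      by (simp only: pd_commute[of i j])
  qed
  finally show "dminus m (dminus m P) \<alpha> = 0 \<alpha>" by (simp only: zero_fun_apply)
qed

text \<open>A nonzero coefficient of \<open>dplus m P\<close> is traced back to one of
  \<open>P\<close>, with the exponent of some \<open>x_j\<close> one higher and \<open>j\<close>
  removed from the blade. Degree, support and grade of \<open>dplus m P\<close> are all read off
  from this source.\<close>

lemma dplus_nonzeroE:
  fixes P :: "'a::field_char_0 cpoly"
  assumes "dplus m P \<alpha> C \<noteq> 0"
  obtains j where "j \<in> {1..m-1}" "j \<in> C" "P (\<alpha>(j := Suc (\<alpha> j))) (C - {j}) \<noteq> 0"
proof -
  have "(\<Sum>j\<in>{1..m-1}. cwedge m (ebasis j) (pd j P \<alpha>) C) \<noteq> 0"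
    using assms by (simp add: dplus_apply sum_fun_apply)
  then obtain j where j: "j \<in> {1..m-1}" "cwedge m (ebasis j) (pd j P \<alpha>) C \<noteq> 0"
    by (meson sum.neutral)
  then have jm: "j \<in> {1..m}" by auto
  have jC: "j \<in> C" and "cmul m (ebasis j) (pd j P \<alpha>) C \<noteq> 0"
    using j(2) unfolding cwedge_ebasis[OF jm] by (auto split: if_splits)
  then have "pd j P \<alpha> (sym_diff {j} C) \<noteq> 0"
    unfolding cmul_ebasis_left[OF jm] by (auto split: if_splits)
  moreover have "sym_diff {j} C = C - {j}" using jC by auto
  ultimately have "pd j P \<alpha> (C - {j}) \<noteq> 0" by metis
  then have "P (\<alpha>(j := Suc (\<alpha> j))) (C - {j}) \<noteq> 0"
    by (auto simp: pd_def)
  then show thesis using that j(1) jC by blast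
qed

lemma dminus_nonzeroE:
  fixes P :: "'a::field_char_0 cpoly"
  assumes "dminus m P \<alpha> C \<noteq> 0"
  obtains j where "j \<in> {1..m-1}" "j \<notin> C" "P (\<alpha>(j := Suc (\<alpha> j))) (insert j C) \<noteq> 0"
proof -
  have "(\<Sum>j\<in>{1..m-1}. cdot m (ebasis j) (pd j P \<alpha>) C) \<noteq> 0"
    using assms by (simp add: dminus_apply sum_fun_apply)
  then obtain j where j: "j \<in> {1..m-1}" "cdot m (ebasis j) (pd j P \<alpha>) C \<noteq> 0"
    by (meson sum.neutral)
  then have jm: "j \<in> {1..m}" by auto
  have jC: "j \<notin> C" and "cmul m (ebasis j) (pd j P \<alpha>) C \<noteq> 0"
    using j(2) unfolding cdot_ebasis[OF jm] by (auto split: if_splits)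
  then have "pd j P \<alpha> (sym_diff {j} C) \<noteq> 0"
    unfolding cmul_ebasis_left[OF jm] by (auto split: if_splits)
  moreover have "sym_diff {j} C = insert j C" using jC by auto
  ultimately have "pd j P \<alpha> (insert j C) \<noteq> 0" by metis
  then have "P (\<alpha>(j := Suc (\<alpha> j))) (insert j C) \<noteq> 0"
    by (auto simp: pd_def)
  then show thesis using that j(1) jC by blast
qed

subsection \<open>Iterating the Cauchy-Kovalevskaya operator\<close>

lemma finite_exponents:
  "finite {\<alpha> :: nat \<Rightarrow> nat. (\<forall>i. \<alpha> i \<noteq> 0 \<longrightarrow> i \<in> {1..n}) \<and> (\<Sum>i\<in>{1..n}. \<alpha> i) = k}"
  (is "finite ?A")
proof (rule finite_subset)
  let ?B = "{\<alpha>. \<forall>i. (i \<in> {1..n} \<longrightarrow> \<alpha> i \<in> {..k}) \<and> (i \<notin> {1..n} \<longrightarrow> \<alpha> i = (0::nat))}"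
  have "\<alpha> i \<le> k" if "(\<Sum>i\<in>{1..n}. \<alpha> i) = k" "i \<in> {1..n}" for \<alpha> :: "nat \<Rightarrow> nat" and i
    using member_le_sum[OF that(2), of \<alpha>] that(1) by simp
  then show "?A \<subseteq> ?B" unfolding atMost_iff by blast
  show "finite ?B"
    by (rule finite_set_of_finite_funs) simp_all
qed

text \<open>A fixed degree bounds all exponents, so the finiteness in \<open>is_cpoly\<close>
  follows and membership becomes a condition on single coefficients.\<close>

lemma hpoly_iff:
  "P \<in> hpoly n k s \<longleftrightarrow> (\<forall>\<alpha> B. P \<alpha> B \<noteq> 0 \<longrightarrow>
     (\<forall>i. \<alpha> i \<noteq> 0 \<longrightarrow> i \<in> {1..n}) \<and> B \<subseteq> {1..n} \<and> (\<Sum>i\<in>{1..n}. \<alpha> i) = k \<and> int (card B) = s)"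
  (is "?L \<longleftrightarrow> ?R")
proof
  assume ?L then show ?R unfolding hpoly_def is_cpoly_def by blast
next
  assume R: ?R
  then have "{\<alpha>. \<exists>B. P \<alpha> B \<noteq> 0} \<subseteq>
      {\<alpha>. (\<forall>i. \<alpha> i \<noteq> 0 \<longrightarrow> i \<in> {1..n}) \<and> (\<Sum>i\<in>{1..n}. \<alpha> i) = k}" by blast
  then have "finite {\<alpha>. \<exists>B. P \<alpha> B \<noteq> 0}"
    by (rule finite_subset[OF _ finite_exponents])
  then show ?L using R unfolding hpoly_def is_cpoly_def by blast
qed

lemma hpolyD:
  assumes "P \<in> hpoly n k s" "P \<alpha> B \<noteq> 0"
  shows "\<alpha> i \<noteq> 0 \<Longrightarrow> i \<in> {1..n}" "B \<subseteq> {1..n}" "(\<Sum>i\<in>{1..n}. \<alpha> i) = k" "int (card B) = s"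
  using assms unfolding hpoly_iff by blast+

lemma is_cpoly_hpoly: "P \<in> hpoly n k s \<Longrightarrow> is_cpoly n P"
  by (simp add: hpoly_def)

lemma zero_in_hpoly [simp]: "0 \<in> hpoly n k s"
  by (simp add: hpoly_iff)

lemma psmul_in_hpoly: "P \<in> hpoly n k s \<Longrightarrow> psmul c P \<in> hpoly n k s"
  for P :: "'a::comm_ring_1 cpoly"
  unfolding hpoly_iff psmul_def by (metis mult_zero_right)

lemma sum_fun_upd_Suc:
  fixes \<alpha> :: "'b \<Rightarrow> nat"
  assumes "finite A" "j \<in> A"
  shows "(\<Sum>i\<in>A. (\<alpha>(j := Suc (\<alpha> j))) i) = Suc (\<Sum>i\<in>A. \<alpha> i)"
proof -
  have "(\<Sum>i\<in>A - {j}. (\<alpha>(j := Suc (\<alpha> j))) i) = (\<Sum>i\<in>A - {j}. \<alpha> i)"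
    by (intro sum.cong) auto
  then show ?thesis using sum.remove[OF assms, of \<alpha>] sum.remove[OF assms, of "\<alpha>(j := Suc (\<alpha> j))"]
    by simp
qed

lemma dplus_hpoly:
  fixes P :: "'a::field_char_0 cpoly"
  assumes P: "P \<in> hpoly (m-1) k s" and nz: "dplus m P \<alpha> C \<noteq> 0"
  shows "\<alpha> i \<noteq> 0 \<Longrightarrow> i \<in> {1..m-1}" "C \<subseteq> {1..m-1}" "Suc (\<Sum>i\<in>{1..m-1}. \<alpha> i) = k"
    "int (card C) = s + 1"
proof -
  obtain j where j: "j \<in> {1..m-1}" "j \<in> C" "P (\<alpha>(j := Suc (\<alpha> j))) (C - {j}) \<noteq> 0"
    using dplus_nonzeroE[OF nz] by metis
  note D = hpolyD[OF P, OF j(3)]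
  show "i \<in> {1..m-1}" if "\<alpha> i \<noteq> 0"
    using D(1)[of i] that j(1) by (cases "i = j") simp_all
  show C: "C \<subseteq> {1..m-1}" using D(2) j(1,2) by (metis insert_Diff insert_subset)
  show "Suc (\<Sum>i\<in>{1..m-1}. \<alpha> i) = k"
    using D(3) sum_fun_upd_Suc[OF finite_atLeastAtMost j(1), of \<alpha>] by (simp only:)
  have "finite C" using C by (rule finite_subset) simp
  from card_Suc_Diff1[OF this j(2)] show "int (card C) = s + 1" using D(4) by simp
qed

lemma dminus_hpoly:
  fixes P :: "'a::field_char_0 cpoly"
  assumes P: "P \<in> hpoly (m-1) k s" and nz: "dminus m P \<alpha> C \<noteq> 0"
  shows "\<alpha> i \<noteq> 0 \<Longrightarrow> i \<in> {1..m-1}" "C \<subseteq> {1..m-1}" "Suc (\<Sum>i\<in>{1..m-1}. \<alpha> i) = k"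
    "int (card C) = s - 1"
proof -
  obtain j where j: "j \<in> {1..m-1}" "j \<notin> C" "P (\<alpha>(j := Suc (\<alpha> j))) (insert j C) \<noteq> 0"
    using dminus_nonzeroE[OF nz] by metis
  note D = hpolyD[OF P, OF j(3)]
  show "i \<in> {1..m-1}" if "\<alpha> i \<noteq> 0"
    using D(1)[of i] that j(1) by (cases "i = j") simp_all
  show C: "C \<subseteq> {1..m-1}" using D(2) by (rule insert_subset[THEN iffD1, THEN conjunct2])
  show "Suc (\<Sum>i\<in>{1..m-1}. \<alpha> i) = k"
    using D(3) sum_fun_upd_Suc[OF finite_atLeastAtMost j(1), of \<alpha>] by (simp only:)
  have "finite C" using C by (rule finite_subset) simp
  then have "card (insert j C) = Suc (card C)" using j(2) by simp
  then show "int (card C) = s - 1" using D(4) by simp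
qed

lemma dplus_in_hpoly:
  fixes P :: "'a::field_char_0 cpoly"
  assumes "P \<in> hpoly (m-1) (Suc k) s"
  shows "dplus m P \<in> hpoly (m-1) k (s + 1)"
  using dplus_hpoly[OF assms] unfolding hpoly_iff by blast

lemma dminus_in_hpoly:
  fixes P :: "'a::field_char_0 cpoly"
  assumes "P \<in> hpoly (m-1) (Suc k) s"
  shows "dminus m P \<in> hpoly (m-1) k (s - 1)"
  using dminus_hpoly[OF assms] unfolding hpoly_iff by blast

lemma dplus_hpoly_0: "P \<in> hpoly (m-1) 0 s \<Longrightarrow> dplus m P = (0 :: 'a::field_char_0 cpoly)"
  and dminus_hpoly_0: "P \<in> hpoly (m-1) 0 s \<Longrightarrow> dminus m P = (0 :: 'a::field_char_0 cpoly)"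
  using dplus_hpoly(3)[of P m 0 s] dminus_hpoly(3)[of P m 0 s] by (auto simp: fun_eq_iff)

section \<open>The Cauchy problem in the last variable\<close>

text \<open>The operator called \<open>D\<close> in the overview.\<close>

definition ckop :: "nat \<Rightarrow> 'a::comm_ring_1 cpoly \<Rightarrow> 'a cpoly" where
  "ckop m P = plmul m (ebasis m) (dirac_u m P)"

lemma CK_ckop: "CK m p0 = (\<lambda>\<alpha> B. \<Sum>j\<le>\<alpha> m. mulx m j ((ckop m ^^ j) p0) \<alpha> B / fact j)"
  unfolding CK_def ckop_def[abs_def] ..

lemma ckop_apply: "ckop m P \<alpha> = cmul m (ebasis m) (dirac_u m P \<alpha>)"
  by (simp add: ckop_def plmul_apply)

lemma ckop_psmul: "ckop m (psmul c P) = psmul c (ckop m (P :: 'a::field_char_0 cpoly))"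
  by (rule ext) (simp only: ckop_apply dirac_u_psmul psmul_apply cmul_scl_right)

lemma ckop_add: "ckop m (P + Q) = ckop m P + ckop m Q"
  by (rule ext) (simp only: ckop_apply dirac_u_add plus_fun_apply cmul_add_right)

lemma ckop_funpow_add: "(ckop m ^^ n) (P + Q) = (ckop m ^^ n) P + (ckop m ^^ n) Q"
  by (induction n) (simp_all only: funpow.simps id_apply comp_apply ckop_add)

lemma ckop_funpow_psmul:
  "(ckop m ^^ n) (psmul c P) = psmul c ((ckop m ^^ n) (P :: 'a::field_char_0 cpoly))"
  by (induction n) (simp_all only: funpow.simps id_apply comp_apply ckop_psmul)

lemma CK_add: "CK m (p + q) = CK m p + CK m q"
  by (simp add: CK_ckop fun_eq_iff ckop_funpow_add mulx_def add_divide_distrib flip: sum.distrib)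

lemma CK_psmul: "CK m (psmul c p) = psmul c (CK m p)"
  unfolding CK_ckop ckop_funpow_psmul
  by (auto simp: fun_eq_iff mulx_def psmul_def sum_distrib_left intro!: sum.cong)

text \<open>\<^const>\<open>ckop\<close> differentiates in the first \<open>m - 1\<close> variables only, so it commutes with freezing
  the exponent of the last one.\<close>

lemma pd_slice: "j \<noteq> m \<Longrightarrow> pd j (\<lambda>\<alpha>. Q (\<alpha>(m := t))) = (\<lambda>\<alpha>. pd j Q (\<alpha>(m := t)))"
  by (simp add: pd_def fun_upd_twist)

lemma ckop_slice: "ckop m (\<lambda>\<alpha>. Q (\<alpha>(m := t))) = (\<lambda>\<alpha>. ckop m Q (\<alpha>(m := t)))"
proof
  fix \<alpha>
  have "pd j (\<lambda>\<alpha>. Q (\<alpha>(m := t))) \<alpha> = pd j Q (\<alpha>(m := t))" if "j \<in> {1..m-1}" for j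
    using pd_slice[of j m Q t] that by auto
  then show "ckop m (\<lambda>\<alpha>. Q (\<alpha>(m := t))) \<alpha> = ckop m Q (\<alpha>(m := t))"
    by (simp only: ckop_apply dirac_u_apply cong: sum.cong)
qed

lemma restr_apply: "restr m P \<alpha> = (if \<alpha> m = 0 then P \<alpha> else 0)"
  by (auto simp: restr_def)

lemma ckop_restr: "ckop m (restr m P) = restr m (ckop m P)"
proof
  fix \<alpha>
  have "pd j (restr m P) \<alpha> = (if \<alpha> m = 0 then pd j P \<alpha> else 0)" if "j \<in> {1..m-1}" for j
    using that by (auto simp: pd_apply restr_apply scl_def)
  then have "dirac_u m (restr m P) \<alpha> = (if \<alpha> m = 0 then dirac_u m P \<alpha> else 0)"
    by (cases "\<alpha> m = 0") (simp_all only: dirac_u_apply refl if_True if_False cmul_zero_right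
        sum.neutral_const cong: sum.cong)
  then show "ckop m (restr m P) \<alpha> = restr m (ckop m P) \<alpha>"
    by (simp add: ckop_apply restr_apply)
qed

lemma ckop_funpow_restr: "(ckop m ^^ n) (restr m P) = restr m ((ckop m ^^ n) P)"
  by (induction n) (simp_all only: funpow.simps id_apply comp_apply ckop_restr)

text \<open>The condition \<open>restr m p = p\<close> encodes that \<open>p\<close> does not
  involve the last variable. The iterates of \<open>ckop m\<close> inherit it, and the shift by
  \<open>mulx m j\<close> then lets only \<open>j = \<alpha> m\<close> contribute to the coefficient
  at \<alpha>.\<close>

lemma CK_apply:
  assumes "restr m p = p"
  shows "CK m p \<alpha> = scl (1 / fact (\<alpha> m)) ((ckop m ^^ \<alpha> m) p (\<alpha>(m := 0)))"
proof
  fix B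
  have r: "(ckop m ^^ j) p \<beta> B = 0" if "\<beta> m \<noteq> 0" for \<beta> j
    using ckop_funpow_restr[of j m p] that unfolding assms by (metis restr_def)
  have "CK m p \<alpha> B = (\<Sum>j\<le>\<alpha> m. if j = \<alpha> m then (ckop m ^^ \<alpha> m) p (\<alpha>(m := 0)) B / fact (\<alpha> m) else 0)"
    unfolding CK_ckop by (intro sum.cong) (auto simp: mulx_def r)
  then show "CK m p \<alpha> B = scl (1 / fact (\<alpha> m)) ((ckop m ^^ \<alpha> m) p (\<alpha>(m := 0))) B"
    by (simp add: scl_def)
qed

lemma restr_CK: "restr m p = p \<Longrightarrow> restr m (CK m p) = p"
  by (rule ext) (metis (no_types, lifting) CK_apply div_by_1 fact_0 fun_upd_triv funpow_0
      restr_apply scl_one)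

text \<open>Differentiating \<open>x_m ^ (n + 1) / (n + 1)!\<close> gives
  \<open>x_m ^ n / n!\<close>, while the iterate attached to it keeps its index
  \<open>n + 1\<close>: one application of \<open>ckop m\<close> more than in the original
  coefficient.\<close>

lemma pd_CK:
  fixes p :: "'a::field_char_0 cpoly"
  assumes "restr m p = p"
  shows "pd m (CK m p) = ckop m (CK m p)"
proof
  fix \<alpha> :: "nat \<Rightarrow> nat"
  define n where "n = \<alpha> m"
  have \<alpha>: "\<alpha>(m := n) = \<alpha>" by (simp add: n_def)
  have fa: "of_nat (Suc n) * (1 / fact (Suc n)) = (1 / fact n :: 'a)"
    by (simp del: of_nat_Suc)
  \<comment> \<open>Freezing the last exponent at \<open>n\<close> turns the extension into a
    multiple of a single iterate, to which \<open>ckop_slice\<close> applies.\<close>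
  have "(\<lambda>\<beta>. CK m p (\<beta>(m := n))) = psmul (1 / fact n) (\<lambda>\<beta>. (ckop m ^^ n) p (\<beta>(m := 0)))"
    by (rule ext) (simp add: CK_apply[OF assms] psmul_apply)
  then have "ckop m (CK m p) (\<alpha>(m := n)) = scl (1 / fact n) (ckop m ((ckop m ^^ n) p) (\<alpha>(m := 0)))"
    using fun_cong[OF ckop_slice[of m "CK m p" n], of \<alpha>]
      fun_cong[OF ckop_slice[of m "(ckop m ^^ n) p" 0], of \<alpha>]
    by (simp only: ckop_psmul psmul_apply)
  moreover have "pd m (CK m p) \<alpha> = scl (1 / fact n) ((ckop m ^^ Suc n) p (\<alpha>(m := 0)))"
    unfolding pd_apply n_def[symmetric] CK_apply[OF assms]
    by (simp only: fun_upd_same fun_upd_upd scl_scl fa)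
  ultimately show "pd m (CK m p) \<alpha> = ckop m (CK m p) \<alpha>"
    by (simp only: \<alpha> funpow.simps comp_apply)
qed

text \<open>The equation expresses the coefficient of \<open>x_m ^ (n + 1)\<close> through
  \<open>ckop m\<close> applied to that of \<open>x_m ^ n\<close>, so induction on the exponent
  recovers everything from the part with exponent zero. This is uniqueness for the Cauchy
  problem.\<close>

lemma eq_CK_restr:
  fixes P :: "'a::field_char_0 cpoly"
  assumes "pd m P = ckop m P"
  shows "P = CK m (restr m P)"
proof -
  have *: "P (\<alpha>(m := n)) = scl (1 / fact n) ((ckop m ^^ n) P (\<alpha>(m := 0)))" for n \<alpha>
  proof (induction n arbitrary: \<alpha>)
    case (Suc n)
    have "(\<lambda>\<beta>. P (\<beta>(m := n))) = psmul (1 / fact n) (\<lambda>\<beta>. (ckop m ^^ n) P (\<beta>(m := 0)))"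
      by (rule ext) (simp only: Suc psmul_apply)
    then have "ckop m P (\<alpha>(m := n)) = scl (1 / fact n) ((ckop m ^^ Suc n) P (\<alpha>(m := 0)))"
      using fun_cong[OF ckop_slice[of m P n], of \<alpha>]
        fun_cong[OF ckop_slice[of m "(ckop m ^^ n) P" 0], of \<alpha>]
      by (simp only: ckop_psmul psmul_apply funpow.simps comp_apply)
    moreover have "pd m P (\<alpha>(m := n)) = scl (of_nat (Suc n)) (P (\<alpha>(m := Suc n)))"
      by (simp only: pd_apply fun_upd_same fun_upd_upd)
    ultimately have "scl (of_nat (Suc n)) (P (\<alpha>(m := Suc n))) =
        scl (1 / fact n) ((ckop m ^^ Suc n) P (\<alpha>(m := 0)))"
      using assms by metis
    then have "scl (1 / of_nat (Suc n)) (scl (of_nat (Suc n)) (P (\<alpha>(m := Suc n)))) =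
        scl (1 / of_nat (Suc n)) (scl (1 / fact n) ((ckop m ^^ Suc n) P (\<alpha>(m := 0))))"
      by (rule arg_cong)
    moreover have "1 / of_nat (Suc n) * of_nat (Suc n) = (1::'a)"
      "1 / of_nat (Suc n) * (1 / fact n) = (1 / fact (Suc n) :: 'a)"
      by (simp_all del: of_nat_Suc)
    ultimately show ?case by (simp only: scl_scl scl_one)
  qed (simp add: scl_def)
  show ?thesis
  proof
    fix \<alpha>
    have "restr m (restr m P) = restr m P" by (auto simp: restr_def fun_eq_iff)
    from CK_apply[OF this, of \<alpha>]
    have "CK m (restr m P) \<alpha> = scl (1 / fact (\<alpha> m)) ((ckop m ^^ \<alpha> m) P (\<alpha>(m := 0)))"
      by (simp add: ckop_funpow_restr restr_apply)
    with *[of \<alpha> "\<alpha> m"] show "P \<alpha> = CK m (restr m P) \<alpha>" by simp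
  qed
qed

lemma dirac_eq:
  assumes "m \<ge> 1"
  shows "dirac m P \<alpha> = dirac_u m P \<alpha> + cmul m (ebasis m) (pd m P \<alpha>)"
proof -
  have "{1..m} = insert m {1..m-1}" using assms by auto
  moreover have "m \<notin> {1..m-1}" using assms by auto
  ultimately show ?thesis
    by (simp only: dirac_apply dirac_u_apply sum.insert finite_atLeastAtMost not_False_eq_True
        add.commute)
qed

lemma ebasis_ebasis_cmul:
  assumes "j \<in> {1..m}" "clf_on m x"
  shows "cmul m (ebasis j) (cmul m (ebasis j) x) = - x"
  using assms by (simp only: cmul_assoc[symmetric] ebasis_square cmul_minus_left cmul_cone_left)

lemma clf_on_dirac_u: "clf_on m (dirac_u m P \<alpha>)"
  unfolding dirac_u_apply by (intro clf_on_sum) simp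

lemma dirac_eq_0_iff:
  assumes "m \<ge> 1" "\<And>\<alpha>. clf_on m (P \<alpha>)"
  shows "dirac m P = 0 \<longleftrightarrow> pd m P = ckop m P"
proof
  have m: "m \<in> {1..m}" using assms by auto
  assume "dirac m P = 0"
  show "pd m P = ckop m P"
  proof
    fix \<alpha>
    have "clf_on m (pd m P \<alpha>)" unfolding pd_apply by (intro clf_on_scl assms)
    moreover have "dirac_u m P \<alpha> + cmul m (ebasis m) (pd m P \<alpha>) = 0"
      using \<open>dirac m P = 0\<close> dirac_eq[OF assms(1), of P \<alpha>] by (metis zero_fun_apply)
    \<comment> \<open>Multiplication by \<open>e_m\<close> from the left turns the second summand
      into \<open>- pd m P\<close>; this cancellation relies on the support of
      \<open>P\<close>.\<close>
    then have "cmul m (ebasis m) (dirac_u m P \<alpha>) + cmul m (ebasis m) (cmul m (ebasis m) (pd m P \<alpha>)) = 0"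
      by (simp only: cmul_add_right[symmetric] cmul_zero_right)
    ultimately have "ckop m P \<alpha> + - pd m P \<alpha> = 0"
      by (simp only: ebasis_ebasis_cmul[OF m] ckop_apply)
    then show "pd m P \<alpha> = ckop m P \<alpha>" by (metis add.right_inverse add_right_cancel)
  qed
next
  have m: "m \<in> {1..m}" using assms by auto
  assume "pd m P = ckop m P"
  then have "dirac m P \<alpha> = 0" for \<alpha>
    by (simp only: dirac_eq[OF assms(1)] ckop_apply ebasis_ebasis_cmul[OF m clf_on_dirac_u]
        add.right_inverse)
  then show "dirac m P = 0" by (simp add: fun_eq_iff)
qed

section \<open>Moving \<open>e_m\<close> past the first \<open>m - 1\<close> generators\<close>

lemma ginv_grade:
  fixes w :: "'a::field clf"
  assumes "\<And>B. w B \<noteq> 0 \<Longrightarrow> int (card B) = g"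
  shows "ginv w = scl ((- 1) powi g) w"
proof
  fix B
  show "ginv w B = scl ((- 1) powi g) w B"
    using assms[of B] by (cases "w B = 0") (auto simp: ginv_def scl_def)
qed

text \<open>No blade of \<open>w\<close> contains \<open>m\<close>, so the inner product of
  \<open>e_m\<close> with \<open>w\<close> is zero; written out, this is the claim.\<close>

lemma ebasis_cmul_commute:
  fixes w :: "'a::field_char_0 clf"
  assumes "m \<ge> 1" "clf_on (m-1) w"
  shows "cmul m (ebasis m) w = cmul m (ginv w) (ebasis m)"
proof
  fix C
  have m: "m \<in> {1..m}" using assms by auto
  have "cdot m (ebasis m) w C = 0"
  proof (cases "m \<in> C")
    case False
    have "\<not> sym_diff {m} C \<subseteq> {1..m-1}"
    proof
      assume "sym_diff {m} C \<subseteq> {1..m-1}"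
      then have "m \<in> {1..m-1}" using False by blast
      then show False using assms(1) by simp
    qed
    then have "w (sym_diff {m} C) = 0" using assms(2) unfolding clf_on_def by metis
    then show ?thesis using m
      by (simp only: cdot_ebasis cmul_ebasis_left mult_zero_right if_cancel)
  qed (simp add: cdot_ebasis[OF m])
  then show "cmul m (ebasis m) w C = cmul m (ginv w) (ebasis m) C"
    by (simp add: cdot_def)
qed

lemma clf_on_hpoly: "P \<in> hpoly n k s \<Longrightarrow> clf_on n (P \<alpha>)"
  unfolding hpoly_iff clf_on_def by metis

lemma clf_on_dirac_u_hpoly:
  fixes P :: "'a::field_char_0 cpoly"
  assumes "P \<in> hpoly (m-1) k s"
  shows "clf_on (m-1) (dirac_u m P \<alpha>)"
proof -
  have "clf_on (m-1) (dplus m P \<alpha>)" "clf_on (m-1) (dminus m P \<alpha>)"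
    using dplus_hpoly(2)[OF assms] dminus_hpoly(2)[OF assms] unfolding clf_on_def by metis+
  then show ?thesis by (simp only: dirac_u_eq plus_fun_apply clf_on_add)
qed

lemma dirac_u_prmul: "dirac_u m (prmul m P c) = prmul m (dirac_u m P) c"
  by (rule ext) (simp only: dirac_u_apply prmul_apply pd_apply cmul_scl_left cmul_scl_right
      cmul_sum_left cmul_assoc)

text \<open>Moving \<open>e_m\<close> to the right leaves it in the \<open>u\<close> part and meets
  the second \<open>e_m\<close> in the \<open>v\<close> part, where \<open>e_m ^ 2 = - 1\<close>
  removes both. The two terms sit on blades with and without \<open>m\<close>, so they can be
  examined separately.\<close>

lemma ckop_split:
  fixes u v :: "'a::field_char_0 cpoly"
  assumes m: "m \<ge> 1" and u: "u \<in> hpoly (m-1) k s" and v: "v \<in> hpoly (m-1) k s'"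
  shows "ckop m (u + prmul m v (ebasis m)) \<alpha> =
    cmul m (ginv (dirac_u m u \<alpha>)) (ebasis m) - ginv (dirac_u m v \<alpha>)"
proof -
  have mm: "m \<in> {1..m}" using m by auto
  let ?w = "dirac_u m v \<alpha>"
  have "clf_on m (ginv ?w)"
    by (intro clf_on_ginv clf_on_dirac_u)
  then have "cmul m (ebasis m) (cmul m ?w (ebasis m)) = - ginv ?w"
    by (simp only: cmul_assoc[symmetric] ebasis_cmul_commute[OF m clf_on_dirac_u_hpoly[OF v]])
       (simp only: cmul_assoc ebasis_square[OF mm] cmul_minus_right cmul_cone_right)
  then show ?thesis
    by (simp only: ckop_add plus_fun_apply ckop_apply dirac_u_prmul prmul_apply
        ebasis_cmul_commute[OF m clf_on_dirac_u_hpoly[OF u]] add_uminus_conv_diff)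
qed

lemma minus_one_powi_pred: "(- 1) powi (s - 1) = - ((- 1) powi s :: 'a::field)"
  by (simp add: power_int_diff)

lemma minus_one_powi_square: "(- 1) powi s * (- 1) powi s = (1 :: 'a::field)"
  by (cases s rule: int_cases3) (simp_all add: power_int_def flip: power_mult_distrib)

text \<open>On the kernels only \<open>dminus m u\<close>, of grade \<open>s - 1\<close>, and
  \<open>dplus m v\<close>, of grade \<open>s\<close>, are left. The involution contributes
  \<open>(- 1) powi (s - 1)\<close> and \<open>(- 1) powi s\<close>; the minus sign in front of the
  \<open>v\<close> part makes the two signs equal. The components exchange roles: the new part
  without \<open>e_m\<close> comes from \<open>v\<close>.\<close>

lemma ckop_Ker:
  fixes u v :: "'a::field_char_0 cpoly"
  assumes m: "m \<ge> 1" and u: "u \<in> Ker_plus m k s" and v: "v \<in> Ker_minus m k (s - 1)"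
  shows "ckop m (u + prmul m v (ebasis m)) =
    psmul ((- 1) powi (s - 1)) (dplus m v) + prmul m (psmul ((- 1) powi (s - 1)) (dminus m u)) (ebasis m)"
proof
  fix \<alpha>
  have hu: "u \<in> hpoly (m-1) k s" and du: "dirac_u m u = dminus m u"
    using u by (auto simp: Ker_plus_def dirac_u_eq)
  have hv: "v \<in> hpoly (m-1) k (s-1)" and dv: "dirac_u m v = dplus m v"
    using v by (auto simp: Ker_minus_def dirac_u_eq)
  have "ginv (dminus m u \<alpha>) = scl ((- 1) powi (s - 1)) (dminus m u \<alpha>)"
    by (rule ginv_grade) (rule dminus_hpoly(4)[OF hu])
  moreover have "ginv (dplus m v \<alpha>) = scl ((- 1) powi s) (dplus m v \<alpha>)"
    by (rule ginv_grade) (use dplus_hpoly(4)[OF hv] in simp)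
  moreover have "- scl ((- 1) powi s) (dplus m v \<alpha>) = scl ((- 1) powi (s - 1)) (dplus m v \<alpha>)"
    unfolding minus_one_powi_pred by (simp add: scl_def fun_eq_iff)
  ultimately show "ckop m (u + prmul m v (ebasis m)) \<alpha> = (psmul ((- 1) powi (s - 1)) (dplus m v) +
      prmul m (psmul ((- 1) powi (s - 1)) (dminus m u)) (ebasis m)) \<alpha>"
    by (simp only: ckop_split[OF m hu hv] du dv plus_fun_apply psmul_apply prmul_apply
        diff_conv_add_uminus add.commute)
qed

lemma psmul_dplus_in_Ker:
  fixes v :: "'a::field_char_0 cpoly"
  assumes "v \<in> Ker_minus m (Suc k) (s - 1)"
  shows "psmul c (dplus m v) \<in> Ker_plus m k s"
proof -
  have "dplus m v \<in> hpoly (m-1) k s"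
    using dplus_in_hpoly[of v m k "s - 1"] assms by (simp add: Ker_minus_def)
  then show ?thesis
    by (simp add: Ker_plus_def psmul_in_hpoly dplus_psmul dplus_dplus) (simp add: psmul_def fun_eq_iff)
qed

lemma psmul_dminus_in_Ker:
  fixes u :: "'a::field_char_0 cpoly"
  assumes "u \<in> Ker_plus m (Suc k) s"
  shows "psmul c (dminus m u) \<in> Ker_minus m k (s - 1)"
proof -
  have "dminus m u \<in> hpoly (m-1) k (s - 1)"
    using dminus_in_hpoly[of u m k s] assms by (simp add: Ker_plus_def)
  then show ?thesis
    by (simp add: Ker_minus_def psmul_in_hpoly dminus_psmul dminus_dminus)
      (simp add: psmul_def fun_eq_iff)
qed

section \<open>The coefficients \<open>u_j\<close> and \<open>v_j\<close>\<close>

text \<open>Together with \<open>ck_v\<close> these are the families of the theorem in closed form;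
  \<open>ck_Suc\<close> is the recursion through which they arise from iterating
  \<open>ckop m\<close>.\<close>

definition ck_u :: "nat \<Rightarrow> int \<Rightarrow> 'a::field cpoly \<Rightarrow> 'a cpoly \<Rightarrow> nat \<Rightarrow> 'a cpoly" where
  "ck_u m s u0 v0 j = (if even j then ((dplus m \<circ> dminus m) ^^ (j div 2)) u0
     else psmul ((-1) powi (s - 1)) (((dplus m \<circ> dminus m) ^^ (j div 2)) (dplus m v0)))"

definition ck_v :: "nat \<Rightarrow> int \<Rightarrow> 'a::field cpoly \<Rightarrow> 'a cpoly \<Rightarrow> nat \<Rightarrow> 'a cpoly" where
  "ck_v m s u0 v0 j = (if even j then ((dminus m \<circ> dplus m) ^^ (j div 2)) v0
     else psmul ((-1) powi (s - 1)) (((dminus m \<circ> dplus m) ^^ (j div 2)) (dminus m u0)))"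

lemma funpow_comp_shift: "((f \<circ> g) ^^ t) (f x) = f (((g \<circ> f) ^^ t) x)"
  by (induction t) simp_all

lemma psmul_psmul_sign: "psmul ((- 1) powi s) (psmul ((- 1) powi s) P) = (P :: 'a::field cpoly)"
  using minus_one_powi_square[of s, where 'a='a]
  by (simp add: psmul_def fun_eq_iff flip: mult.assoc)

text \<open>Every step contributes the sign \<open>(- 1) powi (s - 1)\<close>, and two consecutive
  signs cancel, which is why only odd indices carry one.\<close>

lemma ck_Suc:
  fixes u0 v0 :: "'a::field_char_0 cpoly"
  shows "ck_u m s u0 v0 (Suc j) = psmul ((-1) powi (s - 1)) (dplus m (ck_v m s u0 v0 j))"
    and "ck_v m s u0 v0 (Suc j) = psmul ((-1) powi (s - 1)) (dminus m (ck_u m s u0 v0 j))"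
proof -
  have "ck_u m s u0 v0 (Suc j) = psmul ((-1) powi (s - 1)) (dplus m (ck_v m s u0 v0 j))
      \<and> ck_v m s u0 v0 (Suc j) = psmul ((-1) powi (s - 1)) (dminus m (ck_u m s u0 v0 j))"
  proof (cases "even j")
    case True
    then have "Suc j div 2 = j div 2" by simp
    then show ?thesis using True
      by (simp add: ck_u_def ck_v_def funpow_comp_shift del: comp_apply)
  next
    case False
    then have "Suc j div 2 = Suc (j div 2)" by simp
    then show ?thesis using False
      by (simp add: ck_u_def ck_v_def dplus_psmul dminus_psmul psmul_psmul_sign
        funpow_comp_shift[symmetric] funpow_Suc_right del: funpow.simps)
  qed
  then show "ck_u m s u0 v0 (Suc j) = psmul ((-1) powi (s - 1)) (dplus m (ck_v m s u0 v0 j))"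
    and "ck_v m s u0 v0 (Suc j) = psmul ((-1) powi (s - 1)) (dminus m (ck_u m s u0 v0 j))"
    by blast+
qed

lemma psmul_zero [simp]: "psmul c 0 = (0 :: 'a::comm_ring_1 cpoly)"
  by (simp add: psmul_def fun_eq_iff)

lemma prmul_zero [simp]: "prmul m 0 c = 0"
  by (rule ext) (simp only: prmul_apply zero_fun_apply cmul_zero_left)

lemma zero_in_Ker [simp]:
  "(0 :: 'a::field_char_0 cpoly) \<in> Ker_plus m k s" "(0 :: 'a::field_char_0 cpoly) \<in> Ker_minus m k s"
  by (simp_all add: Ker_plus_def Ker_minus_def)

text \<open>\<open>k - j\<close> is truncated subtraction: for \<open>j > k\<close> the membership
  statements refer to degree 0 and hold because the polynomials are zero there.\<close>

lemma ck_funpow: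
  fixes u0 v0 :: "'a::field_char_0 cpoly"
  assumes m: "m \<ge> 1" and u: "u0 \<in> Ker_plus m k s" and v: "v0 \<in> Ker_minus m k (s - 1)"
  defines "U \<equiv> ck_u m s u0 v0" and "V \<equiv> ck_v m s u0 v0"
  shows "U j \<in> Ker_plus m (k - j) s" "V j \<in> Ker_minus m (k - j) (s - 1)"
    "j > k \<Longrightarrow> U j = 0" "j > k \<Longrightarrow> V j = 0"
    "(ckop m ^^ j) (u0 + prmul m v0 (ebasis m)) = U j + prmul m (V j) (ebasis m)"
proof -
  have "U j \<in> Ker_plus m (k - j) s \<and> V j \<in> Ker_minus m (k - j) (s - 1) \<and>
    (j > k \<longrightarrow> U j = 0 \<and> V j = 0) \<and>
    (ckop m ^^ j) (u0 + prmul m v0 (ebasis m)) = U j + prmul m (V j) (ebasis m)"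
  proof (induction j)
    case 0
    then show ?case using u v by (simp add: U_def V_def ck_u_def ck_v_def)
  next
    case (Suc j)
    have S: "U (Suc j) = psmul ((-1) powi (s - 1)) (dplus m (V j))"
      "V (Suc j) = psmul ((-1) powi (s - 1)) (dminus m (U j))"
      unfolding U_def V_def by (rule ck_Suc)+
    have "(ckop m ^^ Suc j) (u0 + prmul m v0 (ebasis m)) = ckop m (U j + prmul m (V j) (ebasis m))"
      using Suc by (simp only: funpow.simps comp_apply)
    also have "\<dots> = U (Suc j) + prmul m (V (Suc j)) (ebasis m)"
      unfolding S using Suc by (intro ckop_Ker[OF m]) blast+
    finally have eq: "(ckop m ^^ Suc j) (u0 + prmul m v0 (ebasis m)) =
        U (Suc j) + prmul m (V (Suc j)) (ebasis m)" .
    \<comment> \<open>From degree 0 a further derivative gives zero, so both families stop after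
      index \<open>k\<close>.\<close>
    have Z: "U (Suc j) = 0 \<and> V (Suc j) = 0" if "k - j = 0"
    proof -
      have "U j \<in> hpoly (m-1) 0 s" "V j \<in> hpoly (m-1) 0 (s - 1)"
        using Suc that by (auto simp: Ker_plus_def Ker_minus_def)
      then show ?thesis unfolding S by (simp add: dplus_hpoly_0 dminus_hpoly_0)
    qed
    show ?case
    proof (cases "k - j")
      case 0
      have "U (Suc j) \<in> Ker_plus m (k - Suc j) s" "V (Suc j) \<in> Ker_minus m (k - Suc j) (s - 1)"
        using Z[OF 0] zero_in_Ker by metis+
      then show ?thesis using Z[OF 0] eq by blast
    next
      case (Suc l)
      then have l: "k - Suc j = l" by simp
      have "U (Suc j) \<in> Ker_plus m l s" "V (Suc j) \<in> Ker_minus m l (s - 1)"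
        unfolding S using \<open>_ \<and> _\<close> unfolding Suc
        by (auto intro: psmul_dplus_in_Ker psmul_dminus_in_Ker)
      moreover have "\<not> Suc j > k" using Suc by simp
      ultimately show ?thesis using eq unfolding l by blast
    qed
  qed
  then show "U j \<in> Ker_plus m (k - j) s" "V j \<in> Ker_minus m (k - j) (s - 1)"
    "j > k \<Longrightarrow> U j = 0" "j > k \<Longrightarrow> V j = 0"
    "(ckop m ^^ j) (u0 + prmul m v0 (ebasis m)) = U j + prmul m (V j) (ebasis m)"
    by blast+
qed

lemma restr_hpoly_pred:
  assumes "m \<ge> 1" "u \<in> hpoly (m-1) k s"
  shows "restr m u = u"
proof -
  have "m \<notin> {1..m-1}" using assms(1) by auto
  then have "u \<alpha> B = 0" if "\<alpha> m \<noteq> 0" for \<alpha> B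
    using assms(2) that unfolding hpoly_iff by metis
  then show ?thesis by (auto simp: restr_def fun_eq_iff)
qed

lemma restr_split:
  fixes u v :: "'a::field_char_0 cpoly"
  assumes m: "m \<ge> 1" and "u \<in> hpoly (m-1) k s" "v \<in> hpoly (m-1) k s'"
  shows "restr m (u + prmul m v (ebasis m)) = u + prmul m v (ebasis m)"
proof
  fix \<alpha>
  have "restr m u \<alpha> = u \<alpha>" "restr m v \<alpha> = v \<alpha>"
    using restr_hpoly_pred[OF m] assms(2,3) by metis+
  then show "restr m (u + prmul m v (ebasis m)) \<alpha> = (u + prmul m v (ebasis m)) \<alpha>"
    unfolding restr_apply by (auto simp: prmul_apply)
qed

lemma Ispace_E:
  assumes "p \<in> Ispace m k s"
  obtains u v where "u \<in> Ker_plus m k s" "v \<in> Ker_minus m k (s - 1)" "p = u + prmul m v (ebasis m)"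
  using assms unfolding Ispace_def by blast

lemma restr_Ispace:
  fixes p :: "'a::field_char_0 cpoly"
  assumes "m \<ge> 1" "p \<in> Ispace m k s"
  shows "restr m p = p"
proof -
  obtain u v where uv: "u \<in> Ker_plus m k s" "v \<in> Ker_minus m k (s - 1)" "p = u + prmul m v (ebasis m)"
    using assms(2) by (rule Ispace_E)
  then have "u \<in> hpoly (m-1) k s" "v \<in> hpoly (m-1) k (s-1)"
    by (simp_all add: Ker_plus_def Ker_minus_def)
  from restr_split[OF assms(1) this] show ?thesis unfolding uv(3) .
qed

text \<open>Coefficients are compared for a fixed exponent \<open>n\<close> of the last variable:
  only the summand \<open>j = n\<close> contributes on the right, and only the \<open>n\<close>-th
  iterate on the left.\<close>

lemma CK_formula:
  fixes u0 v0 :: "'a::field_char_0 cpoly"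
  assumes m: "m \<ge> 1" and u: "u0 \<in> Ker_plus m k s" and v: "v0 \<in> Ker_minus m k (s - 1)"
  shows "CK m (u0 + prmul m v0 (ebasis m)) =
    (\<Sum>j\<le>k. psmul (1 / fact j) (mulx m j (ck_u m s u0 v0 j))) +
    (\<Sum>j\<le>k. psmul (1 / fact j) (mulx m j (prmul m (ck_v m s u0 v0 j) (ebasis m))))"
proof (rule ext)+
  fix \<alpha> B
  let ?U = "ck_u m s u0 v0" and ?V = "\<lambda>j. prmul m (ck_v m s u0 v0 j) (ebasis m)"
  note ck = ck_funpow[OF m u v]
  have hU: "?U j \<in> hpoly (m-1) (k - j) s" "ck_v m s u0 v0 j \<in> hpoly (m-1) (k - j) (s-1)" for j
    using ck(1,2)[of j] by (simp_all add: Ker_plus_def Ker_minus_def)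
  have r: "restr m (?U j) = ?U j" "restr m (?V j) = ?V j" for j
    using restr_hpoly_pred[OF m hU(1)] restr_split[OF m zero_in_hpoly hU(2), of j]
    by simp_all
  \<comment> \<open>For \<open>\<alpha> m > k\<close> the sum has no matching index, and the
    right-hand side is zero by \<open>W0\<close>; so cutting off at \<open>k\<close> loses
    nothing.\<close>
  have sumeq: "(\<Sum>j\<le>k. psmul (1 / fact j) (mulx m j (W j))) \<alpha> B =
      W (\<alpha> m) (\<alpha>(m := 0)) B / fact (\<alpha> m)"
    if W: "\<And>j. restr m (W j) = W j" and W0: "\<And>j. j > k \<Longrightarrow> W j = 0"
    for W :: "nat \<Rightarrow> 'a cpoly"
  proof -
    have r: "W j \<beta> B = 0" if "\<beta> m \<noteq> 0" for \<beta> j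
      using W[of j] that by (metis restr_def)
    have "(\<Sum>j\<le>k. psmul (1 / fact j) (mulx m j (W j))) \<alpha> B =
      (\<Sum>j\<le>k. if j = \<alpha> m then W (\<alpha> m) (\<alpha>(m := 0)) B / fact (\<alpha> m) else 0)"
      unfolding sum_fun_apply by (intro sum.cong) (auto simp: psmul_def mulx_def r)
    also have "\<dots> = W (\<alpha> m) (\<alpha>(m := 0)) B / fact (\<alpha> m)"
      using W0[of "\<alpha> m"] by simp
    finally show ?thesis .
  qed
  have "restr m (u0 + prmul m v0 (ebasis m)) = u0 + prmul m v0 (ebasis m)"
    using u v by (intro restr_Ispace[OF m]) (auto simp: Ispace_def)
  then have "CK m (u0 + prmul m v0 (ebasis m)) \<alpha> B =
      (?U (\<alpha> m) + ?V (\<alpha> m)) (\<alpha>(m := 0)) B / fact (\<alpha> m)"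
    unfolding ck(5)[symmetric] by (simp add: CK_apply scl_def)
  also have "\<dots> = ?U (\<alpha> m) (\<alpha>(m := 0)) B / fact (\<alpha> m) + ?V (\<alpha> m) (\<alpha>(m := 0)) B / fact (\<alpha> m)"
    by (simp add: add_divide_distrib)
  also have "\<dots> = ((\<Sum>j\<le>k. psmul (1 / fact j) (mulx m j (?U j))) +
      (\<Sum>j\<le>k. psmul (1 / fact j) (mulx m j (?V j)))) \<alpha> B"
    using sumeq[of ?U] sumeq[of ?V] r ck(3,4) by simp
  finally show "CK m (u0 + prmul m v0 (ebasis m)) \<alpha> B =
      ((\<Sum>j\<le>k. psmul (1 / fact j) (mulx m j (?U j))) +
      (\<Sum>j\<le>k. psmul (1 / fact j) (mulx m j (?V j)))) \<alpha> B" .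
qed

subsection \<open>Monogenic polynomials and their restrictions\<close>

text \<open>Every index in a blade of \<open>w\<close> is below \<open>m\<close>, so multiplying by
  \<open>e_m\<close> from the right only appends it, with sign 1.\<close>

lemma cmul_ebasis_last:
  fixes w :: "'a::field_char_0 clf"
  assumes "m \<ge> 1" "clf_on (m-1) w"
  shows "cmul m w (ebasis m) C = (if m \<in> C \<and> C \<subseteq> {1..m} then w (C - {m}) else 0)"
proof -
  have m: "m \<in> {1..m}" using assms(1) by auto
  show ?thesis
  proof (cases "m \<in> C")
    case True
    then have eq: "sym_diff {m} C = C - {m}" by auto
    have "bsign (C - {m}) {m} = (1::'a)" if C: "C \<subseteq> {1..m}"
    proof -
      have fin: "finite (C - {m})" using C by (auto intro: finite_subset)
      have "\<not> m \<le> a" if "a \<in> C - {m}" for a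
        using that C by (metis Diff_iff atLeastAtMost_iff insertI1 le_antisym subsetD)
      then show ?thesis using fin by (simp add: bsign_prod)
    qed
    then show ?thesis unfolding cmul_ebasis_right[OF m] eq using True by simp
  next
    case False
    then have "m \<in> sym_diff {m} C" by auto
    moreover have "m \<notin> {1..m-1}" using assms(1) by auto
    ultimately have "w (sym_diff {m} C) = 0" using assms(2) unfolding clf_on_def by blast
    then show ?thesis unfolding cmul_ebasis_right[OF m] using False by simp
  qed
qed

lemma sum_split_last: "(m::nat) \<ge> 1 \<Longrightarrow> (\<Sum>i\<in>{1..m}. \<alpha> i) = \<alpha> m + (\<Sum>i\<in>{1..m-1}. \<alpha> i :: nat)"
  by (cases m) simp_all

text \<open>The coefficient of \<open>x_m ^ n\<close> has degree \<open>k - n\<close> in the other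
  variables, which adds up to \<open>k\<close>. Its grade is \<open>s\<close> in the
  \<open>ck_u\<close> part and \<open>s - 1\<close> plus one in the part multiplied by
  \<open>e_m\<close>.\<close>

lemma CK_in_hpoly:
  fixes p :: "'a::field_char_0 cpoly"
  assumes m: "m \<ge> 1" and p: "p \<in> Ispace m k s"
  shows "CK m p \<in> hpoly m k s"
proof -
  obtain u v where uv: "u \<in> Ker_plus m k s" "v \<in> Ker_minus m k (s - 1)" "p = u + prmul m v (ebasis m)"
    using p by (rule Ispace_E)
  let ?U = "ck_u m s u v" and ?V = "ck_v m s u v"
  note ck = ck_funpow[OF m uv(1,2)]
  have hU: "?U j \<in> hpoly (m-1) (k - j) s" and hV: "?V j \<in> hpoly (m-1) (k - j) (s-1)" for j
    using ck(1,2)[of j] by (simp_all add: Ker_plus_def Ker_minus_def)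
  have main: "(\<forall>i. \<alpha> i \<noteq> 0 \<longrightarrow> i \<in> {1..m}) \<and> B \<subseteq> {1..m} \<and> (\<Sum>i\<in>{1..m}. \<alpha> i) = k \<and> int (card B) = s"
    if nz: "CK m p \<alpha> B \<noteq> 0" for \<alpha> B
  proof -
    define n where "n = \<alpha> m"
    define \<beta> where "\<beta> = \<alpha>(m := 0)"
    have nz': "?U n \<beta> B + prmul m (?V n) (ebasis m) \<beta> B \<noteq> 0"
      using nz unfolding CK_apply[OF restr_Ispace[OF m p]] n_def[symmetric] \<beta>_def[symmetric]
      unfolding uv(3) ck(5) by (auto simp: scl_def)
    \<comment> \<open>Since \<open>k - n\<close> is truncated, the total degree is \<open>k\<close>
      only for \<open>n \<le> k\<close>.\<close>
    have nk: "n \<le> k"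
    proof (rule ccontr)
      assume "\<not> n \<le> k"
      then have "?U n = 0" "?V n = 0" using ck(3,4)[of n] by auto
      then show False using nz' by simp
    qed
    have *: "(\<forall>i. \<alpha> i \<noteq> 0 \<longrightarrow> i \<in> {1..m}) \<and> (\<Sum>i\<in>{1..m}. \<alpha> i) = k"
      if W: "W \<in> hpoly (m-1) (k - n) t" and W': "W \<beta> D \<noteq> 0" for W :: "'a cpoly" and t D
    proof (intro conjI allI impI)
      note D = hpolyD[OF W, OF W']
      show "i \<in> {1..m}" if "\<alpha> i \<noteq> 0" for i
      proof (cases "i = m")
        case False
        then have "\<beta> i \<noteq> 0" using that by (simp add: \<beta>_def)
        then show ?thesis using D(1)[of i] by auto
      qed (use m in simp)
      have "(\<Sum>i\<in>{1..m-1}. \<alpha> i) = (\<Sum>i\<in>{1..m-1}. \<beta> i)"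
        by (rule sum.cong) (auto simp: \<beta>_def)
      then show "(\<Sum>i\<in>{1..m}. \<alpha> i) = k"
        unfolding sum_split_last[OF m] D(3) using nk by (simp add: n_def)
    qed
    show ?thesis
    proof (cases "?U n \<beta> B = 0")
      case False
      have "{1..m-1} \<subseteq> {1..m}" by auto
      with hpolyD(2)[OF hU, OF False] have "B \<subseteq> {1..m}" by (rule subset_trans)
      then show ?thesis using *[OF hU False] hpolyD(4)[OF hU, OF False] by blast
    next
      case True
      then have "cmul m (?V n \<beta>) (ebasis m) B \<noteq> 0" using nz' by (simp add: prmul_apply)
      then have B: "m \<in> B" "B \<subseteq> {1..m}" and V: "?V n \<beta> (B - {m}) \<noteq> 0"
        unfolding cmul_ebasis_last[OF m clf_on_hpoly[OF hV]] by (auto split: if_splits)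
      have "finite B" using B(2) by (rule finite_subset) simp
      from card_Suc_Diff1[OF this B(1)] have "int (card B) = s"
        using hpolyD(4)[OF hV, OF V] by simp
      then show ?thesis using *[OF hV V] B(2) by blast
    qed
  qed
  show ?thesis unfolding hpoly_iff using main by blast
qed

lemma CK_in_Hspace:
  fixes p :: "'a::field_char_0 cpoly"
  assumes m: "m \<ge> 1" and p: "p \<in> Ispace m k s"
  shows "CK m p \<in> Hspace m k s"
proof -
  note h = CK_in_hpoly[OF m p]
  have "dirac m (CK m p) = 0"
    using dirac_eq_0_iff[OF m, of "CK m p"] pd_CK[OF restr_Ispace[OF m p]] clf_on_hpoly[OF h] by blast
  then show ?thesis using h by (simp add: Hspace_def)
qed

lemma Hspace_eq_CK:
  fixes P :: "'a::field_char_0 cpoly"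
  assumes "m \<ge> 1" "P \<in> Hspace m k s"
  shows "pd m P = ckop m P" "P = CK m (restr m P)"
proof -
  show "pd m P = ckop m P"
    using dirac_eq_0_iff[OF assms(1), of P] assms(2) clf_on_hpoly[of P m k s] by (simp add: Hspace_def)
  then show "P = CK m (restr m P)" by (rule eq_CK_restr)
qed

lemma hpoly_decompose:
  fixes P :: "'a::field_char_0 cpoly"
  assumes m: "m \<ge> 1" and P: "P \<in> hpoly m k s"
  obtains u v where "u \<in> hpoly (m-1) k s" "v \<in> hpoly (m-1) k (s - 1)"
    "restr m P = u + prmul m v (ebasis m)"
proof -
  define u where "u = (\<lambda>\<alpha> B. if m \<in> B then 0 else restr m P \<alpha> B)"
  \<comment> \<open>The coefficient at \<open>insert m B\<close> can be taken over unchanged because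
    appending \<open>e_m\<close> costs no sign.\<close>
  define v where "v = (\<lambda>\<alpha> B. if B \<subseteq> {1..m-1} then restr m P \<alpha> (insert m B) else 0)"
  have r: "(\<forall>i. \<alpha> i \<noteq> 0 \<longrightarrow> i \<in> {1..m-1}) \<and> B \<subseteq> {1..m} \<and> (\<Sum>i\<in>{1..m-1}. \<alpha> i) = k \<and> int (card B) = s"
    if "restr m P \<alpha> B \<noteq> 0" for \<alpha> B
  proof -
    have 0: "\<alpha> m = 0" and nz: "P \<alpha> B \<noteq> 0" using that by (auto simp: restr_def split: if_splits)
    note D = hpolyD[OF P, OF nz]
    have "i \<in> {1..m-1}" if "\<alpha> i \<noteq> 0" for i
    proof -
      have "i \<noteq> m" using that 0 by auto
      then show ?thesis using D(1)[OF that] by auto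
    qed
    moreover have "(\<Sum>i\<in>{1..m-1}. \<alpha> i) = k" using D(3) sum_split_last[OF m, of \<alpha>] 0 by simp
    ultimately show ?thesis using D(2,4) by blast
  qed
  have sub: "B \<subseteq> {1..m-1}" if "B \<subseteq> {1..m}" "m \<notin> B" for B
  proof
    fix i assume "i \<in> B"
    then have "i \<in> {1..m}" "i \<noteq> m" using that by auto
    then show "i \<in> {1..m-1}" by auto
  qed
  have mn: "m \<notin> {1..m-1}" using m by auto
  have u: "u \<in> hpoly (m-1) k s"
    unfolding hpoly_iff
  proof (intro allI impI)
    fix \<alpha> B assume "u \<alpha> B \<noteq> 0"
    then have "m \<notin> B" "restr m P \<alpha> B \<noteq> 0" by (auto simp: u_def split: if_splits)
    then show "(\<forall>i. \<alpha> i \<noteq> 0 \<longrightarrow> i \<in> {1..m-1}) \<and> B \<subseteq> {1..m-1} \<and> (\<Sum>i\<in>{1..m-1}. \<alpha> i) = k \<and> int (card B) = s"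
      using r[of \<alpha> B] sub[of B] by blast
  qed
  have v: "v \<in> hpoly (m-1) k (s - 1)"
    unfolding hpoly_iff
  proof (intro allI impI)
    fix \<alpha> B assume "v \<alpha> B \<noteq> 0"
    then have B: "B \<subseteq> {1..m-1}" and nz: "restr m P \<alpha> (insert m B) \<noteq> 0"
      by (auto simp: v_def split: if_splits)
    have "finite B" "m \<notin> B" using B mn by (auto intro: finite_subset)
    then have "card (insert m B) = Suc (card B)" by simp
    moreover have "int (card (insert m B)) = s" using r[OF nz] by blast
    ultimately have "int (card B) = s - 1" by simp
    then show "(\<forall>i. \<alpha> i \<noteq> 0 \<longrightarrow> i \<in> {1..m-1}) \<and> B \<subseteq> {1..m-1} \<and> (\<Sum>i\<in>{1..m-1}. \<alpha> i) = k \<and> int (card B) = s - 1"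
      using r[OF nz] B by blast
  qed
  have "restr m P = u + prmul m v (ebasis m)"
  proof (rule ext)+
    fix \<alpha> C
    have c: "prmul m v (ebasis m) \<alpha> C = (if m \<in> C \<and> C \<subseteq> {1..m} then v \<alpha> (C - {m}) else 0)"
      by (simp only: prmul_apply cmul_ebasis_last[OF m clf_on_hpoly[OF v]])
    show "restr m P \<alpha> C = (u + prmul m v (ebasis m)) \<alpha> C"
    proof (cases "m \<in> C")
      case True
      show ?thesis
      proof (cases "C \<subseteq> {1..m}")
        case C: True
        have "C - {m} \<subseteq> {1..m-1}" by (rule sub) (use C in auto)
        then have "v \<alpha> (C - {m}) = restr m P \<alpha> C"
          unfolding v_def using True by (simp add: insert_absorb)
        then show ?thesis using c C True by (simp add: u_def)
      next
        case False
        then show ?thesis using c r[of \<alpha> C] True by (auto simp: u_def)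
      qed
    next
      case False
      then show ?thesis using c by (simp add: u_def)
    qed
  qed
  from that[OF u v this] show thesis .
qed

text \<open>The derivative of \<open>P\<close> in the last variable still has grade
  \<open>s\<close>, and at \<open>x_m = 0\<close> it equals \<open>ckop m (restr m P)\<close>. There
  \<open>dminus m v\<close> contributes in grade \<open>s - 2\<close> and \<open>dplus m u\<close>
  times \<open>e_m\<close> in grade \<open>s + 2\<close>, whereas the other two terms have grade
  \<open>s\<close>. Hence these two must vanish.\<close>

lemma restr_in_Ispace:
  fixes P :: "'a::field_char_0 cpoly"
  assumes m: "m \<ge> 1" and P: "P \<in> Hspace m k s"
  shows "restr m P \<in> Ispace m k s"
proof -
  have hP: "P \<in> hpoly m k s" using P by (simp add: Hspace_def)
  obtain u v where hu: "u \<in> hpoly (m-1) k s" and hv: "v \<in> hpoly (m-1) k (s - 1)"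
    and eq: "restr m P = u + prmul m v (ebasis m)"
    using hpoly_decompose[OF m hP] by metis
  have mn: "m \<notin> {1..m-1}" using m by auto
  have grade: "int (card C) = s" if "ckop m (restr m P) \<alpha> C \<noteq> 0" for \<alpha> C
  proof -
    have "pd m P \<alpha> C \<noteq> 0"
      using that unfolding ckop_restr Hspace_eq_CK(1)[OF m P, symmetric]
      by (auto simp: restr_def split: if_splits)
    then have "P (\<alpha>(m := Suc (\<alpha> m))) C \<noteq> 0" by (auto simp: pd_def)
    then show ?thesis by (rule hpolyD(4)[OF hP])
  qed
  have val: "ckop m (restr m P) \<alpha> C =
      (if m \<in> C \<and> C \<subseteq> {1..m} then ginv (dirac_u m u \<alpha>) (C - {m}) else 0) - ginv (dirac_u m v \<alpha>) C" for \<alpha> C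
    unfolding eq ckop_split[OF m hu hv]
    using cmul_ebasis_last[OF m clf_on_ginv[OF clf_on_dirac_u_hpoly[OF hu]]] by simp
  \<comment> \<open>A nonzero coefficient here would survive in \<open>ckop m (restr m P)\<close>:
    \<open>dplus m v\<close> has another grade, and the \<open>u\<close> part meets only blades
    containing \<open>m\<close>.\<close>
  have "dminus m v \<alpha> C = 0" for \<alpha> C
  proof (rule ccontr)
    assume nz: "dminus m v \<alpha> C \<noteq> 0"
    note D = dminus_hpoly[OF hv nz]
    have "dplus m v \<alpha> C = 0" using dplus_hpoly(4)[OF hv, of \<alpha> C] D(4) by force
    then have "ginv (dirac_u m v \<alpha>) C \<noteq> 0" using nz by (simp add: dirac_u_eq ginv_def)
    moreover have "m \<notin> C" using D(2) mn by blast
    ultimately have "ckop m (restr m P) \<alpha> C \<noteq> 0" unfolding val by simp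
    from grade[OF this] D(4) show False by simp
  qed
  then have "dminus m v = 0" by (simp add: fun_eq_iff)
  \<comment> \<open>The blade to look at is \<open>insert m C\<close>, where the \<open>v\<close>
    part has no coefficient.\<close>
  have "dplus m u \<alpha> C = 0" for \<alpha> C
  proof (rule ccontr)
    assume nz: "dplus m u \<alpha> C \<noteq> 0"
    note D = dplus_hpoly[OF hu nz]
    have mC: "m \<notin> C" using D(2) mn by blast
    have finC: "finite C" using D(2) by (rule finite_subset) simp
    have "dminus m u \<alpha> C = 0" using dminus_hpoly(4)[OF hu, of \<alpha> C] D(4) by force
    then have "ginv (dirac_u m u \<alpha>) C \<noteq> 0" using nz by (simp add: dirac_u_eq ginv_def)
    moreover have "ginv (dirac_u m v \<alpha>) (insert m C) = 0"
      using clf_on_ginv[OF clf_on_dirac_u_hpoly[OF hv]] mn unfolding clf_on_def by blast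
    moreover have "{1..m-1} \<subseteq> {1..m}" by auto
    with D(2) have "C \<subseteq> {1..m}" by (rule subset_trans)
    then have "insert m C \<subseteq> {1..m}" using m by simp
    moreover have "insert m C - {m} = C" using mC by simp
    ultimately have "ckop m (restr m P) \<alpha> (insert m C) \<noteq> 0" unfolding val by simp
    from grade[OF this] D(4) mC finC show False by simp
  qed
  then have "dplus m u = 0" by (simp add: fun_eq_iff)
  with \<open>dminus m v = 0\<close> hu hv have "u \<in> Ker_plus m k s" "v \<in> Ker_minus m k (s - 1)"
    by (simp_all add: Ker_plus_def Ker_minus_def)
  then show ?thesis unfolding eq Ispace_def by blast
qed

lemma bij_betw_CK:
  assumes "m \<ge> 1"
  shows "bij_betw (CK m) (Ispace m k s :: 'a::field_char_0 cpoly set) (Hspace m k s)"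
proof (rule bij_betw_byWitness[where f' = "restr m"])
  show "\<forall>p\<in>Ispace m k s. restr m (CK m p) = (p :: 'a cpoly)"
    using restr_CK[OF restr_Ispace[OF assms]] by blast
  show "\<forall>P\<in>Hspace m k s. CK m (restr m P) = (P :: 'a cpoly)"
    using Hspace_eq_CK(2)[OF assms] by metis
qed (use CK_in_Hspace[OF assms] restr_in_Ispace[OF assms] in blast)+

subsection \<open>Polynomials as functions\<close>

abbreviation psupp :: "'a::zero cpoly \<Rightarrow> (nat \<Rightarrow> nat) set" where
  "psupp P \<equiv> {\<alpha>. \<exists>B. P \<alpha> B \<noteq> 0}"

definition mon :: "nat \<Rightarrow> (nat \<Rightarrow> real) \<Rightarrow> (nat \<Rightarrow> nat) \<Rightarrow> real" where
  "mon m x \<alpha> = (\<Prod>i\<in>{1..m}. x i ^ \<alpha> i)"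

text \<open>Any finite \<open>S\<close> containing the support may index the sum, so that
  polynomials with different supports can be evaluated over a common set.\<close>

lemma peval_apply:
  fixes P :: "'a::real_field cpoly"
  assumes "finite S" "psupp P \<subseteq> S"
  shows "peval m P x B = (\<Sum>\<alpha>\<in>S. P \<alpha> B * of_real (mon m x \<alpha>))"
  unfolding peval_def mon_def by (rule sum.mono_neutral_left) (use assms in auto)

lemma peval_sum:
  fixes P :: "'a::real_field cpoly"
  assumes "finite S" "psupp P \<subseteq> S"
  shows "peval m P x = (\<Sum>\<alpha>\<in>S. scl (of_real (mon m x \<alpha>)) (P \<alpha>))"
  by (rule ext) (simp add: peval_apply[OF assms] sum_fun_apply scl_def mult.commute)

lemma finite_psupp: "is_cpoly m P \<Longrightarrow> finite (psupp P)"
  by (simp add: is_cpoly_def)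

lemma is_cpolyI:
  assumes "finite S" "\<And>\<alpha> B. P \<alpha> B \<noteq> 0 \<Longrightarrow> \<alpha> \<in> S"
    "\<And>\<alpha> B i. P \<alpha> B \<noteq> 0 \<Longrightarrow> \<alpha> i \<noteq> 0 \<Longrightarrow> i \<in> {1..m}" "\<And>\<alpha> B. P \<alpha> B \<noteq> 0 \<Longrightarrow> B \<subseteq> {1..m}"
  shows "is_cpoly m P"
proof -
  have "psupp P \<subseteq> S" using assms(2) by blast
  then have "finite (psupp P)" using assms(1) by (rule finite_subset)
  then show ?thesis using assms(3,4) unfolding is_cpoly_def by blast
qed

lemma is_cpolyD:
  assumes "is_cpoly m P" "P \<alpha> B \<noteq> 0"
  shows "\<alpha> i \<noteq> 0 \<Longrightarrow> i \<in> {1..m}" "B \<subseteq> {1..m}"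
  using assms unfolding is_cpoly_def by blast+

lemma mon_cong: "(\<And>i. i \<in> {1..m} \<Longrightarrow> x i = y i) \<Longrightarrow> mon m x \<alpha> = mon m y \<alpha>"
  unfolding mon_def by (rule prod.cong) simp_all

lemma peval_cong: "(\<And>i. i \<in> {1..m} \<Longrightarrow> x i = y i) \<Longrightarrow> peval m P x = peval m P y"
  using mon_cong[of m x y] unfolding peval_def mon_def by simp

lemma is_cpoly_zero: "is_cpoly m 0"
  by (simp add: is_cpoly_def)

lemma is_cpoly_add:
  fixes P Q :: "'a::comm_ring_1 cpoly"
  assumes "is_cpoly m P" "is_cpoly m Q"
  shows "is_cpoly m (P + Q)"
proof (rule is_cpolyI[where S = "psupp P \<union> psupp Q"])
  have nz: "P \<alpha> B \<noteq> 0 \<or> Q \<alpha> B \<noteq> 0" if "(P + Q) \<alpha> B \<noteq> 0" for \<alpha> B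
    using that by auto
  show "finite (psupp P \<union> psupp Q)" using assms by (simp add: is_cpoly_def)
  show "\<alpha> \<in> psupp P \<union> psupp Q" if "(P + Q) \<alpha> B \<noteq> 0" for \<alpha> B
    using nz[OF that] by blast
  show "i \<in> {1..m}" if "(P + Q) \<alpha> B \<noteq> 0" "\<alpha> i \<noteq> 0" for \<alpha> B i
    using nz[OF that(1)] that(2) assms unfolding is_cpoly_def by blast
  show "B \<subseteq> {1..m}" if "(P + Q) \<alpha> B \<noteq> 0" for \<alpha> B
    using nz[OF that] assms unfolding is_cpoly_def by blast
qed

lemma peval_add:
  fixes P Q :: "'a::real_field cpoly"
  assumes "is_cpoly m P" "is_cpoly m Q"
  shows "peval m (P + Q) x = peval m P x + peval m Q x"
proof -
  let ?S = "psupp P \<union> psupp Q"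
  have fin: "finite ?S" using assms by (simp add: is_cpoly_def)
  have "psupp (P + Q) \<subseteq> ?S" by auto
  then show ?thesis
    by (simp only: peval_sum[OF fin] Un_upper1 Un_upper2 plus_fun_apply scl_add sum.distrib)
qed

lemma is_cpoly_map:
  fixes P :: "'a::comm_ring_1 cpoly"
  assumes "is_cpoly m P" "L 0 = 0" "\<And>w. clf_on m (L w)"
  shows "is_cpoly m (\<lambda>\<alpha>. L (P \<alpha>))"
proof (rule is_cpolyI[where S = "psupp P"])
  show "finite (psupp P)" using assms(1) by (rule finite_psupp)
  have nz: "\<exists>B. P \<alpha> B \<noteq> 0" if "L (P \<alpha>) B \<noteq> 0" for \<alpha> B
  proof (rule ccontr)
    assume "\<not> (\<exists>B. P \<alpha> B \<noteq> 0)"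
    then have "P \<alpha> = 0" by (simp add: fun_eq_iff)
    then show False using that assms(2) by simp
  qed
  show "\<alpha> \<in> psupp P" if "L (P \<alpha>) B \<noteq> 0" for \<alpha> B using nz[OF that] by blast
  show "i \<in> {1..m}" if "L (P \<alpha>) B \<noteq> 0" "\<alpha> i \<noteq> 0" for \<alpha> B i
    using nz[OF that(1)] that(2) assms(1) unfolding is_cpoly_def by blast
  show "B \<subseteq> {1..m}" if "L (P \<alpha>) B \<noteq> 0" for \<alpha> B
    using that assms(3) unfolding clf_on_def by blast
qed

lemma is_cpoly_plmul: "is_cpoly m P \<Longrightarrow> is_cpoly m (plmul m c P)"
  unfolding plmul_def by (rule is_cpoly_map[where L = "cmul m c"]) simp_all

lemma is_cpoly_prmul: "is_cpoly m P \<Longrightarrow> is_cpoly m (prmul m P c)"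
  unfolding prmul_def by (rule is_cpoly_map[where L = "\<lambda>w. cmul m w c"]) simp_all

lemma is_cpoly_psmul:
  assumes "is_cpoly m P" shows "is_cpoly m (psmul (c::'a::comm_ring_1) P)"
proof (rule is_cpolyI[where S = "psupp P"])
  have nz: "P \<alpha> B \<noteq> 0" if "psmul c P \<alpha> B \<noteq> 0" for \<alpha> B
    using that by (auto simp: psmul_def)
  show "finite (psupp P)" using assms by (rule finite_psupp)
  show "\<alpha> \<in> psupp P" if "psmul c P \<alpha> B \<noteq> 0" for \<alpha> B
    using nz[OF that] by blast
  show "i \<in> {1..m}" if "psmul c P \<alpha> B \<noteq> 0" "\<alpha> i \<noteq> 0" for \<alpha> B i
    using nz[OF that(1)] that(2) assms unfolding is_cpoly_def by blast
  show "B \<subseteq> {1..m}" if "psmul c P \<alpha> B \<noteq> 0" for \<alpha> B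
    using nz[OF that] assms unfolding is_cpoly_def by blast
qed

lemma psupp_map:
  fixes P :: "'a::comm_ring_1 cpoly"
  assumes "L 0 = (0::'a clf)"
  shows "psupp (\<lambda>\<alpha>. L (P \<alpha>)) \<subseteq> psupp P"
proof
  fix \<alpha> assume "\<alpha> \<in> psupp (\<lambda>\<alpha>. L (P \<alpha>))"
  then have "L (P \<alpha>) \<noteq> 0" by auto
  then have "P \<alpha> \<noteq> 0" using assms by metis
  then show "\<alpha> \<in> psupp P" by (auto simp: fun_eq_iff)
qed

lemma peval_plmul:
  fixes P :: "'a::real_field cpoly"
  assumes "is_cpoly m P"
  shows "peval m (plmul m c P) x = cmul m c (peval m P x)"
proof -
  have "psupp (plmul m c P) \<subseteq> psupp P" unfolding plmul_def by (rule psupp_map[where L = "cmul m c"]) simp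
  then show ?thesis
    by (simp only: peval_sum[OF finite_psupp[OF assms]] order_refl plmul_apply cmul_sum_right
        cmul_scl_right)
qed

lemma peval_prmul:
  fixes P :: "'a::real_field cpoly"
  assumes "is_cpoly m P"
  shows "peval m (prmul m P c) x = cmul m (peval m P x) c"
proof -
  have "psupp (prmul m P c) \<subseteq> psupp P" unfolding prmul_def by (rule psupp_map[where L = "\<lambda>w. cmul m w c"]) simp
  then show ?thesis
    by (simp only: peval_sum[OF finite_psupp[OF assms]] order_refl prmul_apply cmul_sum_left
        cmul_scl_left)
qed

lemma peval_psmul:
  fixes P :: "'a::real_field cpoly"
  assumes "is_cpoly m P"
  shows "peval m (psmul c P) x = scl c (peval m P x)"
proof -
  have "psupp (psmul c P) \<subseteq> psupp P" by (auto simp: psmul_def)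
  then show ?thesis
    by (simp only: peval_sum[OF finite_psupp[OF assms]] order_refl psmul_apply scl_sum
        scl_scl mult.commute)
qed

section \<open>Derivatives along lines, and injectivity of evaluation\<close>

lemma is_cpoly_pd:
  fixes P :: "'a::comm_ring_1 cpoly"
  assumes "is_cpoly m P"
  shows "is_cpoly m (pd i P)"
proof (rule is_cpolyI[where S = "(\<lambda>\<alpha>. \<alpha>(i := \<alpha> i - 1)) ` psupp P"])
  show "finite ((\<lambda>\<alpha>. \<alpha>(i := \<alpha> i - 1)) ` psupp P)"
    using finite_psupp[OF assms] by simp
  have nz: "P (\<alpha>(i := Suc (\<alpha> i))) B \<noteq> 0" if "pd i P \<alpha> B \<noteq> 0" for \<alpha> B
    using that by (auto simp: pd_def)
  show "\<alpha> \<in> (\<lambda>\<alpha>. \<alpha>(i := \<alpha> i - 1)) ` psupp P" if "pd i P \<alpha> B \<noteq> 0" for \<alpha> B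
    by (rule image_eqI[of _ _ "\<alpha>(i := Suc (\<alpha> i))"]) (use nz[OF that] in auto)
  show "j \<in> {1..m}" if "pd i P \<alpha> B \<noteq> 0" "\<alpha> j \<noteq> 0" for \<alpha> B j
    using is_cpolyD(1)[OF assms, OF nz[OF that(1)], of j] that(2) by (cases "i = j") simp_all
  show "B \<subseteq> {1..m}" if "pd i P \<alpha> B \<noteq> 0" for \<alpha> B
    by (rule is_cpolyD(2)[OF assms, OF nz[OF that]])
qed

text \<open>Lowering the \<open>i\<close>-th exponent is injective where that exponent is nonzero.
  The other summands vanish through the factor \<open>of_nat (\<alpha> i)\<close>, so the truncated
  \<open>\<alpha> i - 1\<close> does no harm.\<close>

lemma peval_pd:
  fixes P :: "'a::real_field cpoly"
  assumes "is_cpoly m P"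
  shows "peval m (pd i P) y B =
    (\<Sum>\<alpha>\<in>psupp P. of_nat (\<alpha> i) * P \<alpha> B * of_real (mon m y (\<alpha>(i := \<alpha> i - 1))))"
proof -
  let ?f = "\<lambda>\<alpha>. of_nat (\<alpha> i) * P \<alpha> B * of_real (mon m y (\<alpha>(i := \<alpha> i - 1)))"
  let ?S = "{\<alpha>\<in>psupp P. \<alpha> i \<noteq> 0}"
  have fin: "finite (psupp P)" using assms by (rule finite_psupp)
  have "(\<Sum>\<alpha>\<in>psupp P. ?f \<alpha>) = (\<Sum>\<alpha>\<in>?S. ?f \<alpha>)"
    by (rule sum.mono_neutral_right) (use fin in auto)
  also have "\<dots> = (\<Sum>\<beta>\<in>(\<lambda>\<alpha>. \<alpha>(i := \<alpha> i - 1)) ` ?S. pd i P \<beta> B * of_real (mon m y \<beta>))"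
  proof (rule sum.reindex_cong[symmetric, OF _ refl])
    show "inj_on (\<lambda>\<alpha>. \<alpha>(i := \<alpha> i - 1)) ?S"
    proof (rule inj_onI)
      fix \<alpha> \<beta> assume a: "\<alpha> \<in> ?S" "\<beta> \<in> ?S" and eq: "\<alpha>(i := \<alpha> i - 1) = \<beta>(i := \<beta> i - 1)"
      show "\<alpha> = \<beta>"
      proof
        fix j
        have "\<alpha> i > 0" "\<beta> i > 0" using a by simp_all
        then show "\<alpha> j = \<beta> j"
          using fun_cong[OF eq, of j] by (cases "j = i") auto
      qed
    qed
    show "pd i P (\<alpha>(i := \<alpha> i - 1)) B * of_real (mon m y (\<alpha>(i := \<alpha> i - 1))) = ?f \<alpha>" if "\<alpha> \<in> ?S" for \<alpha>
    proof -
      have "Suc (\<alpha> i - 1) = \<alpha> i" using that by simp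
      then show ?thesis by (simp add: pd_def del: of_nat_Suc)
    qed
  qed
  also have "\<dots> = peval m (pd i P) y B"
  proof (rule peval_apply[symmetric])
    show "finite ((\<lambda>\<alpha>. \<alpha>(i := \<alpha> i - 1)) ` ?S)" using fin by simp
    show "psupp (pd i P) \<subseteq> (\<lambda>\<alpha>. \<alpha>(i := \<alpha> i - 1)) ` ?S"
    proof
      fix \<beta> assume "\<beta> \<in> psupp (pd i P)"
      then obtain B where "P (\<beta>(i := Suc (\<beta> i))) B \<noteq> 0" by (auto simp: pd_def)
      then show "\<beta> \<in> (\<lambda>\<alpha>. \<alpha>(i := \<alpha> i - 1)) ` ?S"
        by (intro image_eqI[of _ _ "\<beta>(i := Suc (\<beta> i))"]) auto
    qed
  qed
  finally show ?thesis ..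
qed

text \<open>Along the line \<open>y + t w\<close> a monomial becomes a product of powers of linear
  polynomials in \<open>t\<close>, and the product rule at \<open>t = 0\<close> yields its
  directional derivative. The coefficients are taken in \<open>'a\<close> so that the result can be
  multiplied by coefficients of \<open>P\<close>.\<close>

lemma mon_line:
  fixes y w :: "nat \<Rightarrow> real" and m :: nat and \<alpha> :: "nat \<Rightarrow> nat"
  defines "q \<equiv> (\<Prod>i\<in>{1..m}. [:of_real (y i), of_real (w i):] ^ \<alpha> i :: 'a::real_field poly)"
  shows "poly q (of_real t) = of_real (mon m (\<lambda>i. y i + t * w i) \<alpha>)"
    and "poly (pderiv q) 0 =
      (\<Sum>i\<in>{1..m}. of_nat (\<alpha> i) * of_real (w i) * of_real (mon m y (\<alpha>(i := \<alpha> i - 1))))"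
proof -
  show "poly q (of_real t) = of_real (mon m (\<lambda>i. y i + t * w i) \<alpha>)"
    by (simp add: q_def mon_def poly_prod poly_power)
  have "mon m y (\<alpha>(i := \<alpha> i - 1)) = y i ^ (\<alpha> i - 1) * (\<Prod>k\<in>{1..m} - {i}. y k ^ \<alpha> k)"
    if "i \<in> {1..m}" for i
  proof -
    have "mon m y (\<alpha>(i := \<alpha> i - 1)) =
      y i ^ (\<alpha>(i := \<alpha> i - 1)) i * (\<Prod>k\<in>{1..m} - {i}. y k ^ (\<alpha>(i := \<alpha> i - 1)) k)"
      unfolding mon_def by (rule prod.remove) (use that in auto)
    also have "(\<Prod>k\<in>{1..m} - {i}. y k ^ (\<alpha>(i := \<alpha> i - 1)) k) = (\<Prod>k\<in>{1..m} - {i}. y k ^ \<alpha> k)"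
      by (rule prod.cong) auto
    finally show ?thesis by (simp only: fun_upd_same)
  qed
  then show "poly (pderiv q) 0 =
      (\<Sum>i\<in>{1..m}. of_nat (\<alpha> i) * of_real (w i) * of_real (mon m y (\<alpha>(i := \<alpha> i - 1))))"
    unfolding q_def pderiv_prod poly_sum
    by (intro sum.cong refl) (simp add: pderiv_power poly_prod poly_power pderiv_pCons mult_ac)
qed

text \<open>The witness is the \<open>B\<close>-component restricted to the line through
  \<open>y\<close> in direction \<open>w\<close>. Its formal derivative at 0 stands in for the
  analytic directional derivative.\<close>

lemma peval_line:
  fixes P :: "'a::real_field cpoly"
  assumes "is_cpoly m P"
  shows "\<exists>p. (\<forall>t. peval m P (\<lambda>i. y i + t * w i) B = poly p (of_real t)) \<and>
    poly (pderiv p) 0 = (\<Sum>i\<in>{1..m}. of_real (w i) * peval m (pd i P) y B)"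
proof -
  define q where "q \<alpha> = (\<Prod>i\<in>{1..m}. [:of_real (y i), of_real (w i):] ^ \<alpha> i :: 'a poly)" for \<alpha>
  define p where "p = (\<Sum>\<alpha>\<in>psupp P. smult (P \<alpha> B) (q \<alpha>))"
  have "peval m P (\<lambda>i. y i + t * w i) B = poly p (of_real t)" for t
    unfolding p_def poly_sum poly_smult q_def mon_line(1)
    by (rule peval_apply[OF finite_psupp[OF assms] order_refl])
  moreover have "poly (pderiv p) 0 = (\<Sum>i\<in>{1..m}. of_real (w i) * peval m (pd i P) y B)"
  proof -
    have "pderiv p = (\<Sum>\<alpha>\<in>psupp P. smult (P \<alpha> B) (pderiv (q \<alpha>)))"
      unfolding p_def using higher_pderiv_sum[of 1 "\<lambda>\<alpha>. smult (P \<alpha> B) (q \<alpha>)" "psupp P"]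
      by (simp add: pderiv_smult)
    then have "poly (pderiv p) 0 = (\<Sum>\<alpha>\<in>psupp P. \<Sum>i\<in>{1..m}. P \<alpha> B *
        (of_nat (\<alpha> i) * of_real (w i) * of_real (mon m y (\<alpha>(i := \<alpha> i - 1)))))"
      by (simp only: poly_sum poly_smult q_def mon_line(2) sum_distrib_left)
    also have "\<dots> = (\<Sum>i\<in>{1..m}. \<Sum>\<alpha>\<in>psupp P. P \<alpha> B *
        (of_nat (\<alpha> i) * of_real (w i) * of_real (mon m y (\<alpha>(i := \<alpha> i - 1)))))"
      by (rule sum.swap)
    also have "\<dots> = (\<Sum>i\<in>{1..m}. of_real (w i) * peval m (pd i P) y B)"
      unfolding peval_pd[OF assms] sum_distrib_left by (intro sum.cong refl) (simp only: mult_ac)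
    finally show ?thesis .
  qed
  ultimately show ?thesis by blast
qed

text \<open>The reals embed as an infinite subset of \<open>'a\<close>, and a nonzero polynomial has
  only finitely many roots.\<close>

lemma poly_eq_on_reals:
  fixes p q :: "'a::real_field poly"
  assumes "\<And>t. poly p (of_real t) = poly q (of_real t)"
  shows "p = q"
proof (rule ccontr)
  assume "p \<noteq> q"
  then have "finite {x. poly (p - q) x = 0}" by (intro poly_roots_finite) simp
  moreover have "range of_real \<subseteq> {x. poly (p - q) x = 0}" using assms by auto
  ultimately have "finite (range (of_real :: real \<Rightarrow> 'a))" using finite_subset by blast
  from finite_imageD[OF this inj_of_real] show False
    using infinite_UNIV_char_0[where 'a = real] by blast
qed

text \<open>This is the chain rule. The substitution maps a line in the \<open>j\<close>-th
  coordinate direction to a line whose direction is the \<open>j\<close>-th column of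
  \<open>t\<close>. The two univariate restrictions agree at all reals, hence as polynomials, and so
  do their derivatives at 0.\<close>

lemma peval_linear_subst_pd:
  fixes P Q :: "'a::real_field cpoly"
  assumes P: "is_cpoly m P" and Q: "is_cpoly m Q"
    and eq: "\<And>x. peval m Q x B = peval m P (\<lambda>i. \<Sum>j\<in>{1..m}. t i j * x j) B"
    and j: "j \<in> {1..m}"
  shows "peval m (pd j Q) x B =
    (\<Sum>i\<in>{1..m}. of_real (t i j) * peval m (pd i P) (\<lambda>i. \<Sum>j\<in>{1..m}. t i j * x j) B)"
proof -
  let ?w = "\<lambda>k. if k = j then 1 else (0::real)"
  obtain q where q: "\<forall>r. peval m Q (\<lambda>i. x i + r * ?w i) B = poly q (of_real r)"
    "poly (pderiv q) 0 = (\<Sum>i\<in>{1..m}. of_real (?w i) * peval m (pd i Q) x B)"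
    using peval_line[OF Q, where y = x and w = ?w and B = B] by blast
  obtain p where p: "\<forall>r. peval m P (\<lambda>i. (\<Sum>j\<in>{1..m}. t i j * x j) + r * t i j) B = poly p (of_real r)"
    "poly (pderiv p) 0 = (\<Sum>i\<in>{1..m}. of_real (t i j) * peval m (pd i P) (\<lambda>i. \<Sum>j\<in>{1..m}. t i j * x j) B)"
    using peval_line[OF P, where y = "\<lambda>i. \<Sum>j\<in>{1..m}. t i j * x j" and w = "\<lambda>i. t i j" and B = B] by blast
  have "(\<Sum>k\<in>{1..m}. t i k * (x k + r * ?w k)) = (\<Sum>k\<in>{1..m}. t i k * x k) + r * t i j" for i r
  proof -
    have "(\<Sum>k\<in>{1..m}. t i k * (x k + r * ?w k)) =
        (\<Sum>k\<in>{1..m}. t i k * x k + (if k = j then r * t i j else 0))"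
      by (rule sum.cong) (auto simp: algebra_simps)
    then show ?thesis using j by (simp add: sum.distrib)
  qed
  then have "poly q (of_real r) = poly p (of_real r)" for r
    unfolding q(1)[rule_format, symmetric] p(1)[rule_format, symmetric] eq by simp
  then have "q = p" by (rule poly_eq_on_reals)
  moreover have "(\<Sum>i\<in>{1..m}. of_real (?w i) * peval m (pd i Q) x B) =
      (\<Sum>i\<in>{1..m}. if i = j then peval m (pd j Q) x B else 0)"
    by (rule sum.cong) auto
  then have "(\<Sum>i\<in>{1..m}. of_real (?w i) * peval m (pd i Q) x B) = peval m (pd j Q) x B"
    using j by simp
  ultimately show ?thesis using p(2) q(2) by simp
qed

lemma mon_zero:
  assumes "\<And>i. i \<notin> {1..m} \<Longrightarrow> \<alpha> i = 0"
  shows "mon m (\<lambda>_. 0) \<alpha> = (if \<alpha> = (\<lambda>_. 0) then 1 else 0)"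
proof (cases "\<alpha> = (\<lambda>_. 0)")
  case False
  then obtain i where "\<alpha> i \<noteq> 0" by auto
  then show ?thesis using False assms[of i] by (force simp: mon_def)
qed (simp add: mon_def)

lemma peval_at_zero:
  fixes P :: "'a::real_field cpoly"
  assumes P: "is_cpoly m P"
  shows "peval m P (\<lambda>_. 0) B = P (\<lambda>_. 0) B"
proof -
  have "mon m (\<lambda>_. 0) \<alpha> = (if \<alpha> = (\<lambda>_. 0) then 1 else 0)" if "\<alpha> \<in> psupp P" for \<alpha>
    by (rule mon_zero) (use that P in \<open>auto simp: is_cpoly_def\<close>)
  then have "peval m P (\<lambda>_. 0) B = (\<Sum>\<alpha>\<in>psupp P. if \<alpha> = (\<lambda>_. 0) then P (\<lambda>_. 0) B else 0)"
    unfolding peval_apply[OF finite_psupp[OF P] order_refl] by (intro sum.cong) auto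
  also have "\<dots> = P (\<lambda>_. 0) B" using finite_psupp[OF P] by auto
  finally show ?thesis .
qed

text \<open>Induction on the degree of \<alpha>: the derivatives of a function that is identically
  zero are zero, and the coefficient at exponent zero is the value at the origin. \<open>P\<close>
  varies because the step passes to \<open>pd i P\<close>.\<close>

lemma peval_eq_0D:
  fixes P :: "'a::real_field cpoly"
  assumes "is_cpoly m P" "\<And>x. peval m P x B = 0"
  shows "P \<alpha> B = 0"
  using assms
proof (induction "\<Sum>i\<in>{1..m}. \<alpha> i" arbitrary: \<alpha> P)
  case 0
  show ?case
  proof (cases "\<alpha> = (\<lambda>_. 0)")
    case True
    then show ?thesis using 0(3)[of "\<lambda>_. 0"] peval_at_zero[OF 0(2)] by simp
  next
    case False
    \<comment> \<open>All exponents in \<open>{1..m}\<close> are zero, so a nonzero one lies outside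
      this range, which \<open>is_cpoly\<close> excludes.\<close>
    then obtain i where i: "\<alpha> i \<noteq> 0" by auto
    then have "i \<notin> {1..m}" using 0(1) by auto
    then show ?thesis using is_cpolyD(1)[OF 0(2), of \<alpha> B i] i by blast
  qed
next
  case (Suc n)
  obtain i where i: "i \<in> {1..m}" "\<alpha> i \<noteq> 0"
    using Suc(2) by (metis nat.distinct(1) sum.neutral)
  define \<beta> where "\<beta> = \<alpha>(i := \<alpha> i - 1)"
  have \<alpha>: "\<alpha> = \<beta>(i := Suc (\<beta> i))" using i(2) by (auto simp: \<beta>_def)
  have "n = (\<Sum>i\<in>{1..m}. \<beta> i)"
    using Suc(2) sum_fun_upd_Suc[OF finite_atLeastAtMost i(1), of \<beta>] unfolding \<alpha>[symmetric] by simp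
  moreover have "peval m (pd i P) x B = 0" for x
  proof -
    let ?w = "\<lambda>k. if k = i then 1 else (0::real)"
    obtain p where p: "\<forall>r. peval m P (\<lambda>i. x i + r * ?w i) B = poly p (of_real r)"
      "poly (pderiv p) 0 = (\<Sum>k\<in>{1..m}. of_real (?w k) * peval m (pd k P) x B)"
      using peval_line[OF Suc(3), where y = x and w = ?w and B = B] by blast
    have "p = 0" by (rule poly_eq_on_reals) (simp add: p(1)[rule_format, symmetric] Suc(4))
    then have "0 = (\<Sum>k\<in>{1..m}. of_real (?w k) * peval m (pd k P) x B)" using p(2) by simp
    also have "\<dots> = (\<Sum>k\<in>{1..m}. if k = i then peval m (pd i P) x B else 0)"
      by (rule sum.cong) auto
    also have "\<dots> = peval m (pd i P) x B" using i(1) by simp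
    finally show ?thesis ..
  qed
  ultimately have "pd i P \<beta> B = 0"
    using Suc(1)[of \<beta> "pd i P"] is_cpoly_pd[OF Suc(3)] by blast
  then have "of_nat (Suc (\<beta> i)) * P \<alpha> B = 0" unfolding \<alpha> pd_def by simp
  then show ?case by (simp del: of_nat_Suc)
qed

text \<open>Applies \<open>peval_eq_0D\<close> to the difference; this is the uniqueness behind the
  definite description in \<open>Hpoly\<close>.\<close>

lemma peval_inject:
  fixes P Q :: "'a::real_field cpoly"
  assumes "is_cpoly m P" "is_cpoly m Q" "\<And>x. peval m P x = peval m Q x"
  shows "P = Q"
proof (rule ext)+
  fix \<alpha> B
  have c: "is_cpoly m (psmul (- 1) Q)" using assms(2) by (rule is_cpoly_psmul)
  have "(P + psmul (- 1) Q) \<alpha> B = 0"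
  proof (rule peval_eq_0D[where P = "P + psmul (- 1) Q"])
    show "is_cpoly m (P + psmul (- 1) Q)" using assms(1) c by (rule is_cpoly_add)
    show "peval m (P + psmul (- 1) Q) x B = 0" for x
      by (simp add: peval_add[OF assms(1) c] peval_psmul[OF assms(2)] assms(3) scl_def)
  qed
  then show "P \<alpha> B = Q \<alpha> B" by (simp add: psmul_def)
qed

section \<open>Linear substitutions yield polynomials\<close>

definition polyfun :: "nat \<Rightarrow> ((nat \<Rightarrow> real) \<Rightarrow> 'a::real_field clf) \<Rightarrow> bool" where
  "polyfun m F \<longleftrightarrow> (\<exists>Q. is_cpoly m Q \<and> peval m Q = F)"

lemma polyfun_add:
  assumes "polyfun m F" "polyfun m G" shows "polyfun m (\<lambda>x. F x + G x)"
proof -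
  obtain P Q where PQ: "is_cpoly m P" "peval m P = F" "is_cpoly m Q" "peval m Q = G"
    using assms unfolding polyfun_def by blast
  have "peval m (P + Q) = (\<lambda>x. F x + G x)"
    by (rule ext) (simp only: peval_add[OF PQ(1,3)] PQ(2,4))
  then show ?thesis using is_cpoly_add[OF PQ(1,3)] unfolding polyfun_def by blast
qed

lemma polyfun_zero: "polyfun m (\<lambda>x. 0)"
proof -
  have "peval m 0 = (\<lambda>x. 0 :: 'a clf)"
    by (simp add: peval_def fun_eq_iff)
  then show ?thesis using is_cpoly_zero unfolding polyfun_def by blast
qed

lemma polyfun_sum:
  assumes "\<And>i. i \<in> A \<Longrightarrow> polyfun m (F i)"
  shows "polyfun m (\<lambda>x. \<Sum>i\<in>A. F i x)"
  using assms
proof (induction A rule: infinite_finite_induct)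
  case (insert i A)
  then have "polyfun m (\<lambda>x. F i x + (\<Sum>i\<in>A. F i x))" by (intro polyfun_add) auto
  then show ?case using insert.hyps by (simp only: sum.insert not_False_eq_True)
qed (simp_all only: sum.infinite sum.empty polyfun_zero not_False_eq_True)

lemma polyfun_const:
  assumes "clf_on m c" shows "polyfun m (\<lambda>x. c)"
proof -
  define Q :: "'a cpoly" where "Q = (\<lambda>\<alpha> B. if \<alpha> = (\<lambda>_. 0) then c B else 0)"
  have "psupp Q \<subseteq> {\<lambda>_. 0}" by (auto simp: Q_def)
  then have "peval m Q x B = c B" for x B
    by (subst peval_apply[of "{\<lambda>_. 0}"]) (auto simp: Q_def mon_def)
  then have "peval m Q = (\<lambda>x. c)" by (simp add: fun_eq_iff)
  moreover have "is_cpoly m Q"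
    by (rule is_cpolyI[where S = "{\<lambda>_. 0}"])
      (use assms in \<open>auto simp: Q_def clf_on_def split: if_splits\<close>)
  ultimately show ?thesis unfolding polyfun_def by blast
qed

lemma is_cpoly_mulx:
  assumes "is_cpoly m P" "i \<in> {1..m}" shows "is_cpoly m (mulx i 1 P)"
proof (rule is_cpolyI[where S = "(\<lambda>\<alpha>. \<alpha>(i := Suc (\<alpha> i))) ` psupp P"])
  have nz: "\<alpha> i \<noteq> 0" "P (\<alpha>(i := \<alpha> i - 1)) B \<noteq> 0" if "mulx i 1 P \<alpha> B \<noteq> 0" for \<alpha> B
    using that by (auto simp: mulx_def split: if_splits)
  show "finite ((\<lambda>\<alpha>. \<alpha>(i := Suc (\<alpha> i))) ` psupp P)" using finite_psupp[OF assms(1)] by simp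
  show "\<alpha> \<in> (\<lambda>\<alpha>. \<alpha>(i := Suc (\<alpha> i))) ` psupp P" if "mulx i 1 P \<alpha> B \<noteq> 0" for \<alpha> B
    by (rule image_eqI[of _ _ "\<alpha>(i := \<alpha> i - 1)"]) (use nz[OF that] in auto)
  show "j \<in> {1..m}" if "mulx i 1 P \<alpha> B \<noteq> 0" "\<alpha> j \<noteq> 0" for \<alpha> B j
    using is_cpolyD(1)[OF assms(1), OF nz(2)[OF that(1)], of j] that(2) assms(2)
    by (cases "i = j") simp_all
  show "B \<subseteq> {1..m}" if "mulx i 1 P \<alpha> B \<noteq> 0" for \<alpha> B
    by (rule is_cpolyD(2)[OF assms(1), OF nz(2)[OF that]])
qed

lemma mon_Suc:
  assumes "i \<in> {1..m}"
  shows "mon m x (\<alpha>(i := Suc (\<alpha> i))) = x i * mon m x \<alpha>"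
proof -
  have "(\<Prod>k\<in>{1..m} - {i}. x k ^ (\<alpha>(i := Suc (\<alpha> i))) k) = (\<Prod>k\<in>{1..m} - {i}. x k ^ \<alpha> k)"
    by (rule prod.cong) auto
  then show ?thesis
    unfolding mon_def prod.remove[OF finite_atLeastAtMost assms]
    by (simp only: fun_upd_same power_Suc mult.assoc)
qed

lemma peval_mulx:
  fixes P :: "'a::real_field cpoly"
  assumes "is_cpoly m P" "i \<in> {1..m}"
  shows "peval m (mulx i 1 P) x = scl (of_real (x i)) (peval m P x)"
proof
  fix B
  let ?g = "\<lambda>\<alpha>. \<alpha>(i := Suc (\<alpha> i))"
  have fin: "finite (psupp P)" using assms(1) by (rule finite_psupp)
  have "inj_on ?g (psupp P)"
  proof (rule inj_onI)
    fix \<alpha> \<beta> assume eq: "?g \<alpha> = ?g \<beta>"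
    show "\<alpha> = \<beta>"
    proof
      fix j show "\<alpha> j = \<beta> j" using fun_cong[OF eq, of j] by (cases "j = i") auto
    qed
  qed
  moreover have "psupp (mulx i 1 P) \<subseteq> ?g ` psupp P"
  proof
    fix \<alpha> assume "\<alpha> \<in> psupp (mulx i 1 P)"
    then obtain B where "\<alpha> i \<noteq> 0" "P (\<alpha>(i := \<alpha> i - 1)) B \<noteq> 0"
      by (auto simp: mulx_def split: if_splits)
    then show "\<alpha> \<in> ?g ` psupp P"
      by (intro image_eqI[of _ _ "\<alpha>(i := \<alpha> i - 1)"]) auto
  qed
  then have "peval m (mulx i 1 P) x B = (\<Sum>\<beta>\<in>?g ` psupp P. mulx i 1 P \<beta> B * of_real (mon m x \<beta>))"
    using fin by (intro peval_apply) simp_all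
  ultimately have "peval m (mulx i 1 P) x B =
      (\<Sum>\<alpha>\<in>psupp P. mulx i 1 P (?g \<alpha>) B * of_real (mon m x (?g \<alpha>)))"
    by (simp only: sum.reindex o_def)
  also have "\<dots> = (\<Sum>\<alpha>\<in>psupp P. of_real (x i) * (P \<alpha> B * of_real (mon m x \<alpha>)))"
    unfolding mon_Suc[OF assms(2)] by (rule sum.cong) (simp_all add: mulx_def)
  also have "\<dots> = scl (of_real (x i)) (peval m P x) B"
    unfolding peval_apply[OF fin order_refl] scl_def sum_distrib_left ..
  finally show "peval m (mulx i 1 P) x B = scl (of_real (x i)) (peval m P x) B" .
qed

text \<open>Multipliers rather than real polynomials: closure under sums and products follows by
  adding and composing the multiplications, so no product of Clifford-valued polynomials has to be
  introduced. The type argument fixes the coefficient field, which does not occur in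
  \<open>h\<close>.\<close>

definition polymult :: "'a::real_field itself \<Rightarrow> nat \<Rightarrow> ((nat \<Rightarrow> real) \<Rightarrow> real) \<Rightarrow> bool" where
  "polymult TYPE('a) m h \<longleftrightarrow>
    (\<forall>F :: (nat \<Rightarrow> real) \<Rightarrow> 'a clf. polyfun m F \<longrightarrow> polyfun m (\<lambda>x. scl (of_real (h x)) (F x)))"

lemma polymult_const: "polymult TYPE('a::real_field) m (\<lambda>x. c)"
  unfolding polymult_def polyfun_def
proof (intro allI impI)
  fix F :: "(nat \<Rightarrow> real) \<Rightarrow> 'a clf"
  assume "\<exists>Q. is_cpoly m Q \<and> peval m Q = F"
  then obtain Q where Q: "is_cpoly m Q" "peval m Q = F" by blast
  have "peval m (psmul (of_real c) Q) = (\<lambda>x. scl (of_real c) (F x))"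
    by (rule ext) (simp only: peval_psmul[OF Q(1)] Q(2))
  then show "\<exists>Q. is_cpoly m Q \<and> peval m Q = (\<lambda>x. scl (of_real c) (F x))"
    using is_cpoly_psmul[OF Q(1)] by blast
qed

lemma polymult_coord:
  assumes "i \<in> {1..m}" shows "polymult TYPE('a::real_field) m (\<lambda>x. x i)"
  unfolding polymult_def polyfun_def
proof (intro allI impI)
  fix F :: "(nat \<Rightarrow> real) \<Rightarrow> 'a clf"
  assume "\<exists>Q. is_cpoly m Q \<and> peval m Q = F"
  then obtain Q where Q: "is_cpoly m Q" "peval m Q = F" by blast
  have "peval m (mulx i 1 Q) = (\<lambda>x. scl (of_real (x i)) (F x))"
    by (rule ext) (simp only: peval_mulx[OF Q(1) assms] Q(2))
  then show "\<exists>Q. is_cpoly m Q \<and> peval m Q = (\<lambda>x. scl (of_real (x i)) (F x))"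
    using is_cpoly_mulx[OF Q(1) assms] by blast
qed

lemma polymult_add:
  assumes "polymult TYPE('a::real_field) m g" "polymult TYPE('a) m h"
  shows "polymult TYPE('a) m (\<lambda>x. g x + h x)"
  unfolding polymult_def
proof (intro allI impI)
  fix F :: "(nat \<Rightarrow> real) \<Rightarrow> 'a clf" assume "polyfun m F"
  then have "polyfun m (\<lambda>x. scl (of_real (g x)) (F x) + scl (of_real (h x)) (F x))"
    using assms unfolding polymult_def by (intro polyfun_add) blast+
  moreover have "scl (of_real (g x)) (F x) + scl (of_real (h x)) (F x) = scl (of_real (g x + h x)) (F x)" for x
    by (simp add: scl_def fun_eq_iff algebra_simps)
  ultimately show "polyfun m (\<lambda>x. scl (of_real (g x + h x)) (F x))" by simp
qed

lemma polymult_mult: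
  assumes "polymult TYPE('a::real_field) m g" "polymult TYPE('a) m h"
  shows "polymult TYPE('a) m (\<lambda>x. g x * h x)"
  unfolding polymult_def
proof (intro allI impI)
  fix F :: "(nat \<Rightarrow> real) \<Rightarrow> 'a clf" assume "polyfun m F"
  then have "polyfun m (\<lambda>x. scl (of_real (h x)) (F x))"
    using assms(2) unfolding polymult_def by blast
  then have "polyfun m (\<lambda>x. scl (of_real (g x)) (scl (of_real (h x)) (F x)))"
    using assms(1) unfolding polymult_def by (elim allE impE)
  then show "polyfun m (\<lambda>x. scl (of_real (g x * h x)) (F x))" by (simp add: scl_scl)
qed

lemma polymult_sum:
  assumes "\<And>i. i \<in> A \<Longrightarrow> polymult TYPE('a::real_field) m (f i)"
  shows "polymult TYPE('a) m (\<lambda>x. \<Sum>i\<in>A. f i x)"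
  using assms
  by (induction A rule: infinite_finite_induct) (simp_all add: polymult_const polymult_add)

lemma polymult_prod:
  assumes "\<And>i. i \<in> A \<Longrightarrow> polymult TYPE('a::real_field) m (f i)"
  shows "polymult TYPE('a) m (\<lambda>x. \<Prod>i\<in>A. f i x)"
  using assms
  by (induction A rule: infinite_finite_induct) (simp_all add: polymult_const polymult_mult)

lemma polymult_power:
  assumes "polymult TYPE('a::real_field) m f"
  shows "polymult TYPE('a) m (\<lambda>x. f x ^ n)"
  by (induction n) (simp_all add: polymult_const polymult_mult assms)

text \<open>Linear forms are multipliers, hence so are monomials in linear forms; applied to the
  constant functions \<open>P \<alpha>\<close> they represent every summand of the substituted
  polynomial.\<close>

lemma linear_subst_exists:
  fixes P :: "'a::real_field cpoly" and t :: "nat \<Rightarrow> nat \<Rightarrow> real"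
  assumes P: "is_cpoly m P"
  shows "\<exists>Q. is_cpoly m Q \<and> (\<forall>x. peval m Q x = peval m P (\<lambda>i. \<Sum>j\<in>{1..m}. t i j * x j))"
proof -
  have "polyfun m (\<lambda>x. \<Sum>\<alpha>\<in>psupp P. scl (of_real (mon m (\<lambda>i. \<Sum>j\<in>{1..m}. t i j * x j) \<alpha>)) (P \<alpha>))"
  proof (rule polyfun_sum)
    fix \<alpha>
    have mult: "polymult TYPE('a) m (\<lambda>x. \<Prod>i\<in>{1..m}. (\<Sum>j\<in>{1..m}. t i j * x j) ^ \<alpha> i)"
      by (intro polymult_prod polymult_power polymult_sum polymult_mult polymult_const polymult_coord)
    have "clf_on m (P \<alpha>)" using P unfolding is_cpoly_def clf_on_def by blast
    from mult[unfolded polymult_def, rule_format, OF polyfun_const[OF this]]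
    show "polyfun m (\<lambda>x. scl (of_real (mon m (\<lambda>i. \<Sum>j\<in>{1..m}. t i j * x j) \<alpha>)) (P \<alpha>))"
      by (simp only: mon_def)
  qed
  then have "polyfun m (\<lambda>x. peval m P (\<lambda>i. \<Sum>j\<in>{1..m}. t i j * x j))"
    by (simp only: peval_sum[OF finite_psupp[OF P] order_refl])
  then obtain Q where "is_cpoly m Q" "peval m Q = (\<lambda>x. peval m P (\<lambda>i. \<Sum>j\<in>{1..m}. t i j * x j))"
    unfolding polyfun_def by blast
  then show ?thesis by (intro exI[of _ Q]) simp
qed

section \<open>Degree and restriction read off from values\<close>

lemma mon_scale: "mon m (\<lambda>i. c * x i) \<alpha> = c ^ (\<Sum>i\<in>{1..m}. \<alpha> i) * mon m x \<alpha>"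
  by (simp add: mon_def power_mult_distrib prod.distrib power_sum)

lemma peval_hpoly_scale:
  fixes P :: "'a::real_field cpoly"
  assumes P: "P \<in> hpoly m k s"
  shows "peval m P (\<lambda>i. c * x i) = scl (of_real c ^ k) (peval m P x)"
proof
  fix B
  have "(\<Sum>i\<in>{1..m}. \<alpha> i) = k" if "\<alpha> \<in> psupp P" for \<alpha>
    using that P unfolding hpoly_iff by blast
  then have "peval m P (\<lambda>i. c * x i) B = (\<Sum>\<alpha>\<in>psupp P. of_real c ^ k * (P \<alpha> B * of_real (mon m x \<alpha>)))"
    unfolding peval_apply[OF finite_psupp[OF is_cpoly_hpoly[OF P]] order_refl] mon_scale
    by (intro sum.cong refl) simp
  then show "peval m P (\<lambda>i. c * x i) B = scl (of_real c ^ k) (peval m P x) B"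
    unfolding peval_apply[OF finite_psupp[OF is_cpoly_hpoly[OF P]] order_refl, of m x]
    by (simp only: scl_def sum_distrib_left)
qed

text \<open>Doubling the argument multiplies the coefficient at \<alpha> by 2 to the degree of
  \<alpha>. By injectivity of evaluation this factor is \<open>2 ^ k\<close> wherever the
  coefficient is nonzero, and in characteristic zero distinct powers of 2 are distinct.\<close>

lemma degree_of_peval_scale:
  fixes Q :: "'a::real_field cpoly"
  assumes Q: "is_cpoly m Q" and sc: "\<And>x. peval m Q (\<lambda>i. 2 * x i) = scl (2 ^ k) (peval m Q x)"
    and nz: "Q \<alpha> B \<noteq> 0"
  shows "(\<Sum>i\<in>{1..m}. \<alpha> i) = k"
proof -
  define Q2 where "Q2 = (\<lambda>\<alpha>. scl (2 ^ (\<Sum>i\<in>{1..m}. \<alpha> i)) (Q \<alpha>))"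
  have supp: "Q \<alpha> B \<noteq> 0" if "Q2 \<alpha> B \<noteq> 0" for \<alpha> B
    using that by (auto simp: Q2_def scl_def)
  have c2: "is_cpoly m Q2"
  proof (rule is_cpolyI[where S = "psupp Q"])
    show "finite (psupp Q)" using Q by (rule finite_psupp)
    show "\<alpha> \<in> psupp Q" if "Q2 \<alpha> B \<noteq> 0" for \<alpha> B using supp[OF that] by blast
    show "i \<in> {1..m}" if "Q2 \<alpha> B \<noteq> 0" "\<alpha> i \<noteq> 0" for \<alpha> B i
      using is_cpolyD(1)[OF Q, OF supp[OF that(1)] that(2)] .
    show "B \<subseteq> {1..m}" if "Q2 \<alpha> B \<noteq> 0" for \<alpha> B
      using is_cpolyD(2)[OF Q, OF supp[OF that]] .
  qed
  have "psupp Q2 \<subseteq> psupp Q" using supp by blast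
  then have e: "peval m Q2 x B = (\<Sum>\<alpha>\<in>psupp Q. Q2 \<alpha> B * of_real (mon m x \<alpha>))" for x B
    by (rule peval_apply[OF finite_psupp[OF Q]])
  have "peval m Q2 x B = peval m Q (\<lambda>i. 2 * x i) B" for x B
    unfolding e peval_apply[OF finite_psupp[OF Q] order_refl] mon_scale
    by (intro sum.cong refl) (simp add: Q2_def scl_def)
  then have "peval m Q2 x = peval m (psmul (2 ^ k) Q) x" for x
    unfolding peval_psmul[OF Q] sc[symmetric] by blast
  then have "Q2 = psmul (2 ^ k) Q"
    by (rule peval_inject[OF c2 is_cpoly_psmul[OF Q]])
  then have "Q2 \<alpha> B = psmul (2 ^ k) Q \<alpha> B" by simp
  then have "(2::'a) ^ (\<Sum>i\<in>{1..m}. \<alpha> i) = 2 ^ k"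
    using nz by (simp add: Q2_def scl_def psmul_def)
  then have "(of_nat (2 ^ (\<Sum>i\<in>{1..m}. \<alpha> i)) :: 'a) = of_nat (2 ^ k)" by simp
  then have "(2::nat) ^ (\<Sum>i\<in>{1..m}. \<alpha> i) = 2 ^ k" by (simp only: of_nat_eq_iff)
  then show ?thesis by simp
qed

lemma is_cpoly_restr:
  assumes "is_cpoly m P" shows "is_cpoly m (restr m P)"
proof (rule is_cpolyI[where S = "psupp P"])
  have nz: "P \<alpha> B \<noteq> 0" if "restr m P \<alpha> B \<noteq> 0" for \<alpha> B
    using that by (auto simp: restr_def split: if_splits)
  show "finite (psupp P)" using assms by (rule finite_psupp)
  show "\<alpha> \<in> psupp P" if "restr m P \<alpha> B \<noteq> 0" for \<alpha> B using nz[OF that] by blast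
  show "i \<in> {1..m}" if "restr m P \<alpha> B \<noteq> 0" "\<alpha> i \<noteq> 0" for \<alpha> B i
    using is_cpolyD(1)[OF assms, OF nz[OF that(1)] that(2)] .
  show "B \<subseteq> {1..m}" if "restr m P \<alpha> B \<noteq> 0" for \<alpha> B
    using is_cpolyD(2)[OF assms, OF nz[OF that]] .
qed

lemma mon_upd_zero:
  assumes "m \<ge> 1" shows "mon m (x(m := 0)) \<alpha> = (if \<alpha> m = 0 then mon m x \<alpha> else 0)"
proof -
  have m: "m \<in> {1..m}" using assms by auto
  have "(\<Prod>k\<in>{1..m} - {m}. (x(m := 0)) k ^ \<alpha> k) = (\<Prod>k\<in>{1..m} - {m}. x k ^ \<alpha> k)"
    by (rule prod.cong) auto
  then show ?thesis
    unfolding mon_def prod.remove[OF finite_atLeastAtMost m] by (simp add: power_0_left)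
qed

lemma peval_restr:
  fixes P :: "'a::real_field cpoly"
  assumes "m \<ge> 1" "is_cpoly m P"
  shows "peval m (restr m P) x = peval m P (x(m := 0))"
proof
  fix B
  have "psupp (restr m P) \<subseteq> psupp P" by (auto simp: restr_def)
  then show "peval m (restr m P) x B = peval m P (x(m := 0)) B"
    unfolding peval_apply[OF finite_psupp[OF assms(2)] order_refl]
      peval_apply[OF finite_psupp[OF assms(2)] \<open>psupp (restr m P) \<subseteq> psupp P\<close>] mon_upd_zero[OF assms(1)]
    by (intro sum.cong refl) (simp add: restr_def)
qed

lemma is_cpoly_sum:
  fixes f :: "'b \<Rightarrow> 'a::comm_ring_1 cpoly"
  assumes "\<And>i. i \<in> A \<Longrightarrow> is_cpoly m (f i)"
  shows "is_cpoly m (\<Sum>i\<in>A. f i)"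
  using assms
  by (induction A rule: infinite_finite_induct)
    (simp_all only: sum.infinite sum.empty sum.insert is_cpoly_zero is_cpoly_add insertI1 insertI2
      not_False_eq_True)

lemma is_cpoly_dirac: "is_cpoly m P \<Longrightarrow> is_cpoly m (dirac m P)"
  unfolding dirac_def by (intro is_cpoly_sum is_cpoly_plmul is_cpoly_pd)

lemma peval_sum_cpoly:
  fixes f :: "'b \<Rightarrow> 'a::real_field cpoly"
  assumes "finite A" "\<And>i. i \<in> A \<Longrightarrow> is_cpoly m (f i)"
  shows "peval m (\<Sum>i\<in>A. f i) x = (\<Sum>i\<in>A. peval m (f i) x)"
  using assms
proof (induction A rule: finite_induct)
  case empty
  show ?case by (simp add: peval_def fun_eq_iff)
next
  case (insert a A)
  have "is_cpoly m (f a)" "is_cpoly m (\<Sum>i\<in>A. f i)"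
    using insert.prems by (auto intro!: is_cpoly_sum)
  moreover have "peval m (\<Sum>i\<in>A. f i) x = (\<Sum>i\<in>A. peval m (f i) x)"
    using insert.IH insert.prems by blast
  ultimately show ?case using insert.hyps
    by (simp only: sum.insert peval_add not_False_eq_True)
qed

lemma peval_dirac:
  fixes P :: "'a::real_field cpoly"
  assumes "is_cpoly m P"
  shows "peval m (dirac m P) x = (\<Sum>j\<in>{1..m}. cmul m (ebasis j) (peval m (pd j P) x))"
  unfolding dirac_def
  by (subst peval_sum_cpoly)
    (simp_all only: finite_atLeastAtMost peval_plmul is_cpoly_plmul is_cpoly_pd assms)

subsection \<open>The Pin group\<close>

text \<open>The coefficient ring is left open so that the same computations apply to real vectors
  and to their images under \<open>cof_real\<close>.\<close>

definition gvec :: "nat \<Rightarrow> (nat \<Rightarrow> 'a::comm_ring_1) \<Rightarrow> 'a clf" where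
  "gvec m a = (\<Sum>i\<in>{1..m}. scl (a i) (ebasis i))"

lemma clf_on_gvec [simp]: "clf_on m (gvec m a)"
  unfolding gvec_def by (intro clf_on_sum clf_on_scl) simp

lemma gvec_apply: "gvec m a B = (\<Sum>i\<in>{1..m}. if B = {i} then a i else 0)"
  by (simp add: gvec_def sum_fun_apply scl_def ebasis_apply if_distrib cong: if_cong)

lemma vec_of_pt_eq: "vec_of_pt m x = gvec m x"
  by (rule ext) (simp add: vec_of_pt_def gvec_apply)

lemma gvec_singleton: "i \<in> {1..m} \<Longrightarrow> gvec m a {i} = a i"
  by (simp add: gvec_apply)

lemma ginv_gvec: "ginv (gvec m a) = - gvec m a"
proof
  fix B
  show "ginv (gvec m a) B = (- gvec m a) B"
  proof (cases "\<exists>i. B = {i}")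
    case False
    then have "gvec m a B = 0" by (simp add: gvec_apply)
    then show ?thesis by (simp add: ginv_def)
  qed (auto simp: ginv_def)
qed

lemma scl_left_sum: "scl (\<Sum>i\<in>A. f i) x = (\<Sum>i\<in>A. scl (f i :: 'a::comm_ring_1) x)"
  by (rule ext) (simp add: scl_def sum_fun_apply sum_distrib_right)

lemma gvec_relation:
  "cmul m (gvec m a) (gvec m b) + cmul m (gvec m b) (gvec m a) =
    scl (- 2 * (\<Sum>i\<in>{1..m}. a i * b i)) (cone :: 'a::comm_ring_1 clf)"
proof -
  have expand: "cmul m (gvec m a) (gvec m b) =
      (\<Sum>i\<in>{1..m}. \<Sum>j\<in>{1..m}. scl (a i * b j) (cmul m (ebasis i) (ebasis j)))" for a b :: "nat \<Rightarrow> 'a"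
    by (simp only: gvec_def cmul_sum_left cmul_scl_left)
      (simp only: cmul_sum_right cmul_scl_right scl_sum scl_scl)
  have "cmul m (gvec m b) (gvec m a) =
      (\<Sum>i\<in>{1..m}. \<Sum>j\<in>{1..m}. scl (b j * a i) (cmul m (ebasis j) (ebasis i)))"
    unfolding expand by (rule sum.swap)
  then have "cmul m (gvec m b) (gvec m a) =
      (\<Sum>i\<in>{1..m}. \<Sum>j\<in>{1..m}. scl (a i * b j) (cmul m (ebasis j) (ebasis i)))"
    by (simp only: mult.commute)
  then have "cmul m (gvec m a) (gvec m b) + cmul m (gvec m b) (gvec m a) =
      (\<Sum>i\<in>{1..m}. \<Sum>j\<in>{1..m}. scl (a i * b j)
        (cmul m (ebasis i) (ebasis j) + cmul m (ebasis j) (ebasis i)))"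
    by (simp only: expand[of a b] sum.distrib[symmetric] scl_add)
  also have "\<dots> = (\<Sum>i\<in>{1..m}. \<Sum>j\<in>{1..m}. scl (a i * b j * (if i = j then - 2 else 0)) cone)"
    by (intro sum.cong refl) (simp only: ebasis_relation scl_scl)
  also have "\<dots> = scl (\<Sum>i\<in>{1..m}. \<Sum>j\<in>{1..m}. a i * b j * (if i = j then - 2 else 0)) cone"
    by (simp only: scl_left_sum)
  also have "(\<Sum>i\<in>{1..m}. \<Sum>j\<in>{1..m}. a i * b j * (if i = j then - 2 else 0)) =
      - 2 * (\<Sum>i\<in>{1..m}. a i * b i)"
    unfolding sum_distrib_left
  proof (rule sum.cong[OF refl])
    fix i assume i: "i \<in> {1..m}"
    have "(\<Sum>j\<in>{1..m}. a i * b j * (if i = j then - 2 else 0)) =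
        (\<Sum>j\<in>{1..m}. if j = i then - 2 * (a i * b i) else 0)"
      by (rule sum.cong) (auto simp: algebra_simps)
    then show "(\<Sum>j\<in>{1..m}. a i * b j * (if i = j then - 2 else 0)) = - 2 * (a i * b i)"
      using i by simp
  qed
  finally show ?thesis .
qed

lemma gvec_unit_square:
  fixes a :: "nat \<Rightarrow> 'a::field_char_0"
  assumes "(\<Sum>i\<in>{1..m}. a i * a i) = 1"
  shows "cmul m (gvec m a) (gvec m a) = - cone"
proof
  fix B
  define z where "z = cmul m (gvec m a) (gvec m a) B"
  have "(cmul m (gvec m a) (gvec m a) + cmul m (gvec m a) (gvec m a)) B = scl (- 2 * 1) cone B"
    unfolding gvec_relation assms ..
  then have "z + z = - 2 * cone B"
    by (simp only: plus_fun_apply scl_def mult_1_right z_def)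
  then have "2 * (z + cone B) = 0" by (simp add: algebra_simps)
  then have "z + cone B = 0" using mult_eq_0_iff zero_neq_numeral by metis
  then have "z = - cone B" by (simp only: eq_neg_iff_add_eq_0)
  then show "cmul m (gvec m a) (gvec m a) B = (- cone) B" by (simp add: z_def)
qed

text \<open>Follows from \<open>x u = - u x - 2 (a . b)\<close> and \<open>u ^ 2 = - 1\<close>,
  which also makes \<open>- u\<close> the inverse of \<open>u\<close>. The matrix is
  \<open>- I + 2 a a^T\<close>, the negative of the reflection in the hyperplane orthogonal to
  \<open>a\<close>; in particular it is symmetric.\<close>

lemma gvec_reflect:
  fixes a b :: "nat \<Rightarrow> 'a::field_char_0"
  assumes "(\<Sum>i\<in>{1..m}. a i * a i) = 1"
  shows "cmul m (- gvec m a) (cmul m (gvec m b) (gvec m a)) =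
    gvec m (\<lambda>i. \<Sum>j\<in>{1..m}. ((if i = j then - 1 else 0) + 2 * a i * a j) * b j)"
proof -
  let ?u = "gvec m a" and ?x = "gvec m b" and ?c = "\<Sum>i\<in>{1..m}. a i * b i"
  have rel: "cmul m ?x ?u = scl (- 2 * ?c) cone - cmul m ?u ?x"
    using gvec_relation[of m a b] by (metis add_diff_cancel_left')
  have "cmul m ?u (cmul m ?x ?u) = scl (- 2 * ?c) ?u + ?x"
    unfolding rel cmul_diff_right cmul_scl_right cmul_cone_right[OF clf_on_gvec]
    unfolding cmul_assoc[symmetric] gvec_unit_square[OF assms] cmul_minus_left
      cmul_cone_left[OF clf_on_gvec] by simp
  then have "cmul m (- ?u) (cmul m ?x ?u) = - (scl (- 2 * ?c) ?u + ?x)"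
    by (simp only: cmul_minus_left)
  also have "\<dots> = gvec m (\<lambda>i. \<Sum>j\<in>{1..m}. ((if i = j then - 1 else 0) + 2 * a i * a j) * b j)"
  proof
    fix B
    have t: "(\<Sum>j\<in>{1..m}. ((if i = j then - 1 else 0) + 2 * a i * a j) * b j) = - b i + 2 * ?c * a i"
      if "i \<in> {1..m}" for i
    proof -
      have "(\<Sum>j\<in>{1..m}. ((if i = j then - 1 else 0) + 2 * a i * a j) * b j) =
          (\<Sum>j\<in>{1..m}. (if j = i then - b i else 0) + 2 * a i * (a j * b j))"
        by (rule sum.cong) (auto simp: algebra_simps)
      also have "\<dots> = - b i + 2 * a i * ?c"
        unfolding sum.distrib sum_distrib_left using that by simp
      finally show ?thesis by (simp only: mult_ac)
    qed
    show "(- (scl (- 2 * ?c) ?u + ?x)) B =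
      gvec m (\<lambda>i. \<Sum>j\<in>{1..m}. ((if i = j then - 1 else 0) + 2 * a i * a j) * b j) B"
    proof (cases "\<exists>i\<in>{1..m}. B = {i}")
      case True
      then obtain i where i: "i \<in> {1..m}" "B = {i}" by blast
      show ?thesis unfolding i(2) gvec_singleton[OF i(1)] t[OF i(1)]
        by (simp add: scl_def gvec_singleton[OF i(1)])
    next
      case False
      then have "gvec m d B = 0" for d :: "nat \<Rightarrow> 'a"
        unfolding gvec_apply by (intro sum.neutral) auto
      then show ?thesis by (simp add: scl_def)
    qed
  qed
  finally show ?thesis .
qed

section \<open>Conjugation by a vector preserves grades\<close>

text \<open>Grades are integers because lowering grade 0 leads to grade -1, which contains only
  zero.\<close>

definition graded :: "int \<Rightarrow> 'a::zero clf \<Rightarrow> bool" where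
  "graded g w \<longleftrightarrow> (\<forall>B. w B \<noteq> 0 \<longrightarrow> int (card B) = g)"

lemma cwedge_gvec: "cwedge m (gvec m a) w = (\<Sum>i\<in>{1..m}. scl (a i) (cwedge m (ebasis i) w))"
  and cdot_gvec: "cdot m (gvec m a) w = (\<Sum>i\<in>{1..m}. scl (a i) (cdot m (ebasis i) (w :: 'a::field_char_0 clf)))"
  by (simp_all add: cwedge_alt cdot_alt gvec_def cmul_sum_left cmul_sum_right cmul_scl_left
      cmul_scl_right scl_sum scl_add scl_diff scl_scl sum.distrib sum_subtractf mult.commute)

lemma graded_cwedge:
  fixes w :: "'a::field_char_0 clf"
  assumes "graded g w" shows "graded (g + 1) (cwedge m (gvec m a) w)"
  unfolding graded_def
proof (intro allI impI)
  fix C assume "cwedge m (gvec m a) w C \<noteq> 0"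
  then have "(\<Sum>i\<in>{1..m}. a i * cwedge m (ebasis i) w C) \<noteq> 0"
    by (simp add: cwedge_gvec sum_fun_apply scl_def)
  then obtain i where i: "i \<in> {1..m}" and "a i * cwedge m (ebasis i) w C \<noteq> 0"
    by (meson sum.neutral)
  then have "cwedge m (ebasis i) w C \<noteq> 0" by auto
  then have iC: "i \<in> C" and nz: "cmul m (ebasis i) w C \<noteq> 0"
    unfolding cwedge_ebasis[OF i] by (auto split: if_splits)
  have C: "C \<subseteq> {1..m}" using clf_on_cmul nz unfolding clf_on_def by blast
  have "w (sym_diff {i} C) \<noteq> 0" using nz unfolding cmul_ebasis_left[OF i] by (auto split: if_splits)
  moreover have "sym_diff {i} C = C - {i}" using iC by auto
  ultimately have "int (card (C - {i})) = g" using assms unfolding graded_def by metis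
  moreover have "finite C" using C by (rule finite_subset) simp
  ultimately show "int (card C) = g + 1" using card_Suc_Diff1[OF _ iC] by simp
qed

lemma graded_cdot:
  fixes w :: "'a::field_char_0 clf"
  assumes "graded g w" shows "graded (g - 1) (cdot m (gvec m a) w)"
  unfolding graded_def
proof (intro allI impI)
  fix C assume "cdot m (gvec m a) w C \<noteq> 0"
  then have "(\<Sum>i\<in>{1..m}. a i * cdot m (ebasis i) w C) \<noteq> 0"
    by (simp add: cdot_gvec sum_fun_apply scl_def)
  then obtain i where i: "i \<in> {1..m}" and "a i * cdot m (ebasis i) w C \<noteq> 0"
    by (meson sum.neutral)
  then have "cdot m (ebasis i) w C \<noteq> 0" by auto
  then have iC: "i \<notin> C" and nz: "cmul m (ebasis i) w C \<noteq> 0"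
    unfolding cdot_ebasis[OF i] by (auto split: if_splits)
  have C: "C \<subseteq> {1..m}" using clf_on_cmul nz unfolding clf_on_def by blast
  have "w (sym_diff {i} C) \<noteq> 0" using nz unfolding cmul_ebasis_left[OF i] by (auto split: if_splits)
  moreover have "sym_diff {i} C = insert i C" using iC by auto
  ultimately have "int (card (insert i C)) = g" using assms unfolding graded_def by metis
  moreover have "finite C" using C by (rule finite_subset) simp
  ultimately show "int (card C) = g - 1" using iC by simp
qed

text \<open>Since \<open>u \<and> (u \<and> w) = u \<bullet> (u \<bullet> w) = 0\<close>, only the grade-preserving part
  \<open>u \<bullet> (u \<and> w) - u \<and> (u \<bullet> w)\<close> of \<open>u w u\<close> survives.\<close>

lemma graded_conj_gvec:
  fixes w :: "'a::field_char_0 clf"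
  assumes w: "graded g w"
  shows "graded g (cmul m (cmul m (gvec m a) w) (- gvec m a))"
proof -
  let ?u = "gvec m a" and ?\<epsilon> = "(- 1) powi g :: 'a"
  have gw: "ginv w = scl ?\<epsilon> w" using w by (intro ginv_grade) (auto simp: graded_def)
  then have w': "w = scl ?\<epsilon> (ginv w)" by (simp add: scl_scl minus_one_powi_square)
  have "cmul m (ginv w) ?u = cwedge m ?u w - cdot m ?u w"
    by (simp add: cwedge_def cdot_def fun_eq_iff field_simps)
  \<comment> \<open>\<open>w\<close> equals \<open>ginv w\<close> up to a sign, and
    \<open>ginv w\<close> times \<open>u\<close> is the outer minus the inner product; so right
    multiplication by \<open>u\<close> is expressed by operators acting from the left.\<close>
  then have wu: "cmul m w ?u = scl ?\<epsilon> (cwedge m ?u w - cdot m ?u w)"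
    by (subst w') (simp only: cmul_scl_left)
  have z: "x = 0" if "x = - x" for x :: "'a clf"
    using that by (simp add: fun_eq_iff)
  have "cwedge m ?u (cwedge m ?u w) = 0" "cdot m ?u (cdot m ?u w) = 0"
    by (rule z, rule cwedge_cwedge_anticommute cdot_cdot_anticommute,
        rule ginv_gvec, rule ginv_gvec, rule gvec_relation)+
  then have "cmul m ?u (cwedge m ?u w) = cdot m ?u (cwedge m ?u w)"
    "cmul m ?u (cdot m ?u w) = cwedge m ?u (cdot m ?u w)"
    using cwedge_plus_cdot[of m ?u "cwedge m ?u w"] cwedge_plus_cdot[of m ?u "cdot m ?u w"] by simp_all
  then have "cmul m (cmul m ?u w) (- ?u) =
      - scl ?\<epsilon> (cdot m ?u (cwedge m ?u w) - cwedge m ?u (cdot m ?u w))"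
    by (simp only: cmul_minus_right cmul_assoc wu cmul_scl_right cmul_diff_right)
  moreover have "graded g (cdot m ?u (cwedge m ?u w))" "graded g (cwedge m ?u (cdot m ?u w))"
    using graded_cdot[OF graded_cwedge[OF w], of m a m a] graded_cwedge[OF graded_cdot[OF w], of m a m a]
    by simp_all
  ultimately show ?thesis unfolding graded_def by (simp add: scl_def) (metis diff_0_right)
qed

lemma cof_real_cmul: "cof_real (cmul m a b) = cmul m (cof_real a) (cof_real b :: 'a::real_field clf)"
proof
  fix C
  have "of_real (bsign A B) = (bsign A B :: 'a)" for A B by (simp add: bsign_def)
  then show "cof_real (cmul m a b) C = cmul m (cof_real a) (cof_real b :: 'a clf) C"
    by (simp add: cof_real_def cmul_eq)
qed

lemma cof_real_cone: "cof_real cone = (cone :: 'a::real_field clf)"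
  and cof_real_ebasis: "cof_real (ebasis i) = (ebasis i :: 'a::real_field clf)"
  and cof_real_scl: "cof_real (scl c x) = (scl (of_real c) (cof_real x) :: 'a::real_field clf)"
  and cof_real_minus: "cof_real (- x) = (- cof_real x :: 'a::real_field clf)"
  by (auto simp: cof_real_def cone_def ebasis_def scl_def fun_eq_iff)

lemma cof_real_sum: "cof_real (\<Sum>i\<in>A. f i) = (\<Sum>i\<in>A. cof_real (f i) :: 'a::real_field clf)"
  by (rule ext) (simp add: cof_real_def sum_fun_apply)

lemma cof_real_gvec: "cof_real (gvec m a) = gvec m (\<lambda>i. of_real (a i) :: 'a::real_field)"
  by (simp only: gvec_def cof_real_sum cof_real_scl cof_real_ebasis)

text \<open>The data of \<open>r \<in> Pin(m - 1)\<close> that matter: its inverse \<open>y\<close>, and the matrix \<open>t\<close> of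
  \<open>x \<mapsto> y x r\<close>, which is block diagonal and whose transpose is the matrix of
  \<open>x \<mapsto> r x y\<close>.\<close>

definition pin_data :: "'a::real_field itself \<Rightarrow> nat \<Rightarrow> real clf \<Rightarrow> real clf \<Rightarrow> (nat \<Rightarrow> nat \<Rightarrow> real) \<Rightarrow> bool" where
  "pin_data TYPE('a) m r y t \<longleftrightarrow> clf_on m r \<and> clf_on m y \<and> cmul m r y = cone \<and> cmul m y r = cone
    \<and> (\<forall>x. cmul m y (cmul m (gvec m x) r) = gvec m (\<lambda>i. \<Sum>j\<in>{1..m}. t i j * x j))
    \<and> (\<forall>i\<in>{1..m}. i \<noteq> m \<longrightarrow> t i m = 0 \<and> t m i = 0)
    \<and> (\<forall>i\<in>{1..m}. gvec m (t i) = cmul m (cmul m r (ebasis i)) y)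
    \<and> (\<forall>g (w::'a clf). graded g w \<longrightarrow> graded g (cmul m (cmul m (cof_real r) w) (cof_real y)))"

lemma ebasis_gvec: "i \<in> {1..m} \<Longrightarrow> ebasis i = gvec m (\<lambda>j. if j = i then 1 else (0::'a::comm_ring_1))"
proof -
  assume i: "i \<in> {1..m}"
  have "gvec m (\<lambda>j. if j = i then 1 else 0) = (\<Sum>j\<in>{1..m}. if j = i then ebasis i else (0 :: 'a clf))"
    unfolding gvec_def by (rule sum.cong) (auto simp: scl_def fun_eq_iff)
  then show "ebasis i = gvec m (\<lambda>j. if j = i then 1 else (0::'a))" using i by simp
qed

lemma pin_data_unit:
  assumes m: "m \<ge> 1" and u: "unit_vec_u m u"
  shows "\<exists>y t. pin_data TYPE('a::real_field) m u y t"
proof -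
  obtain a0 where a0: "u = (\<lambda>B. \<Sum>i\<in>{1..m-1}. if B = {i} then a0 i else 0)"
    and n0: "(\<Sum>i\<in>{1..m-1}. (a0 i)^2) = 1"
    using u unfolding unit_vec_u_def by blast
  \<comment> \<open>The value 0 at index \<open>m\<close> makes the matrix below block diagonal,
    with entry -1 at position \<open>(m, m)\<close>.\<close>
  define a where "a i = (if i \<in> {1..m-1} then a0 i else 0)" for i
  have am: "a m = 0" using m by (simp add: a_def)
  have ins: "{1..m} = insert m {1..m-1}" "m \<notin> {1..m-1}" using m by auto
  have u_eq: "u = gvec m a"
  proof
    fix B
    have "gvec m a B = (\<Sum>i\<in>{1..m-1}. if B = {i} then a i else 0)"
      unfolding gvec_apply ins(1) by (subst sum.insert) (use ins(2) am in auto)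
    also have "\<dots> = u B" unfolding a0 by (rule sum.cong) (auto simp: a_def)
    finally show "u B = gvec m a B" ..
  qed
  have "(\<Sum>i\<in>{1..m}. a i * a i) = (\<Sum>i\<in>{1..m-1}. a i * a i)"
    unfolding ins(1) by (subst sum.insert) (use ins(2) am in auto)
  also have "\<dots> = (\<Sum>i\<in>{1..m-1}. (a0 i)^2)"
    by (rule sum.cong) (auto simp: a_def power2_eq_square)
  finally have n: "(\<Sum>i\<in>{1..m}. a i * a i) = 1" using n0 by simp
  define t where "t i j = (if i = j then - 1 else 0) + 2 * a i * a j" for i j
  have T: "cmul m (- u) (cmul m (gvec m x) u) = gvec m (\<lambda>i. \<Sum>j\<in>{1..m}. t i j * x j)" for x
    unfolding u_eq t_def by (rule gvec_reflect[OF n])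
  have "pin_data TYPE('a) m u (- u) t"
    unfolding pin_data_def
  proof (intro conjI allI ballI impI)
    show "clf_on m u" "clf_on m (- u)" by (simp_all add: u_eq clf_on_minus)
    show "cmul m u (- u) = cone" "cmul m (- u) u = cone"
      by (simp_all only: u_eq cmul_minus_left cmul_minus_right gvec_unit_square[OF n] minus_minus)
    show "cmul m (- u) (cmul m (gvec m x) u) = gvec m (\<lambda>i. \<Sum>j\<in>{1..m}. t i j * x j)" for x by (rule T)
    show "t i m = 0" "t m i = 0" if "i \<noteq> m" for i using that am by (auto simp: t_def)
    show "gvec m (t i) = cmul m (cmul m u (ebasis i)) (- u)" if i: "i \<in> {1..m}" for i
    proof -
      \<comment> \<open>The inverse of \<open>u\<close> is \<open>- u\<close>, so conjugating from
        either side is the same map; with the symmetry of \<open>t\<close> this gives the transpose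
        clause.\<close>
      have "cmul m (cmul m u (ebasis i)) (- u) = cmul m (- u) (cmul m (ebasis i) u)"
        by (simp only: cmul_assoc cmul_minus_right cmul_minus_left)
      also have "\<dots> = gvec m (\<lambda>k. \<Sum>j\<in>{1..m}. t k j * (if j = i then 1 else 0))"
        unfolding ebasis_gvec[OF i] by (rule T)
      also have "(\<lambda>k. \<Sum>j\<in>{1..m}. t k j * (if j = i then 1 else 0)) = t i"
      proof
        fix k
        have "(\<Sum>j\<in>{1..m}. t k j * (if j = i then 1 else 0)) = (\<Sum>j\<in>{1..m}. if j = i then t k i else 0)"
          by (rule sum.cong) auto
        then show "(\<Sum>j\<in>{1..m}. t k j * (if j = i then 1 else 0)) = t i k"
          using i by (simp add: t_def)
      qed
      finally show ?thesis ..
    qed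
    show "graded g (cmul m (cmul m (cof_real u) w) (cof_real (- u)))" if "graded g w" for g and w :: "'a clf"
      unfolding u_eq cof_real_minus cof_real_gvec by (rule graded_conj_gvec[OF that])
  qed
  then show ?thesis by blast
qed

lemma pin_data_cone: "\<exists>y t. pin_data TYPE('a::real_field) m cone y t"
proof -
  have s: "(\<Sum>j\<in>{1..m}. (if i = j then 1 else 0) * x j) = x i" if "i \<in> {1..m}" for i and x :: "nat \<Rightarrow> real"
  proof -
    have "(\<Sum>j\<in>{1..m}. (if i = j then 1 else 0) * x j) = (\<Sum>j\<in>{1..m}. if j = i then x i else 0)"
      by (rule sum.cong) auto
    then show ?thesis using that by simp
  qed
  have "pin_data TYPE('a) m cone cone (\<lambda>i j. if i = j then 1 else 0)"
    unfolding pin_data_def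
  proof (intro conjI allI ballI impI)
    show "cmul m cone (cmul m (gvec m x) cone) = gvec m (\<lambda>i. \<Sum>j\<in>{1..m}. (if i = j then 1 else 0) * x j)"
      for x :: "nat \<Rightarrow> real"
    proof -
      have "gvec m (\<lambda>i. \<Sum>j\<in>{1..m}. (if i = j then 1 else 0) * x j) = gvec m x"
        unfolding gvec_def by (rule sum.cong[OF refl]) (simp only: s)
      then show ?thesis by (simp only: cmul_cone_right cmul_cone_left clf_on_gvec)
    qed
    show "gvec m (\<lambda>j. if i = j then 1 else 0) = cmul m (cmul m cone (ebasis i)) (cone :: real clf)"
      if "i \<in> {1..m}" for i
      using ebasis_gvec[OF that, where 'a = real] clf_on_simps(3)[OF that, where 'a = real]
      by (simp add: cmul_cone_left cmul_cone_right eq_commute)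
    show "graded g (cmul m (cmul m (cof_real cone) w) (cof_real cone))" if "graded g w" for g and w :: "'a clf"
    proof -
      have "cmul m (cmul m cone w) cone = cmul m w (cone :: 'a clf)"
        by (simp only: cmul_cone_commute[symmetric] cmul_cone_left clf_on_cmul)
      moreover have "cmul m w cone B \<noteq> 0 \<Longrightarrow> w B \<noteq> 0" for B
      proof -
        assume nz: "cmul m w cone B \<noteq> 0"
        define w' where "w' = (\<lambda>B. if B \<subseteq> {1..m} then w B else 0)"
        have "clf_on m w'" by (auto simp: clf_on_def w'_def)
        moreover have "cmul m w cone = cmul m w' cone"
          by (rule cmul_cong) (auto simp: w'_def)
        ultimately have "w' B \<noteq> 0" using nz by (simp add: cmul_cone_right)
        then show "w B \<noteq> 0" by (auto simp: w'_def split: if_splits)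
      qed
      ultimately show ?thesis using that unfolding cof_real_cone graded_def by metis
    qed
  qed (simp_all add: cmul_cone_left)
  then show ?thesis by blast
qed

text \<open>In \<open>y' (y x u) r\<close> the matrix \<open>t\<close> acts first and
  \<open>t'\<close> second, which gives the product \<open>t' t\<close>. In the transpose clause
  \<open>r\<close> is innermost instead, and expanding \<open>r e_i y'\<close> in basis vectors
  before conjugating by \<open>u\<close> leads to the same matrix.\<close>

lemma pin_data_mult:
  assumes u: "pin_data TYPE('a::real_field) m u y t" and r: "pin_data TYPE('a) m r y' t'"
  shows "pin_data TYPE('a) m (cmul m u r) (cmul m y' y) (\<lambda>i j. \<Sum>l\<in>{1..m}. t' i l * t l j)"
  unfolding pin_data_def
proof (intro conjI allI ballI impI)
  have on: "clf_on m u" "clf_on m y" "clf_on m r" "clf_on m y'"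
    and inv: "cmul m u y = cone" "cmul m y u = cone" "cmul m r y' = cone" "cmul m y' r = cone"
    using u r unfolding pin_data_def by blast+
  show "clf_on m (cmul m u r)" "clf_on m (cmul m y' y)" by simp_all
  have "cmul m (cmul m u r) (cmul m y' y) = cmul m u (cmul m (cmul m r y') y)"
    by (simp only: cmul_assoc)
  then show "cmul m (cmul m u r) (cmul m y' y) = cone" by (simp only: inv on cmul_cone_left)
  have "cmul m (cmul m y' y) (cmul m u r) = cmul m y' (cmul m (cmul m y u) r)"
    by (simp only: cmul_assoc)
  then show "cmul m (cmul m y' y) (cmul m u r) = cone" by (simp only: inv on cmul_cone_left)
  show "cmul m (cmul m y' y) (cmul m (gvec m x) (cmul m u r)) =
    gvec m (\<lambda>i. \<Sum>j\<in>{1..m}. (\<Sum>l\<in>{1..m}. t' i l * t l j) * x j)" for x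
  proof -
    have "cmul m (cmul m y' y) (cmul m (gvec m x) (cmul m u r)) =
        cmul m y' (cmul m (cmul m y (cmul m (gvec m x) u)) r)"
      by (simp only: cmul_assoc)
    also have "cmul m y (cmul m (gvec m x) u) = gvec m (\<lambda>i. \<Sum>j\<in>{1..m}. t i j * x j)"
      using u unfolding pin_data_def by blast
    also have "cmul m y' (cmul m (gvec m (\<lambda>i. \<Sum>j\<in>{1..m}. t i j * x j)) r) =
        gvec m (\<lambda>i. \<Sum>l\<in>{1..m}. t' i l * (\<Sum>j\<in>{1..m}. t l j * x j))"
      using r unfolding pin_data_def by blast
    also have "(\<lambda>i. \<Sum>l\<in>{1..m}. t' i l * (\<Sum>j\<in>{1..m}. t l j * x j)) =
        (\<lambda>i. \<Sum>j\<in>{1..m}. (\<Sum>l\<in>{1..m}. t' i l * t l j) * x j)"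
      unfolding sum_distrib_left sum_distrib_right mult.assoc by (rule ext) (rule sum.swap)
    finally show ?thesis .
  qed
  have tz: "t i m = 0" "t m i = 0" "t' i m = 0" "t' m i = 0" if "i \<in> {1..m}" "i \<noteq> m" for i
    using u r that unfolding pin_data_def by blast+
  show "(\<Sum>l\<in>{1..m}. t' i l * t l m) = 0" if i: "i \<in> {1..m}" "i \<noteq> m" for i
    by (rule sum.neutral) (metis i mult_eq_0_iff tz(1,3))
  show "(\<Sum>l\<in>{1..m}. t' m l * t l i) = 0" if i: "i \<in> {1..m}" "i \<noteq> m" for i
    by (rule sum.neutral) (metis i mult_eq_0_iff tz(2,4))
  show "gvec m (\<lambda>j. \<Sum>l\<in>{1..m}. t' i l * t l j) =
      cmul m (cmul m (cmul m u r) (ebasis i)) (cmul m y' y)" if i: "i \<in> {1..m}" for i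
  proof -
    have "gvec m (\<lambda>j. \<Sum>l\<in>{1..m}. t' i l * t l j) = (\<Sum>l\<in>{1..m}. scl (t' i l) (gvec m (t l)))"
      unfolding gvec_def scl_left_sum scl_sum scl_scl by (rule sum.swap)
    also have "\<dots> = (\<Sum>l\<in>{1..m}. scl (t' i l) (cmul m (cmul m u (ebasis l)) y))"
      by (rule sum.cong[OF refl]) (use u in \<open>simp add: pin_data_def\<close>)
    also have "\<dots> = cmul m (cmul m u (gvec m (t' i))) y"
      by (simp only: gvec_def cmul_sum_left cmul_sum_right cmul_scl_left cmul_scl_right)
    also have "gvec m (t' i) = cmul m (cmul m r (ebasis i)) y'"
      using r i unfolding pin_data_def by blast
    finally show ?thesis by (simp only: cmul_assoc)
  qed
  show "graded g (cmul m (cmul m (cof_real (cmul m u r)) w) (cof_real (cmul m y' y)))"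
    if w: "graded g w" for g and w :: "'a clf"
  proof -
    have "cmul m (cmul m (cof_real (cmul m u r)) w) (cof_real (cmul m y' y)) =
        cmul m (cmul m (cof_real u) (cmul m (cmul m (cof_real r) w) (cof_real y'))) (cof_real y)"
      by (simp only: cof_real_cmul cmul_assoc)
    moreover have "graded g (cmul m (cmul m (cof_real r) w) (cof_real y'))"
      using r w unfolding pin_data_def by blast
    ultimately show ?thesis using u unfolding pin_data_def by metis
  qed
qed

lemma Pin_u_data:
  assumes "m \<ge> 1" "r \<in> Pin_u m"
  obtains y t where "pin_data TYPE('a::real_field) m r y t"
proof -
  have "\<exists>y t. pin_data TYPE('a) m (foldr (cmul m) us cone) y t" if "\<forall>u\<in>set us. unit_vec_u m u" for us
    using that
  proof (induction us)
    case Nil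
    show ?case using pin_data_cone by simp
  next
    case (Cons u us)
    then obtain y' t' where "pin_data TYPE('a) m (foldr (cmul m) us cone) y' t'" by auto
    moreover obtain y t where "pin_data TYPE('a) m u y t"
      using pin_data_unit[OF assms(1), of u] Cons.prems by auto
    ultimately show ?case using pin_data_mult by fastforce
  qed
  then show thesis using assms(2) that unfolding Pin_u_def by blast
qed

section \<open>The H-action of a fixed element of Pin(m - 1)\<close>

context
  fixes m :: nat and r y :: "real clf" and t :: "nat \<Rightarrow> nat \<Rightarrow> real"
  assumes m: "m \<ge> 1" and data: "pin_data TYPE('a::real_field) m r y t"
begin

private definition T :: "(nat \<Rightarrow> real) \<Rightarrow> nat \<Rightarrow> real" where
  "T x = (\<lambda>i. \<Sum>j\<in>{1..m}. t i j * x j)"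

text \<open>The action is split into conjugation of the values, which works coefficient by
  coefficient and keeps the exponents, and the change of variables \<open>T\<close>.\<close>

private definition conj_poly :: "'a cpoly \<Rightarrow> 'a cpoly" where
  "conj_poly P = prmul m (plmul m (cof_real r) P) (cof_real y)"

private lemma on: "clf_on m r" "clf_on m y"
  and inv: "cmul m r y = cone" "cmul m y r = cone"
  and vec: "cmul m y (cmul m (gvec m x) r) = gvec m (T x)"
  and block: "i \<in> {1..m} \<Longrightarrow> i \<noteq> m \<Longrightarrow> t i m = 0" "i \<in> {1..m} \<Longrightarrow> i \<noteq> m \<Longrightarrow> t m i = 0"
  and transp: "i \<in> {1..m} \<Longrightarrow> gvec m (t i) = cmul m (cmul m r (ebasis i)) y"
  and grade: "graded g (w::'a clf) \<Longrightarrow> graded g (cmul m (cmul m (cof_real r) w) (cof_real y))"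
  using data unfolding pin_data_def T_def by blast+

text \<open>\<open>cinv m r\<close> is chosen among all functions, whose coefficients outside
  \<open>{1..m}\<close> are arbitrary, so it may differ from \<open>y\<close>. Products see only its
  truncation, which is \<open>y\<close> by uniqueness of inverses.\<close>

private lemma cinv_cmul:
  "cmul m (cinv m r) w = cmul m y w"
  "cmul m (cmul m (cof_real r) w') (cof_real (cinv m r)) =
    cmul m (cmul m (cof_real r) w') (cof_real y :: 'a clf)"
proof -
  let ?z = "cinv m r"
  have z: "cmul m r ?z = cone \<and> cmul m ?z r = cone"
    unfolding cinv_def by (rule someI[of _ y]) (simp add: inv)
  have "cmul m y (cmul m r ?z) = y" using z by (simp only: cmul_cone_right[OF on(2)])
  then have yz: "y = cmul m cone ?z" by (simp only: cmul_assoc[symmetric] inv)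
  then show "cmul m ?z w = cmul m y w"
    by (simp only: cmul_assoc cmul_cone_left clf_on_cmul)
  have "cmul m v (cof_real y) = cmul m v (cof_real ?z)" if "clf_on m v" for v :: "'a clf"
  proof -
    have "cmul m v (cof_real y) = cmul m (cmul m v cone) (cof_real ?z)"
      by (subst yz) (simp only: cof_real_cmul cof_real_cone cmul_assoc)
    then show ?thesis by (simp only: cmul_cone_right[OF that])
  qed
  then show "cmul m (cmul m (cof_real r) w') (cof_real ?z) =
      cmul m (cmul m (cof_real r) w') (cof_real y)" by simp
qed

private lemma Hfun_peval:
  assumes "is_cpoly m P"
  shows "Hfun m r (peval m P) x = peval m (conj_poly P) (T x)"
proof -
  have "peval m P (\<lambda>i. cmul m (cinv m r) (cmul m (vec_of_pt m x) r) {i}) = peval m P (T x)"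
    by (rule peval_cong) (simp add: cinv_cmul(1) vec_of_pt_eq vec gvec_singleton)
  then show ?thesis
    by (simp only: Hfun_def cinv_cmul(2) conj_poly_def peval_prmul is_cpoly_plmul peval_plmul assms)
qed

private lemma is_cpoly_conj: "is_cpoly m P \<Longrightarrow> is_cpoly m (conj_poly P)"
  unfolding conj_poly_def by (intro is_cpoly_prmul is_cpoly_plmul)

text \<open>Existence comes from substituting \<open>T\<close> in \<open>conj_poly P\<close>,
  uniqueness from injectivity of evaluation; both are needed to unfold the definite
  description.\<close>

private lemma Hpoly_props:
  assumes P: "is_cpoly m P"
  shows "is_cpoly m (Hpoly m r P)" "peval m (Hpoly m r P) x = peval m (conj_poly P) (T x)"
proof -
  have H: "Hfun m r (peval m P) = (\<lambda>x. peval m (conj_poly P) (T x))"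
    by (rule ext) (rule Hfun_peval[OF P])
  obtain Q where Q: "is_cpoly m Q" "\<And>x. peval m Q x = peval m (conj_poly P) (T x)"
    using linear_subst_exists[OF is_cpoly_conj[OF P], of t] unfolding T_def by blast
  have "is_cpoly m (Hpoly m r P) \<and> peval m (Hpoly m r P) = Hfun m r (peval m P)"
    unfolding Hpoly_def
  proof (rule theI[of _ Q])
    show "is_cpoly m Q \<and> peval m Q = Hfun m r (peval m P)"
      using Q unfolding H by blast
    show "Q' = Q" if "is_cpoly m Q' \<and> peval m Q' = Hfun m r (peval m P)" for Q'
    proof (rule peval_inject[OF _ Q(1)])
      show "is_cpoly m Q'" using that by blast
      show "peval m Q' x = peval m Q x" for x using that Q(2) unfolding H by metis
    qed
  qed
  then show "is_cpoly m (Hpoly m r P)" "peval m (Hpoly m r P) x = peval m (conj_poly P) (T x)"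
    unfolding H by simp_all
qed

text \<open>\<open>T\<close> is block diagonal, so setting the last coordinate to zero before or
  after \<open>T\<close> gives the same point, up to coordinates outside \<open>{1..m}\<close> that
  evaluation ignores.\<close>

lemma Hpoly_restr:
  fixes P :: "'a cpoly"
  assumes P: "is_cpoly m P"
  shows "Hpoly m r (restr m P) = restr m (Hpoly m r P)"
proof (rule peval_inject)
  note R = is_cpoly_restr[OF P]
  show "is_cpoly m (Hpoly m r (restr m P))" by (rule Hpoly_props(1)[OF R])
  show "is_cpoly m (restr m (Hpoly m r P))" by (rule is_cpoly_restr[OF Hpoly_props(1)[OF P]])
  fix x
  have "T (x(m := 0)) i = ((T x)(m := 0)) i" if i: "i \<in> {1..m}" for i
  proof (cases "i = m")
    case True
    have "(\<Sum>j\<in>{1..m}. t m j * (x(m := 0)) j) = 0"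
      by (rule sum.neutral) (use block(2) in auto)
    then show ?thesis using True by (simp add: T_def)
  next
    case False
    have "(\<Sum>j\<in>{1..m}. t i j * (x(m := 0)) j) = (\<Sum>j\<in>{1..m}. t i j * x j)"
      by (rule sum.cong) (use block(1)[OF i False] in auto)
    then show ?thesis using False by (simp add: T_def)
  qed
  then have "peval m P (T (x(m := 0))) = peval m P ((T x)(m := 0))" by (rule peval_cong)
  then show "peval m (Hpoly m r (restr m P)) x = peval m (restr m (Hpoly m r P)) x"
    by (simp only: peval_restr[OF m] Hpoly_props P R conj_poly_def peval_prmul peval_plmul
        is_cpoly_plmul)
qed

text \<open>By the chain rule the Dirac operator produces, for each \<open>i\<close>, the vector
  with coordinates \<open>t i j\<close> times \<open>r (pd i P) y\<close>. The transpose clause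
  identifies this vector with \<open>r e_i y\<close>; the adjacent \<open>y r\<close> cancels, and
  summing over \<open>i\<close> leaves \<open>r (dirac m P) y\<close> at \<open>T x\<close>, which
  is zero.\<close>

lemma Hpoly_Hspace:
  fixes P :: "'a cpoly"
  assumes PH: "P \<in> Hspace m k s"
  shows "Hpoly m r P \<in> Hspace m k s"
proof -
  have hP: "P \<in> hpoly m k s" and dP: "dirac m P = 0" using PH by (auto simp: Hspace_def)
  note P = is_cpoly_hpoly[OF hP]
  let ?Q = "Hpoly m r P" and ?R = "cof_real r :: 'a clf" and ?Y = "cof_real y :: 'a clf"
  note Q = Hpoly_props[OF P]
  have gP: "graded s (P \<alpha>)" for \<alpha> using hP unfolding hpoly_iff graded_def by metis
  have h': "conj_poly P \<in> hpoly m k s"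
    unfolding hpoly_iff
  proof (intro allI impI)
    fix \<alpha> B assume nz: "conj_poly P \<alpha> B \<noteq> 0"
    have c: "conj_poly P \<alpha> = cmul m (cmul m ?R (P \<alpha>)) ?Y"
      by (simp only: conj_poly_def prmul_apply plmul_apply)
    have "int (card B) = s" using nz grade[OF gP[of \<alpha>]] unfolding c graded_def by blast
    moreover have "B \<subseteq> {1..m}" using nz clf_on_cmul unfolding c clf_on_def by blast
    moreover have "P \<alpha> \<noteq> 0"
    proof
      assume "P \<alpha> = 0"
      then have "conj_poly P \<alpha> = 0" by (simp only: c cmul_zero_right cmul_zero_left)
      then show False using nz by simp
    qed
    then obtain B' where "P \<alpha> B' \<noteq> 0" by (auto simp: fun_eq_iff)
    then have "(\<forall>i. \<alpha> i \<noteq> 0 \<longrightarrow> i \<in> {1..m}) \<and> (\<Sum>i\<in>{1..m}. \<alpha> i) = k"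
      using hP unfolding hpoly_iff by blast
    ultimately show "(\<forall>i. \<alpha> i \<noteq> 0 \<longrightarrow> i \<in> {1..m}) \<and> B \<subseteq> {1..m} \<and> (\<Sum>i\<in>{1..m}. \<alpha> i) = k \<and> int (card B) = s"
      by blast
  qed
  have hQ: "?Q \<in> hpoly m k s"
    unfolding hpoly_iff
  proof (intro allI impI)
    fix \<alpha> B assume nz: "?Q \<alpha> B \<noteq> 0"
    \<comment> \<open>Doubling commutes with the linear map \<open>T\<close>; through
      \<open>degree_of_peval_scale\<close> this yields the degree of \<open>?Q\<close>, which is
      known only by its values.\<close>
    have T2: "T (\<lambda>i. 2 * x i) = (\<lambda>i. 2 * T x i)" for x
      by (rule ext) (simp add: T_def sum_distrib_left mult.left_commute)
    have "peval m ?Q (\<lambda>i. 2 * x i) = scl (2 ^ k) (peval m ?Q x)" for x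
      unfolding Q(2) T2 using peval_hpoly_scale[OF h', of 2 "T x"] by simp
    then have "(\<Sum>i\<in>{1..m}. \<alpha> i) = k" using nz by (rule degree_of_peval_scale[OF Q(1)])
    \<comment> \<open>\<open>T\<close> changes the argument only, so a blade absent from
      \<open>conj_poly P\<close> gives the zero function in that component of
      \<open>?Q\<close>.\<close>
    moreover have "int (card B) = s"
    proof (rule ccontr)
      assume "int (card B) \<noteq> s"
      then have "conj_poly P \<beta> B = 0" for \<beta> using h' unfolding hpoly_iff by blast
      then have "peval m (conj_poly P) z B = 0" for z by (simp add: peval_def)
      then have "peval m ?Q x B = 0" for x by (simp only: Q(2))
      then have "?Q \<alpha> B = 0" by (rule peval_eq_0D[OF Q(1)])
      then show False using nz by simp
    qed
    ultimately show "(\<forall>i. \<alpha> i \<noteq> 0 \<longrightarrow> i \<in> {1..m}) \<and> B \<subseteq> {1..m} \<and> (\<Sum>i\<in>{1..m}. \<alpha> i) = k \<and> int (card B) = s"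
      using is_cpolyD[OF Q(1), OF nz] by blast
  qed
  have "dirac m ?Q = 0"
  proof (rule peval_inject[OF is_cpoly_dirac[OF Q(1)] is_cpoly_zero])
    fix x
    let ?D = "\<lambda>i. peval m (pd i P) (T x)"
    have pdc: "peval m (pd i (conj_poly P)) (T x) = cmul m (cmul m ?R (?D i)) ?Y" for i
    proof -
      have "pd i (conj_poly P) = prmul m (plmul m ?R (pd i P)) ?Y"
        by (rule ext) (simp only: conj_poly_def pd_apply prmul_apply plmul_apply cmul_scl_left cmul_scl_right)
      then show ?thesis
        by (simp only: peval_prmul is_cpoly_plmul peval_plmul is_cpoly_pd P)
    qed
    have pdQ: "peval m (pd j ?Q) x = (\<Sum>i\<in>{1..m}. scl (of_real (t i j)) (cmul m (cmul m ?R (?D i)) ?Y))"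
      if "j \<in> {1..m}" for j
    proof
      fix B
      have "peval m ?Q x B = peval m (conj_poly P) (\<lambda>i. \<Sum>j\<in>{1..m}. t i j * x j) B" for x
        unfolding Q(2) T_def ..
      from peval_linear_subst_pd[OF is_cpoly_conj[OF P] Q(1) this that, of x, folded T_def]
      show "peval m (pd j ?Q) x B =
          (\<Sum>i\<in>{1..m}. scl (of_real (t i j)) (cmul m (cmul m ?R (?D i)) ?Y)) B"
        unfolding sum_fun_apply scl_def pdc[symmetric] .
    qed
    have "peval m (dirac m ?Q) x = (\<Sum>j\<in>{1..m}. \<Sum>i\<in>{1..m}.
        cmul m (scl (of_real (t i j)) (ebasis j)) (cmul m (cmul m ?R (?D i)) ?Y))"
      unfolding peval_dirac[OF Q(1)]
      by (intro sum.cong refl) (simp only: pdQ cmul_sum_right cmul_scl_left cmul_scl_right)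
    also have "\<dots> = (\<Sum>i\<in>{1..m}. \<Sum>j\<in>{1..m}.
        cmul m (scl (of_real (t i j)) (ebasis j)) (cmul m (cmul m ?R (?D i)) ?Y))"
      by (rule sum.swap)
    also have "\<dots> = (\<Sum>i\<in>{1..m}. cmul m (cmul m ?R (cmul m (ebasis i) (?D i))) ?Y)"
    proof (rule sum.cong[OF refl])
      fix i assume i: "i \<in> {1..m}"
      have "(\<Sum>j\<in>{1..m}. scl (of_real (t i j)) (ebasis j)) = (cof_real (gvec m (t i)) :: 'a clf)"
        unfolding cof_real_gvec unfolding gvec_def ..
      also have "\<dots> = cmul m (cmul m ?R (ebasis i)) ?Y"
        by (simp only: transp[OF i] cof_real_cmul cof_real_ebasis)
      finally have e: "(\<Sum>j\<in>{1..m}. scl (of_real (t i j)) (ebasis j)) = cmul m (cmul m ?R (ebasis i)) ?Y" .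
      have YR: "cmul m ?Y ?R = cone"
        by (simp only: cof_real_cmul[symmetric] inv cof_real_cone)
      have "(\<Sum>j\<in>{1..m}. cmul m (scl (of_real (t i j)) (ebasis j)) (cmul m (cmul m ?R (?D i)) ?Y)) =
          cmul m (cmul m (cmul m ?R (ebasis i)) ?Y) (cmul m (cmul m ?R (?D i)) ?Y)"
        by (simp only: cmul_sum_left[symmetric] e)
      also have "\<dots> = cmul m ?R (cmul m (ebasis i) (cmul m (cmul m ?Y ?R) (cmul m (?D i) ?Y)))"
        by (simp only: cmul_assoc)
      also have "\<dots> = cmul m (cmul m ?R (cmul m (ebasis i) (?D i))) ?Y"
        by (simp only: YR cmul_cone_left clf_on_cmul cmul_assoc)
      finally show "(\<Sum>j\<in>{1..m}. cmul m (scl (of_real (t i j)) (ebasis j)) (cmul m (cmul m ?R (?D i)) ?Y)) =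
          cmul m (cmul m ?R (cmul m (ebasis i) (?D i))) ?Y" .
    qed
    also have "\<dots> = cmul m (cmul m ?R (peval m (dirac m P) (T x))) ?Y"
      by (simp only: peval_dirac[OF P] cmul_sum_left cmul_sum_right)
    also have "peval m (dirac m P) (T x) = 0"
      unfolding dP by (simp add: peval_def fun_eq_iff)
    also have "cmul m (cmul m ?R 0) ?Y = peval m 0 x"
      by (simp add: peval_def fun_eq_iff)
    finally show "peval m (dirac m ?Q) x = peval m 0 x" .
  qed
  then show ?thesis using hQ by (simp add: Hspace_def)
qed

end

text \<open>Since \<open>p\<close> is the restriction of \<open>CK m p\<close>, both claims are read
  off from the monogenic polynomial \<open>Hpoly m r (CK m p)\<close>: its restriction is
  \<open>Hpoly m r p\<close>, and \<open>CK m\<close> recovers it from there.\<close>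

lemma Hpoly_CK:
  fixes p :: "'a::real_field cpoly"
  assumes m: "m \<ge> 1" and r: "r \<in> Pin_u m" and p: "p \<in> Ispace m k s"
  shows "Hpoly m r p \<in> Ispace m k s" "CK m (Hpoly m r p) = Hpoly m r (CK m p)"
proof -
  obtain y t where data: "pin_data TYPE('a) m r y t" using Pin_u_data[OF m r] by blast
  note H = CK_in_Hspace[OF m p]
  then have "is_cpoly m (CK m p)" unfolding Hspace_def hpoly_def by blast
  from Hpoly_restr[OF m data this]
  have eq: "Hpoly m r p = restr m (Hpoly m r (CK m p))"
    unfolding restr_CK[OF restr_Ispace[OF m p]] .
  note H' = Hpoly_Hspace[OF m data H]
  show "Hpoly m r p \<in> Ispace m k s" unfolding eq by (rule restr_in_Ispace[OF m H'])
  show "CK m (Hpoly m r p) = Hpoly m r (CK m p)"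
    unfolding eq by (rule Hspace_eq_CK(2)[OF m H', symmetric])
qed

text \<open>The class \<open>real_field\<close> covers real and complex coefficients, hence both
  Clifford algebras. Integer grades and \<open>powi\<close> keep \<open>s - 1\<close> meaningful for
  \<open>s = 0\<close>, where \<open>Ker_minus\<close> contains only zero.\<close>

theorem theorem2:
  fixes m s k :: nat
  assumes "2 \<le> m" and "s \<le> m"
  shows
    "(\<forall>p\<in>Ispace m k (int s). \<forall>q\<in>Ispace m k (int s). \<forall>c::'a::{real_field}.
        CK m (p + q) = CK m p + CK m q \<and> CK m (psmul c p) = psmul c (CK m p))
   \<and> bij_betw (CK m) (Ispace m k (int s) :: 'a cpoly set) (Hspace m k (int s))
   \<and> (\<forall>r\<in>Pin_u m. \<forall>p\<in>(Ispace m k (int s) :: 'a cpoly set).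
        Hpoly m r p \<in> Ispace m k (int s) \<and> CK m (Hpoly m r p) = Hpoly m r (CK m p))
   \<and> (\<forall>u0\<in>(Ker_plus m k (int s) :: 'a cpoly set). \<forall>v0\<in>Ker_minus m k (int s - 1).
        CK m (u0 + prmul m v0 (ebasis m)) =
          (\<Sum>j\<le>k. psmul (1 / fact j) (mulx m j
              (if even j then ((dplus m \<circ> dminus m) ^^ (j div 2)) u0
               else psmul ((-1) powi (int s - 1)) (((dplus m \<circ> dminus m) ^^ (j div 2)) (dplus m v0)))))
        + (\<Sum>j\<le>k. psmul (1 / fact j) (mulx m j (prmul m
              (if even j then ((dminus m \<circ> dplus m) ^^ (j div 2)) v0
               else psmul ((-1) powi (int s - 1)) (((dminus m \<circ> dplus m) ^^ (j div 2)) (dminus m u0)))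
              (ebasis m)))))
   \<and> (\<forall>p\<in>(Hspace m k (int s) :: 'a cpoly set).
        restr m p \<in> Ispace m k (int s) \<and> p = CK m (restr m p))"
proof (intro conjI ballI allI)
  have m: "m \<ge> 1" using assms by simp
  fix p q :: "'a cpoly" and c :: 'a and r and u0 v0 :: "'a cpoly"
  show "CK m (p + q) = CK m p + CK m q" by (rule CK_add)
  show "CK m (psmul c p) = psmul c (CK m p)" by (rule CK_psmul)
  show "bij_betw (CK m) (Ispace m k (int s) :: 'a cpoly set) (Hspace m k (int s))"
    by (rule bij_betw_CK[OF m])
  show "Hpoly m r p \<in> Ispace m k (int s)" "CK m (Hpoly m r p) = Hpoly m r (CK m p)"
    if "r \<in> Pin_u m" "p \<in> Ispace m k (int s)"
    using Hpoly_CK[OF m that] by blast+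
  show "restr m p \<in> Ispace m k (int s)" "p = CK m (restr m p)" if "p \<in> Hspace m k (int s)"
    by (rule restr_in_Ispace[OF m that], rule Hspace_eq_CK(2)[OF m that])
qed (rule CK_formula[unfolded ck_u_def ck_v_def], use assms in simp_all)

end
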